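(* For every integer $N\ge 3$, the spectral gap $\lambda(N)$ of the Kac walk on $S^{N-1}$ satisfies $$\lambda(N)=\bigl(3\,\lambda(3)-1\bigr)\left(1-\frac{2}{N}\right)+\frac1N .$$ In particular, with $\lambda(3)=\frac{5}{12}$, it follows that $$\lambda(N)=\frac{N+2}{4N},\qquad N\ge 2.$$
   Context: For $N\ge 2$ let $S^{N-1}=\{\eta\in\mathbb{R}^N:\ \sum_{i=1}^N\eta_i^2=1\}$ and let $\nu$ be the uniform probability measure on $S^{N-1}$. For $i\neq j$ and $\theta\in[0,2\pi)$, let $R_\theta^{ij}$ be the clockwise rotation of angle $\theta$ in the coordinate plane $(\eta_i,\eta_j)$ (leaving the other coordinates fixed), and let $R_\theta^{ii}=\mathrm{Id}$. The generator of the Kac walk is the bounded self-adjoint operator on $L^2(\nu)$ $$\mathcal{L}f(\eta)=\frac{1}{2N}\sum_{i,j=1}^N\frac{1}{2\pi}\int_0^{2\pi}\bigl[f(R_\theta^{ij}\eta)-f(\eta)\bigr]\,d\theta .$$ Its spectral gap is $$\lambda(N)=\inf\left\{\frac{\nu(f(-\mathcal{L})f)}{\nu(f^2)}:\ f\in L^2(\nu),\ f\ne 0,\ \nu(f)=0\right\},$$ where $\nu(g)=\int g\,d\nu$. *)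

theory Defs
  imports "HOL-Probability.Probability"
begin

text \<open>
  The coordinate index set \<open>{1,\<dots>,N}\<close> is a finite type \<open>'n\<close>, with \<open>N = CARD('n)\<close>, and
  \<open>S\<^sup>N\<^sup>-\<^sup>1\<close> is \<^term>\<open>sphere (0 :: real ^ 'n) 1\<close>.

  The uniform probability measure is normalised surface measure, obtained from polar coordinates:
  the measure of \<open>A\<close> is the proportion of the unit ball occupied by the cone over \<open>A\<close>. Here
  \<^term>\<open>sgn x\<close> is \<open>x / norm x\<close>.  The lemmas below show that it is a probability measure
  invariant under all orthogonal maps, which determines it.
\<close>

definition sphere_measure :: "(real ^ 'n) measure" where
  "sphere_measure =
     restrict_space (distr (uniform_measure lborel (ball 0 1)) borel sgn) (sphere 0 1)"

lemma space_sphere_measure: "space (sphere_measure :: (real ^ 'n) measure) = sphere 0 1"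
  by (simp add: sphere_measure_def space_restrict_space)

lemma sets_sphere_measure:
  "sets (sphere_measure :: (real ^ 'n) measure) = sets (restrict_space borel (sphere 0 1))"
  by (simp add: sphere_measure_def sets_restrict_space)

lemma emeasure_sphere_measure:
  assumes "A \<in> sets borel" "A \<subseteq> sphere (0 :: real ^ 'n) 1"
  shows "emeasure sphere_measure A =
    emeasure lborel (ball 0 1 \<inter> sgn -` A) / emeasure lborel (ball (0 :: real ^ 'n) 1)"
proof -
  have s: "sgn \<in> borel_measurable (borel :: (real ^ 'n) measure)"
    unfolding sgn_div_norm by measurable
  have m: "sgn -` A \<in> sets (borel :: (real ^ 'n) measure)"
    using measurable_sets[OF s assms(1)] by simp
  show ?thesis
    using assms s m
    by (simp add: sphere_measure_def emeasure_restrict_space emeasure_distr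
          uniform_measure_def[symmetric] closed_sphere)
qed

lemma emeasure_lborel_unit_ball:
  "emeasure lborel (ball (0 :: real ^ 'n) 1) \<noteq> 0" "emeasure lborel (ball (0 :: real ^ 'n) 1) \<noteq> \<top>"
  using emeasure_lborel_ball_finite[of "0 :: real ^ 'n" 1] content_ball_pos[of 1 "0 :: real ^ 'n"]
  by (auto simp: measure_def)

text \<open>
  The library has this fact for Lebesgue measurable sets only over well-ordered index types; the
  proof below uses uniqueness of translation-invariant measures instead.
\<close>

lemma emeasure_lborel_orthogonal_vimage:
  fixes T :: "real ^ 'n \<Rightarrow> real ^ 'n"
  assumes T: "orthogonal_transformation T" and C: "C \<in> sets borel"
  shows "emeasure lborel (T -` C) = emeasure lborel C"
proof -
  let ?B = "ball (0 :: real ^ 'n) 1"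
  define f :: "real ^ 'n \<Rightarrow> ennreal" where "f = indicator ?B"
  define h :: "real ^ 'n \<Rightarrow> ennreal" where "h = indicator C"
  have lin: "linear T" and nT: "\<And>x. norm (T x) = norm x"
    using T by (auto simp: orthogonal_transformation)
  have [measurable]: "T \<in> borel_measurable borel"
    by (intro borel_measurable_continuous_onI linear_continuous_on)
       (use lin in \<open>simp add: linear_conv_bounded_linear\<close>)
  have [measurable]: "f \<in> borel_measurable borel" "h \<in> borel_measurable borel"
    using C by (auto simp: f_def h_def intro!: borel_measurable_indicator)
  have trans: "(\<integral>\<^sup>+x. g (c + x) \<partial>lborel) = (\<integral>\<^sup>+x. g x \<partial>lborel)"
    if [measurable]: "g \<in> borel_measurable borel" for g :: "real ^ 'n \<Rightarrow> ennreal" and c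
    by (subst (2) lborel_distr_plus[of c, symmetric]) (simp add: nn_integral_distr)
  have f_minus: "f (x - y) = f (y - x)" for x y
    by (simp add: f_def indicator_def norm_minus_commute)
  have f_eq: "f (x - w) = f (T x - T w)" for x w
    by (simp add: f_def indicator_def nT flip: linear_diff[OF lin])
  have f_int: "(\<integral>\<^sup>+x. f x \<partial>lborel) = emeasure lborel ?B"
    by (simp add: f_def)
  have "emeasure lborel ?B * emeasure lborel C = (\<integral>\<^sup>+x. f x * (\<integral>\<^sup>+y. h (T x + y) \<partial>lborel) \<partial>lborel)"
    by (subst trans, measurable) (use C in \<open>simp add: nn_integral_multc f_int h_def\<close>)
  also have "\<dots> = (\<integral>\<^sup>+x. (\<integral>\<^sup>+y. f x * h (T x + y) \<partial>lborel) \<partial>lborel)"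
    by (intro nn_integral_cong) (simp add: nn_integral_cmult)
  also have "\<dots> = (\<integral>\<^sup>+y. (\<integral>\<^sup>+x. f x * h (T x + y) \<partial>lborel) \<partial>lborel)"
    by (rule lborel_pair.Fubini') measurable
  also have "\<dots> = (\<integral>\<^sup>+y. (\<integral>\<^sup>+x. f (T x - y) * h (T x) \<partial>lborel) \<partial>lborel)"
  proof (rule nn_integral_cong)
    fix y :: "real ^ 'n"
    obtain w where w: "y = T w"
      using orthogonal_transformation_surj[OF T] by (metis surjD)
    have "(\<integral>\<^sup>+x. f x * h (T x + y) \<partial>lborel) =
        (\<integral>\<^sup>+x. (\<lambda>x. f (T x - y) * h (T x)) (w + x) \<partial>lborel)"
      by (intro nn_integral_cong)
         (simp add: w linear_add[OF lin] f_def indicator_def nT add.commute)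
    also have "\<dots> = (\<integral>\<^sup>+x. f (T x - y) * h (T x) \<partial>lborel)"
      by (rule trans) measurable
    finally show "(\<integral>\<^sup>+x. f x * h (T x + y) \<partial>lborel) = (\<integral>\<^sup>+x. f (T x - y) * h (T x) \<partial>lborel)" .
  qed
  also have "\<dots> = (\<integral>\<^sup>+x. (\<integral>\<^sup>+y. f (T x - y) * h (T x) \<partial>lborel) \<partial>lborel)"
    by (rule lborel_pair.Fubini') measurable
  also have "\<dots> = (\<integral>\<^sup>+x. (\<integral>\<^sup>+y. f (- T x + y) \<partial>lborel) * h (T x) \<partial>lborel)"
    by (subst f_minus) (simp add: nn_integral_multc)
  also have "\<dots> = emeasure lborel ?B * (\<integral>\<^sup>+x. h (T x) \<partial>lborel)"
    by (subst trans, measurable) (simp add: f_int nn_integral_cmult)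
  also have "(\<integral>\<^sup>+x. h (T x) \<partial>lborel) = (\<integral>\<^sup>+x. indicator (T -` C) x \<partial>lborel)"
    by (simp add: h_def indicator_def)
  also have "\<dots> = emeasure lborel (T -` C)"
    using measurable_sets[of T borel borel C] C by (subst nn_integral_indicator) auto
  finally show ?thesis
    using emeasure_lborel_unit_ball by (auto simp: ennreal_mult_cancel_left)
qed

lemma prob_space_sphere_measure: "prob_space (sphere_measure :: (real ^ 'n) measure)"
proof
  let ?B = "ball (0 :: real ^ 'n) 1"
  have e: "?B \<inter> sgn -` sphere 0 1 = ?B - {0}"
    by (auto simp: norm_sgn split: if_splits)
  have "emeasure lborel (?B - {0}) = emeasure lborel ?B"
    by (rule emeasure_Diff_null_set) auto
  moreover have "emeasure lborel ?B / emeasure lborel ?B = 1"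
    using emeasure_lborel_unit_ball by (intro ennreal_divide_self) (auto simp: less_top)
  ultimately show "emeasure sphere_measure (space (sphere_measure :: (real ^ 'n) measure)) = 1"
    unfolding space_sphere_measure
    by (subst emeasure_sphere_measure) (auto simp: e closed_sphere borel_closed)
qed

lemma sphere_measure_orthogonal_invariant:
  fixes T :: "real ^ 'n \<Rightarrow> real ^ 'n"
  assumes T: "orthogonal_transformation T"
  shows "distr sphere_measure sphere_measure T = sphere_measure"
proof -
  let ?B = "ball (0 :: real ^ 'n) 1"
  have lin: "linear T" and nT: "\<And>x. norm (T x) = norm x"
    using T by (auto simp: orthogonal_transformation)
  have mT: "T \<in> borel_measurable borel"
    by (intro borel_measurable_continuous_onI linear_continuous_on)
       (use lin in \<open>simp add: linear_conv_bounded_linear\<close>)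
  have sT: "sgn (T x) = T (sgn x)" for x
    by (simp add: sgn_div_norm nT linear_scale[OF lin])
  have s: "sgn \<in> borel_measurable (borel :: (real ^ 'n) measure)"
    unfolding sgn_div_norm by measurable
  have inv: "emeasure lborel (T -` C) = emeasure lborel C" if "C \<in> sets borel" for C
    using emeasure_lborel_orthogonal_vimage[OF T that] .
  have mT': "T \<in> measurable sphere_measure (sphere_measure :: (real ^ 'n) measure)"
    unfolding measurable_cong_sets[OF sets_sphere_measure sets_sphere_measure]
    by (intro measurable_restrict_space3 mT) (auto simp: nT)
  show ?thesis
  proof (rule measure_eqI)
    fix A assume "A \<in> sets (distr sphere_measure (sphere_measure :: (real ^ 'n) measure) T)"
    then have A': "A \<in> sets (sphere_measure :: (real ^ 'n) measure)" by simp
    then have A: "A \<in> sets borel" "A \<subseteq> sphere 0 1"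
      by (auto simp: sets_sphere_measure sets_restrict_space_iff closed_sphere borel_closed)
    have TA: "T -` A \<in> sets borel" using measurable_sets[OF mT A(1)] by simp
    have TAs: "T -` A \<subseteq> sphere 0 1" using A(2) nT by auto
    have sA: "sgn -` A \<in> sets borel" using measurable_sets[OF s A(1)] by simp
    have eq: "?B \<inter> sgn -` (T -` A) = T -` (?B \<inter> sgn -` A)"
      by (auto simp: sT nT)
    have "emeasure (distr sphere_measure sphere_measure T) A = emeasure sphere_measure (T -` A)"
      using TAs by (simp add: emeasure_distr[OF mT' A'] space_sphere_measure Int_absorb2)
    also have "\<dots> = emeasure sphere_measure A"
      using sA by (simp add: emeasure_sphere_measure A TA TAs eq inv del: vimage_Int)
    finally show "emeasure (distr sphere_measure sphere_measure T) A = emeasure sphere_measure A" .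
  qed simp
qed

definition kac_rotation :: "'n \<Rightarrow> 'n \<Rightarrow> real \<Rightarrow> real ^ 'n \<Rightarrow> real ^ 'n" where
  "kac_rotation i j \<theta> \<eta> =
     (if i = j then \<eta>
      else (\<chi> k. if k = i then cos \<theta> * \<eta> $ i + sin \<theta> * \<eta> $ j
                 else if k = j then cos \<theta> * \<eta> $ j - sin \<theta> * \<eta> $ i
                 else \<eta> $ k))"

text \<open>
  The generator acts on a representative \<open>f\<close> of a class in \<open>L\<^sup>2\<close>; for almost every \<open>\<eta>\<close> all the
  integrands below are integrable, and the class of the result does not depend on the representative.
\<close>

definition kac_generator :: "(real ^ 'n \<Rightarrow> real) \<Rightarrow> real ^ 'n \<Rightarrow> real" where
  "kac_generator f \<eta> =
     1 / (2 * real CARD('n)) *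
       (\<Sum>i\<in>UNIV. \<Sum>j\<in>UNIV.
          1 / (2 * pi) * (LINT \<theta>:{0..2 * pi}|lborel. f (kac_rotation i j \<theta> \<eta>) - f \<eta>))"

definition L2_functions :: "'a measure \<Rightarrow> ('a \<Rightarrow> real) set" where
  "L2_functions M = {f \<in> borel_measurable M. integrable M (\<lambda>x. (f x)\<^sup>2)}"

definition kac_gap :: "'n::finite itself \<Rightarrow> real" where
  "kac_gap _ =
     Inf {(\<integral>\<eta>. f \<eta> * (- kac_generator f \<eta>) \<partial>sphere_measure) / (\<integral>\<eta>. (f \<eta>)\<^sup>2 \<partial>sphere_measure)
          | f :: real ^ 'n \<Rightarrow> real.
            f \<in> L2_functions sphere_measure \<and>
            \<not> (AE \<eta> in sphere_measure. f \<eta> = 0) \<and>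
            (\<integral>\<eta>. f \<eta> \<partial>sphere_measure) = 0}"

end

theory Submission
  imports Defs "HOL-Library.Function_Algebras"
begin

text \<open>
  Following Caputo, write \<open>-L = (1 / 2N) A\<close> with \<open>A = \<Sum>\<^sub>i\<^sub>j D\<^sub>i\<^sub>j\<close>, where \<open>1 - D\<^sub>i\<^sub>j\<close> is the orthogonal
  projection that averages over the rotations of the plane \<open>(i, j)\<close>. Expand \<open>A\<^sup>2\<close>: products over
  disjoint pairs are nonnegative, and the remaining terms group into triangles, for which
  \<open>D = D\<^sub>i\<^sub>j + D\<^sub>i\<^sub>k + D\<^sub>j\<^sub>k\<close> satisfies \<open>D\<^sup>2 \<ge> (5/4) D\<close>. This gives \<open>A\<^sup>2 \<ge> ((N + 2) / 2) A\<close>.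

  The three projections of a triangle average about the three axes, so their ranges consist of
  functions of one coordinate. These ranges interact only within the same Legendre degree, with Gram
  matrix governed by the value at 0 of the Legendre polynomial, which is \<open>-1/2, 3/8, ...\<close> in the
  degrees \<open>2, 4, ...\<close>; the largest eigenvalue is \<open>1 + 2 (3/8) = 3 - 5/4\<close>.

  All of this takes place on polynomials. Since \<open>A\<close> preserves the degree, a Krylov argument replaces
  the spectral theorem: a polynomial of mean zero lies in the range of \<open>A\<close>, where \<open>A\<^sup>2 \<ge> c A\<close> implies
  \<open>A \<ge> c\<close>. Density of polynomials extends the gap to all of \<open>L\<^sup>2\<close>, and
  \<open>\<Sum>\<^sub>i \<eta>\<^sub>i\<^sup>4 - 3 / (N + 2)\<close> is an eigenfunction that attains it.
\<close>

section \<open>Integration over the sphere\<close>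

text \<open>How the constants fit: if \<open>D^2 \<ge> (5/4) D\<close>, the three cross terms of a
  triangle are at least \<open>(5/4 - 1)/2 = 1/8\<close> of the sum of the three squares. Each pair
  lies in \<open>N - 2\<close> triangles, so \<open>A^2\<close> dominates
  \<open>(2 + (N - 2)/2) A\<close>, and dividing by \<open>2N\<close> gives the gap.

  The obstacle in a triangle is that \<open>f\<close> depends on all \<open>N\<close> coordinates,
  so the problem does not live on a two-dimensional sphere. The Legendre coefficients are functions
  of the remaining coordinates and of the radius of the three chosen ones. The three averages treat
  such functions as scalars, and homogenising the Legendre polynomials by the radius keeps
  everything polynomial. Orthogonality of the degrees then comes from self-adjointness, because the
  values at 0 are distinct.

  Degree 0 is exceptional: the three ranges share it, the Gram matrix has eigenvalue 3 there, and
  \<open>D\<close> vanishes on it. It has to be subtracted before the bound \<open>7/4\<close>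
  applies. Odd degrees vanish at 0, so they are orthogonal across axes and can stay
  unexpanded.\<close>

abbreviation \<nu> :: "(real ^ 'n) measure" where
  "\<nu> \<equiv> sphere_measure"

abbreviation (input) L2_sphere :: "(real ^ 'n \<Rightarrow> real) set" where
  "L2_sphere \<equiv> L2_functions \<nu>"

abbreviation (input) sq_norm :: "(real ^ 'n \<Rightarrow> real) \<Rightarrow> real" where
  "sq_norm f \<equiv> \<integral>x. (f x)\<^sup>2 \<partial>\<nu>"

abbreviation (input) sq_dist :: "(real ^ 'n \<Rightarrow> real) \<Rightarrow> (real ^ 'n \<Rightarrow> real) \<Rightarrow> real" where
  "sq_dist f g \<equiv> \<integral>x. (f x - g x)\<^sup>2 \<partial>\<nu>"

lemma measurable_sphere_measureI:
  fixes f :: "real ^ 'n \<Rightarrow> 'a::topological_space"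
  assumes "continuous_on (sphere 0 1) f"
  shows "f \<in> borel_measurable (\<nu> :: (real ^ 'n) measure)"
  using assms borel_measurable_continuous_on_restrict
  by (subst measurable_cong_sets[OF sets_sphere_measure refl]) auto

lemma integrable_sphere_measureI:
  fixes f :: "real ^ 'n \<Rightarrow> real"
  assumes "continuous_on (sphere 0 1) f"
  shows "integrable \<nu> f"
proof -
  interpret prob_space "\<nu> :: (real ^ 'n) measure"
    by (rule prob_space_sphere_measure)
  have "compact (f ` sphere 0 1)"
    using assms by (intro compact_continuous_image) auto
  then have "bounded (f ` sphere 0 1)"
    by (rule compact_imp_bounded)
  then obtain B where "\<forall>x \<in> sphere 0 1. norm (f x) \<le> B"
    by (auto simp: bounded_iff)
  then show ?thesis
    using measurable_sphere_measureI[OF assms]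
    by (intro integrable_const_bound[where B = B]) (auto simp: space_sphere_measure)
qed

text \<open>The cone over \<open>U\<close> in the punctured ball is open and contains
  \<open>x / 2\<close>, so it is not negligible. This is what turns almost-everywhere statements
  about continuous functions into pointwise ones.\<close>

lemma emeasure_sphere_measure_open_pos:
  fixes U :: "(real ^ 'n) set"
  assumes "open U" "x \<in> U" "x \<in> sphere 0 1"
  shows "emeasure \<nu> (U \<inter> sphere 0 1) \<noteq> 0"
proof -
  let ?C = "sgn -` U \<inter> (ball 0 1 - {0 :: real ^ 'n})"
  have "continuous_on (ball 0 1 - {0 :: real ^ 'n}) sgn"
    by (intro continuous_intros) auto
  then have "open ?C"
    using assms(1) by (metis Int_commute open_delete continuous_on_open_vimage open_ball)
  moreover have "(1/2) *\<^sub>R x \<in> ?C"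
    using assms by (auto simp: sgn_div_norm)
  ultimately have "\<not> negligible ?C"
    by (metis empty_iff open_not_negligible)
  moreover have "?C \<in> sets lborel"
    using \<open>open ?C\<close> by simp
  ultimately have that: "emeasure lborel ?C \<noteq> 0"
    by (auto simp: negligible_iff_null_sets null_sets_def)
  have eq: "ball 0 1 \<inter> sgn -` (U \<inter> sphere 0 1) = ?C"
    by (auto simp: norm_sgn split: if_splits)
  have "U \<inter> sphere 0 1 \<in> sets borel"
    using assms by (auto simp: borel_closed)
  then show ?thesis
    using that emeasure_lborel_unit_ball[where 'n = 'n]
    by (subst emeasure_sphere_measure) (auto simp: eq ennreal_divide_eq_0_iff simp del: vimage_Int)
qed

lemma continuous_eq_0_on_sphere:
  fixes f :: "real ^ 'n \<Rightarrow> real"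
  assumes f: "continuous_on UNIV f" and 0: "AE \<eta> in \<nu>. f \<eta> = 0" and x: "norm x = 1"
  shows "f x = 0"
proof (rule ccontr)
  assume "f x \<noteq> 0"
  let ?U = "f -` (- {0})"
  have "open ?U"
    using f by (intro open_vimage) (auto simp: continuous_on_eq_continuous_at)
  then have "emeasure \<nu> (?U \<inter> sphere 0 1) \<noteq> 0"
    using \<open>f x \<noteq> 0\<close> x by (intro emeasure_sphere_measure_open_pos[of _ x]) auto
  moreover have "?U \<inter> sphere 0 1 = {\<eta> \<in> space \<nu>. f \<eta> \<noteq> 0}"
    by (auto simp: space_sphere_measure)
  moreover have "f \<in> borel_measurable \<nu>"
    using f by (intro measurable_sphere_measureI) (auto intro: continuous_on_subset)
  ultimately show False
    using 0 by (subst (asm) AE_iff_measurable[OF _ refl]) auto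
qed

section \<open>Plane rotations\<close>

lemma kac_rotation_same [simp]: "kac_rotation i i \<theta> \<eta> = \<eta>"
  by (simp add: kac_rotation_def)

lemma kac_rotation_nth:
  "i \<noteq> j \<Longrightarrow> kac_rotation i j \<theta> \<eta> $ k =
     (if k = i then cos \<theta> * \<eta> $ i + sin \<theta> * \<eta> $ j
      else if k = j then cos \<theta> * \<eta> $ j - sin \<theta> * \<eta> $ i else \<eta> $ k)"
  by (simp add: kac_rotation_def)

lemma sum_split2:
  fixes g :: "'n::finite \<Rightarrow> 'b::comm_monoid_add"
  assumes "i \<noteq> j"
  shows "sum g UNIV = g i + g j + sum g (UNIV - {i, j})"
proof -
  have "UNIV - {i, j} = UNIV - {i} - {j}" by auto
  then show ?thesis
    using assms sum.remove[of UNIV i g] sum.remove[of "UNIV - {i}" j g] by (simp add: add.assoc)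
qed

lemma sum_squares_rotated:
  "(cos \<theta> * x + sin \<theta> * y)\<^sup>2 + (cos \<theta> * y - sin \<theta> * x)\<^sup>2 = x\<^sup>2 + (y :: real)\<^sup>2"
proof -
  have "(cos \<theta> * x + sin \<theta> * y)\<^sup>2 + (cos \<theta> * y - sin \<theta> * x)\<^sup>2 =
      ((sin \<theta>)\<^sup>2 + (cos \<theta>)\<^sup>2) * (x\<^sup>2 + y\<^sup>2)"
    by algebra
  then show ?thesis by simp
qed

lemma orthogonal_transformation_kac_rotation:
  "orthogonal_transformation (kac_rotation i j \<theta> :: real ^ 'n \<Rightarrow> real ^ 'n)"
proof (cases "i = j")
  case False
  have "linear (kac_rotation i j \<theta> :: real ^ 'n \<Rightarrow> real ^ 'n)"
    using False by (auto simp: kac_rotation_def algebra_simps vec_eq_iff intro!: linearI)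
  moreover have "norm (kac_rotation i j \<theta> v) = norm v" for v :: "real ^ 'n"
  proof -
    have "(\<Sum>k\<in>UNIV - {i, j}. (kac_rotation i j \<theta> v $ k)\<^sup>2) = (\<Sum>k\<in>UNIV - {i, j}. (v $ k)\<^sup>2)"
      using False by (intro sum.cong) (auto simp: kac_rotation_nth)
    then show ?thesis
      using False
      by (simp add: norm_vec_def L2_set_def sum_split2[OF False] kac_rotation_nth sum_squares_rotated)
  qed
  ultimately show ?thesis
    by (simp add: orthogonal_transformation)
qed (auto simp: kac_rotation_def[abs_def] orthogonal_transformation_id)

lemma norm_kac_rotation [simp]: "norm (kac_rotation i j \<theta> \<eta>) = norm \<eta>"
  using orthogonal_transformation_kac_rotation orthogonal_transformation_norm by blast

lemma continuous_on_kac_rotation [continuous_intros]: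
  fixes g :: "'a::t2_space \<Rightarrow> real"
  assumes "continuous_on X g" "continuous_on X h"
  shows "continuous_on X (\<lambda>x. kac_rotation i j (g x) (h x))"
proof (cases "i = j")
  case False
  have "continuous_on X (\<lambda>x. kac_rotation i j (g x) (h x) $ k)" for k
    unfolding kac_rotation_nth[OF False] using assms
    by (cases "k = i"; cases "k = j") (auto intro!: continuous_intros)
  then have "continuous_on X (\<lambda>x. \<chi> k. kac_rotation i j (g x) (h x) $ k)"
    by (intro continuous_on_vec_lambda)
  then show ?thesis
    by simp
qed (use assms in simp)

lemma measurable_kac_rotation_sphere:
  "kac_rotation i j \<theta> \<in> measurable \<nu> (\<nu> :: (real ^ 'n) measure)"
proof -
  have "kac_rotation i j \<theta> \<in> borel_measurable (borel :: (real ^ 'n) measure)"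
    by (intro borel_measurable_continuous_onI continuous_intros)
  then show ?thesis
    unfolding measurable_cong_sets[OF sets_sphere_measure sets_sphere_measure]
    by (intro measurable_restrict_space3) auto
qed

lemma integral_kac_rotation:
  fixes f :: "real ^ 'n \<Rightarrow> real"
  assumes "f \<in> borel_measurable \<nu>"
  shows "(\<integral>\<eta>. f (kac_rotation i j \<theta> \<eta>) \<partial>\<nu>) = (\<integral>\<eta>. f \<eta> \<partial>\<nu>)"
  using integral_distr[OF measurable_kac_rotation_sphere assms, of i j \<theta>]
  by (simp add: sphere_measure_orthogonal_invariant orthogonal_transformation_kac_rotation)

lemma kac_rotation_swap: "kac_rotation j i \<theta> \<eta> = kac_rotation i j (- \<theta>) \<eta>"
  by (auto simp: kac_rotation_def vec_eq_iff)

section \<open>Polynomial functions\<close>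

definition monom_fun :: "('n \<Rightarrow> nat) \<Rightarrow> real ^ 'n \<Rightarrow> real" where
  "monom_fun \<alpha> \<eta> = (\<Prod>i\<in>UNIV. \<eta> $ i ^ \<alpha> i)"

text \<open>A property of the function on the whole space, not of a formal expression or of its
  restriction to the sphere. Compositions with rotations can then be compared extensionally, and the
  rules give induction over monomials.\<close>

inductive mpoly :: "nat \<Rightarrow> (real ^ 'n \<Rightarrow> real) \<Rightarrow> bool" for d where
  zero: "mpoly d 0"
| step: "mpoly d f \<Longrightarrow> sum \<alpha> UNIV \<le> d \<Longrightarrow> mpoly d ((\<lambda>_. c) * monom_fun \<alpha> + f)"

lemma monom_fun_mult: "monom_fun \<alpha> * monom_fun \<beta> = monom_fun (\<alpha> + \<beta>)"
  by (simp add: monom_fun_def fun_eq_iff power_add prod.distrib)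

lemma monom_fun_0 [simp]: "monom_fun 0 = 1"
  by (simp add: monom_fun_def fun_eq_iff)

lemma mpoly_monom: "sum \<alpha> UNIV \<le> d \<Longrightarrow> mpoly d ((\<lambda>_. c) * monom_fun \<alpha>)"
  using mpoly.step[OF mpoly.zero, of \<alpha> d c] by simp

lemma mpoly_const [simp]: "mpoly d (\<lambda>_. c)"
  using mpoly_monom[of "0 :: 'a \<Rightarrow> nat" d c] by (simp add: one_fun_def times_fun_def)

lemma mpoly_add: "mpoly d f \<Longrightarrow> mpoly d g \<Longrightarrow> mpoly d (f + g)"
  by (induction rule: mpoly.induct) (auto simp: add.assoc intro: mpoly.intros)

lemma mpoly_mono: "mpoly d f \<Longrightarrow> d \<le> e \<Longrightarrow> mpoly e f"
  by (induction rule: mpoly.induct) (auto intro: mpoly.intros)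

lemma mpoly_monom_mult:
  assumes "mpoly e g" "sum \<alpha> UNIV \<le> d"
  shows "mpoly (d + e) ((\<lambda>_. c) * monom_fun \<alpha> * g)"
  using assms
proof (induction rule: mpoly.induct)
  case (step g \<beta> b)
  have eq: "(\<lambda>_. c) * monom_fun \<alpha> * ((\<lambda>_. b) * monom_fun \<beta> + g) =
      (\<lambda>_. c * b) * monom_fun (\<alpha> + \<beta>) + (\<lambda>_. c) * monom_fun \<alpha> * g"
    unfolding monom_fun_mult[symmetric] by (simp add: fun_eq_iff algebra_simps)
  show ?case
    unfolding eq
  proof (rule mpoly.step)
    show "sum (\<alpha> + \<beta>) UNIV \<le> d + e"
      using step.hyps step.prems by (simp add: sum.distrib)
  qed (use step in blast)
qed (simp add: mpoly.zero)

lemma mpoly_mult: "mpoly d f \<Longrightarrow> mpoly e g \<Longrightarrow> mpoly (d + e) (f * g)"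
  by (induction rule: mpoly.induct)
    (auto simp: distrib_right intro: mpoly.intros mpoly_add mpoly_monom_mult)

lemma mpoly_smult: "mpoly d f \<Longrightarrow> mpoly d ((\<lambda>_. c) * f)"
  using mpoly_mult[OF mpoly_const[of 0 c], of d f] by simp

lemma mpoly_diff: "mpoly d f \<Longrightarrow> mpoly d g \<Longrightarrow> mpoly d (f - g)"
  using mpoly_add[of d f "(\<lambda>_. - 1) * g"] mpoly_smult[of d g "- 1"]
  by (simp add: fun_diff_def plus_fun_def times_fun_def)

lemma mpoly_nth: "mpoly 1 (\<lambda>\<eta>. \<eta> $ i)"
proof -
  have "monom_fun (\<lambda>j. of_bool (j = i)) = (\<lambda>\<eta>. \<eta> $ i)"
    by (simp add: monom_fun_def fun_eq_iff of_bool_def if_distrib[of "power _"] prod.delta cong: if_cong)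
  moreover have "sum (\<lambda>j. of_bool (j = i)) UNIV = (1 :: nat)"
    by (simp add: of_bool_def)
  ultimately show ?thesis
    using mpoly_monom[of "\<lambda>j. of_bool (j = i)" 1 1] by (simp add: times_fun_def)
qed

lemma mpoly_power: "mpoly d f \<Longrightarrow> mpoly (n * d) (\<lambda>\<eta>. f \<eta> ^ n)"
  by (induction n) (auto dest!: mpoly_mult[of d f] simp: times_fun_def)

lemma mpoly_sum: "(\<And>x. x \<in> X \<Longrightarrow> mpoly d (f x)) \<Longrightarrow> mpoly d (\<Sum>x\<in>X. f x)"
  by (induction X rule: infinite_finite_induct) (auto intro: mpoly_add mpoly.zero)

lemma sum_fun_apply [simp]: "(\<Sum>x\<in>X. f x) y = (\<Sum>x\<in>X. f x y)"
  for f :: "'a \<Rightarrow> 'b \<Rightarrow> real"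
  by (induction X rule: infinite_finite_induct) auto

lemma finite_exponents: "finite {\<alpha> :: 'n::finite \<Rightarrow> nat. sum \<alpha> UNIV \<le> d}"
proof (rule finite_subset)
  show "{\<alpha> :: 'n \<Rightarrow> nat. sum \<alpha> UNIV \<le> d} \<subseteq> Pi\<^sub>E UNIV (\<lambda>_. {..d})"
  proof
    fix \<alpha> :: "'n \<Rightarrow> nat" assume "\<alpha> \<in> {\<alpha>. sum \<alpha> UNIV \<le> d}"
    moreover have "\<alpha> i \<le> sum \<alpha> UNIV" for i
      by (rule member_le_sum) auto
    ultimately show "\<alpha> \<in> Pi\<^sub>E UNIV (\<lambda>_. {..d})"
      by (auto simp: PiE_UNIV_domain intro: order_trans)
  qed
qed (simp add: finite_PiE)

text \<open>Finite dimensionality of the polynomials of bounded degree: the iterates of a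
  degree-preserving operator must become linearly dependent.\<close>

lemma mpoly_finite_combination:
  assumes "mpoly d f"
  shows "\<exists>a. f = (\<Sum>\<alpha>\<in>{\<alpha>. sum \<alpha> UNIV \<le> d}. (\<lambda>_. a \<alpha>) * monom_fun \<alpha>)"
  using assms
proof (induction rule: mpoly.induct)
  case zero
  show ?case by (rule exI[of _ "\<lambda>_. 0"]) (simp add: fun_eq_iff)
next
  case (step f \<beta> c)
  then obtain a where a: "f = (\<Sum>\<alpha>\<in>{\<alpha>. sum \<alpha> UNIV \<le> d}. (\<lambda>_. a \<alpha>) * monom_fun \<alpha>)" by blast
  have "(\<Sum>\<alpha>\<in>{\<alpha>. sum \<alpha> UNIV \<le> d}. (a \<alpha> + (if \<alpha> = \<beta> then c else 0)) * monom_fun \<alpha> \<eta>) =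
     c * monom_fun \<beta> \<eta> + f \<eta>" for \<eta>
    using step(2) finite_exponents[of d]
    by (simp add: a distrib_right sum.distrib if_distrib[of "\<lambda>x. x * _"] sum.delta'
        if_distribR cong: if_cong) (subst sum.delta, auto)
  then show ?case
    by (intro exI[of _ "\<lambda>\<alpha>. a \<alpha> + (if \<alpha> = \<beta> then c else 0)"]) (simp add: fun_eq_iff)
qed

definition poly_fun :: "(real ^ 'n \<Rightarrow> real) \<Rightarrow> bool" where
  "poly_fun f \<longleftrightarrow> (\<exists>d. mpoly d f)"

lemma mpoly_imp_poly_fun: "mpoly d f \<Longrightarrow> poly_fun f"
  by (auto simp: poly_fun_def)

lemma poly_fun_add [simp]: "poly_fun f \<Longrightarrow> poly_fun g \<Longrightarrow> poly_fun (f + g)"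
  unfolding poly_fun_def by (metis mpoly_add mpoly_mono nat_le_linear)

lemma poly_fun_diff [simp]: "poly_fun f \<Longrightarrow> poly_fun g \<Longrightarrow> poly_fun (f - g)"
  unfolding poly_fun_def by (metis mpoly_diff mpoly_mono nat_le_linear)

lemma poly_fun_mult [simp]: "poly_fun f \<Longrightarrow> poly_fun g \<Longrightarrow> poly_fun (f * g)"
  unfolding poly_fun_def by (metis mpoly_mult)

lemma poly_fun_const [simp]: "poly_fun (\<lambda>_. c)"
  using mpoly_const[of 0 c] by (auto simp: poly_fun_def)

lemma poly_fun_0 [simp]: "poly_fun 0"
  by (simp add: zero_fun_def)

lemma poly_fun_nth [simp]: "poly_fun (\<lambda>\<eta>. \<eta> $ i)"
  by (auto simp: poly_fun_def intro: mpoly_nth)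

lemma poly_fun_sum [simp]: "(\<And>x. x \<in> X \<Longrightarrow> poly_fun (f x)) \<Longrightarrow> poly_fun (\<Sum>x\<in>X. f x)"
  by (induction X rule: infinite_finite_induct) auto

lemma poly_fun_pointwise [simp]:
  "poly_fun f \<Longrightarrow> poly_fun g \<Longrightarrow> poly_fun (\<lambda>\<eta>. f \<eta> + g \<eta>)"
  "poly_fun f \<Longrightarrow> poly_fun g \<Longrightarrow> poly_fun (\<lambda>\<eta>. f \<eta> - g \<eta>)"
  "poly_fun f \<Longrightarrow> poly_fun g \<Longrightarrow> poly_fun (\<lambda>\<eta>. f \<eta> * g \<eta>)"
  using poly_fun_add[of f g] poly_fun_diff[of f g] poly_fun_mult[of f g]
  by (simp_all add: plus_fun_def fun_diff_def times_fun_def)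

lemma poly_fun_power [simp]: "poly_fun f \<Longrightarrow> poly_fun (\<lambda>\<eta>. f \<eta> ^ n)"
  by (induction n) auto

lemma poly_fun_sum_pointwise [simp]:
  "(\<And>x. x \<in> X \<Longrightarrow> poly_fun (f x)) \<Longrightarrow> poly_fun (\<lambda>\<eta>. \<Sum>x\<in>X. f x \<eta>)"
  by (induction X rule: infinite_finite_induct) auto

lemma poly_fun_prod_pointwise [simp]:
  "(\<And>x. x \<in> X \<Longrightarrow> poly_fun (f x)) \<Longrightarrow> poly_fun (\<lambda>\<eta>. \<Prod>x\<in>X. f x \<eta>)"
  by (induction X rule: infinite_finite_induct) auto

lemma poly_fun_monom [simp]: "poly_fun (monom_fun \<alpha>)"
  using poly_fun_prod_pointwise[of UNIV "\<lambda>i \<eta>. \<eta> $ i ^ \<alpha> i"]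
  by (simp add: monom_fun_def[abs_def])

lemma poly_fun_induct [consumes 1, case_names zero step]:
  assumes "poly_fun f" "P 0"
    "\<And>c \<alpha> f. poly_fun f \<Longrightarrow> P f \<Longrightarrow> P ((\<lambda>_. c) * monom_fun \<alpha> + f)"
  shows "P f"
proof -
  from assms(1) obtain d where "mpoly d f" by (auto simp: poly_fun_def)
  then show ?thesis
    by (induction rule: mpoly.induct) (blast intro: assms(2,3) mpoly_imp_poly_fun)+
qed

lemma continuous_on_poly_fun: "poly_fun f \<Longrightarrow> continuous_on X f"
proof (induction rule: poly_fun_induct)
  case (step c \<alpha> f)
  then show ?case
    by (auto simp: plus_fun_def times_fun_def monom_fun_def intro!: continuous_intros)
qed (simp add: zero_fun_def)

lemma real_polynomial_function_imp_poly_fun: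
  fixes f :: "real ^ 'n \<Rightarrow> real"
  assumes "real_polynomial_function f"
  shows "poly_fun f"
  using assms
proof (induction rule: real_polynomial_function.induct)
  case (linear f)
  have "f \<eta> = (\<Sum>i\<in>UNIV. \<eta> $ i * f (axis i 1))" for \<eta>
  proof -
    interpret bounded_linear f by fact
    have "f (\<Sum>i\<in>UNIV. \<eta> $ i *\<^sub>R axis i 1) = (\<Sum>i\<in>UNIV. \<eta> $ i * f (axis i 1))"
      by (simp add: sum scale)
    moreover have "(\<Sum>i\<in>UNIV. \<eta> $ i *\<^sub>R axis i 1) = \<eta>"
      by (simp add: vec_eq_iff axis_def if_distrib cong: if_cong)
    ultimately show ?thesis by simp
  qed
  then have eq: "f = (\<lambda>\<eta>. \<Sum>i\<in>UNIV. \<eta> $ i * f (axis i 1))"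
    by (rule ext)
  show ?case
    by (subst eq) simp
qed auto

section \<open>The inner product of square integrable functions, on polynomials\<close>

definition nu_inner :: "(real ^ 'n \<Rightarrow> real) \<Rightarrow> (real ^ 'n \<Rightarrow> real) \<Rightarrow> real" where
  "nu_inner f g = (\<integral>\<eta>. f \<eta> * g \<eta> \<partial>\<nu>)"

lemma integrable_poly_fun [simp]: "poly_fun f \<Longrightarrow> integrable \<nu> f"
  by (intro integrable_sphere_measureI continuous_on_poly_fun)

lemma nu_inner_commute: "nu_inner f g = nu_inner g f"
  by (simp add: nu_inner_def mult.commute)

lemma nu_inner_add_left [simp]:
  "poly_fun f \<Longrightarrow> poly_fun g \<Longrightarrow> poly_fun h \<Longrightarrow>
    nu_inner (f + g) h = nu_inner f h + nu_inner g h"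
  by (simp add: nu_inner_def distrib_right)

lemma nu_inner_diff_left [simp]:
  "poly_fun f \<Longrightarrow> poly_fun g \<Longrightarrow> poly_fun h \<Longrightarrow>
    nu_inner (f - g) h = nu_inner f h - nu_inner g h"
  by (simp add: nu_inner_def left_diff_distrib)

lemma nu_inner_smult_left [simp]: "nu_inner ((\<lambda>_. c) * f) h = c * nu_inner f h"
  by (simp add: nu_inner_def mult.assoc)

lemma nu_inner_zero_left [simp]: "nu_inner 0 h = 0"
  by (simp add: nu_inner_def)

lemma nu_inner_sum_left [simp]:
  "(\<And>x. x \<in> X \<Longrightarrow> poly_fun (f x)) \<Longrightarrow> poly_fun h \<Longrightarrow>
    nu_inner (\<Sum>x\<in>X. f x) h = (\<Sum>x\<in>X. nu_inner (f x) h)"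
  by (induction X rule: infinite_finite_induct) auto

lemma nu_inner_right [simp]:
  "poly_fun f \<Longrightarrow> poly_fun g \<Longrightarrow> poly_fun h \<Longrightarrow>
    nu_inner h (f + g) = nu_inner h f + nu_inner h g"
  "poly_fun f \<Longrightarrow> poly_fun g \<Longrightarrow> poly_fun h \<Longrightarrow>
    nu_inner h (f - g) = nu_inner h f - nu_inner h g"
  "nu_inner h ((\<lambda>_. c) * f) = c * nu_inner h f"
  "nu_inner h 0 = 0"
  by (simp_all add: nu_inner_commute[of h])

lemma nu_inner_sum_right [simp]:
  "(\<And>x. x \<in> X \<Longrightarrow> poly_fun (f x)) \<Longrightarrow> poly_fun h \<Longrightarrow>
    nu_inner h (\<Sum>x\<in>X. f x) = (\<Sum>x\<in>X. nu_inner h (f x))"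
  by (simp add: nu_inner_commute[of h])

lemma nu_inner_nonneg [simp]: "nu_inner f f \<ge> 0"
  by (simp add: nu_inner_def)

lemma nu_inner_Cauchy_Schwarz:
  assumes [simp]: "poly_fun f" "poly_fun g"
  shows "(nu_inner f g)\<^sup>2 \<le> nu_inner f f * nu_inner g g"
proof -
  let ?a = "nu_inner f f" and ?b = "nu_inner g g" and ?c = "nu_inner f g"
  have *: "0 \<le> x\<^sup>2 * ?a - 2 * x * y * ?c + y\<^sup>2 * ?b" for x y
  proof -
    have "0 \<le> nu_inner ((\<lambda>_. x) * f - (\<lambda>_. y) * g) ((\<lambda>_. x) * f - (\<lambda>_. y) * g)"
      by (rule nu_inner_nonneg)
    also have "\<dots> = x * (x * ?a - y * ?c) - y * (x * ?c - y * ?b)"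
      by (simp add: nu_inner_commute[of g f])
    finally show ?thesis
      by (simp add: algebra_simps power2_eq_square)
  qed
  show ?thesis
  proof (cases "?b = 0")
    case True
    have "?c = 0"
    proof (rule ccontr)
      assume "?c \<noteq> 0"
      \<comment> \<open>For \<open>x = 1\<close> and this \<open>y\<close> the quadratic expression
        equals \<open>?a - (?a + 1) = -1\<close>.\<close>
      with *[of 1 "(?a + 1) / (2 * ?c)"] True show False
        by (simp add: field_simps)
    qed
    then show ?thesis by (simp add: True)
  next
    case False
    then have "?b > 0" using nu_inner_nonneg[of g] by linarith
    moreover have "0 \<le> ?b * (?a * ?b - ?c\<^sup>2)"
      using *[of ?b ?c] by (simp add: algebra_simps power2_eq_square)
    ultimately show ?thesis by (simp add: zero_le_mult_iff)
  qed
qed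

text \<open>\<open>nu_inner\<close> is only semidefinite on polynomials: the squared norm minus 1
  vanishes on the sphere without being 0. Null functions are therefore discarded through
  Cauchy--Schwarz.\<close>

lemma nu_inner_null:
  "poly_fun f \<Longrightarrow> poly_fun g \<Longrightarrow> nu_inner g g = 0 \<Longrightarrow> nu_inner f g = 0"
  using nu_inner_Cauchy_Schwarz[of f g] by simp

lemma nu_inner_eq_0_imp:
  assumes f: "poly_fun f" and 0: "nu_inner f f = 0" and x: "norm x = 1"
  shows "f x = 0"
proof (rule continuous_eq_0_on_sphere[OF continuous_on_poly_fun[OF f] _ x])
  have "AE \<eta> in \<nu>. f \<eta> * f \<eta> = 0"
    using 0 f unfolding nu_inner_def
    by (subst (asm) integral_nonneg_eq_0_iff_AE) auto
  then show "AE \<eta> in \<nu>. f \<eta> = 0" by simp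
qed

section \<open>Averages over plane rotations\<close>

definition circle_mean :: "(real \<Rightarrow> real) \<Rightarrow> real" where
  "circle_mean g = 1 / (2 * pi) * (LINT \<theta>:{0..2 * pi}|lborel. g \<theta>)"

lemma set_integrable_circle:
  "continuous_on UNIV g \<Longrightarrow> set_integrable lborel {0..2 * pi} (g :: real \<Rightarrow> real)"
  by (intro borel_integrable_atLeastAtMost') (auto intro: continuous_on_subset)

lemma circle_mean_add:
  "continuous_on UNIV f \<Longrightarrow> continuous_on UNIV g \<Longrightarrow>
    circle_mean (\<lambda>\<theta>. f \<theta> + g \<theta>) = circle_mean f + circle_mean g"
  by (simp add: circle_mean_def set_integral_add set_integrable_circle distrib_left)

lemma circle_mean_mult: "circle_mean (\<lambda>\<theta>. c * g \<theta>) = c * circle_mean g"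
  by (simp add: circle_mean_def)

lemma circle_mean_const [simp]: "circle_mean (\<lambda>\<theta>. c) = c"
  by (simp add: circle_mean_def set_lebesgue_integral_def)

lemma circle_mean_HK:
  "continuous_on UNIV g \<Longrightarrow> circle_mean g = 1 / (2 * pi) * integral {0..2 * pi} g"
  using set_borel_integral_eq_integral(2)[OF set_integrable_circle, of g]
  by (simp add: circle_mean_def)

text \<open>The shifted interval is cut at 0, and its negative piece is moved by one period to the
  right end.\<close>

lemma circle_mean_shift:
  assumes g: "continuous_on UNIV g" and per: "\<And>x. g (x + 2 * pi) = g x"
    and t: "0 \<le> t" "t \<le> 2 * pi"
  shows "circle_mean (\<lambda>\<theta>. g (\<theta> - t)) = circle_mean g"
proof -
  have int: "g integrable_on {a..b}" for a b
    using g by (intro integrable_continuous_real) (auto intro: continuous_on_subset)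
  have "integral {0..2 * pi} (\<lambda>x. g (x - t)) = integral {-t..2 * pi - t} g"
    using integral_shift_Icc_real[of 0 "2 * pi" g "-t"] by (simp add: o_def)
  also have "\<dots> = integral {-t..0} g + integral {0..2 * pi - t} g"
    using t by (intro Henstock_Kurzweil_Integration.integral_combine[symmetric] int) auto
  also have "integral {-t..0} g = integral {-t..0} (g \<circ> (+) (2 * pi))"
    by (simp add: o_def per add.commute[of "2 * pi"])
  also have "\<dots> = integral {2 * pi - t..2 * pi} g"
    by (subst integral_shift_Icc_real) simp
  also have "\<dots> + integral {0..2 * pi - t} g = integral {0..2 * pi} g"
    using t by (subst add.commute, intro Henstock_Kurzweil_Integration.integral_combine int) auto
  finally show ?thesis
    using g by (subst (1 2) circle_mean_HK) (auto intro!: continuous_on_compose2[OF g] continuous_intros)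
qed

lemma circle_mean_reflect:
  assumes g: "continuous_on UNIV g" and per: "\<And>x. g (x + 2 * pi) = g x"
  shows "circle_mean (\<lambda>\<theta>. g (- \<theta>)) = circle_mean g"
proof -
  have "integral {0..2 * pi} (\<lambda>x. g (- x)) = integral {- (2 * pi)..0} g"
    using Henstock_Kurzweil_Integration.integral_reflect_real[where a = "- (2 * pi)" and b = 0 and f = g] by simp
  also have "\<dots> = integral {- (2 * pi)..0} (g \<circ> (+) (2 * pi))"
    by (simp add: o_def per add.commute[of "2 * pi"])
  also have "\<dots> = integral {0..2 * pi} g"
    by (subst integral_shift_Icc_real) simp
  finally show ?thesis
    using g by (subst (1 2) circle_mean_HK) (auto intro!: continuous_on_compose2[OF g] continuous_intros)
qed

text \<open>The moments of a point on the unit circle. The clockwise rotation takes the first basis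
  vector to \<open>(cos \<theta>, - sin \<theta>)\<close>, hence the sign.\<close>

definition circ :: "nat \<Rightarrow> nat \<Rightarrow> real" where
  "circ a b = circle_mean (\<lambda>\<theta>. cos \<theta> ^ a * (- sin \<theta>) ^ b)"

lemma circle_mean_shift_monomial:
  assumes "0 \<le> t" "t \<le> 2 * pi"
  shows "circle_mean (\<lambda>\<theta>. cos (\<theta> - t) ^ a * (- sin (\<theta> - t)) ^ b) = circ a b"
  unfolding circ_def
proof (rule circle_mean_shift[of "\<lambda>\<theta>. cos \<theta> ^ a * (- sin \<theta>) ^ b" t])
  show "continuous_on UNIV (\<lambda>\<theta> :: real. cos \<theta> ^ a * (- sin \<theta>) ^ b)"
    by (intro continuous_intros)
qed (use assms in simp_all)

text \<open>In polar coordinates \<open>(x, y) = (r cos t, r sin t)\<close> the rotation only shifts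
  the angle by \<open>t\<close>, which the mean over a period ignores; homogeneity supplies the
  power of \<open>r\<close>.\<close>

lemma circle_mean_rotated_monomial:
  "circle_mean (\<lambda>\<theta>. (cos \<theta> * x + sin \<theta> * y) ^ a * (cos \<theta> * y - sin \<theta> * x) ^ b) =
     circ a b * sqrt (x\<^sup>2 + y\<^sup>2) ^ (a + b)"
proof -
  define r where "r = sqrt (x\<^sup>2 + y\<^sup>2)"
  have "\<exists>t. 0 \<le> t \<and> t \<le> 2 * pi \<and> x = r * cos t \<and> y = r * sin t"
  proof (cases "r = 0")
    case True
    then show ?thesis by (auto simp: r_def sum_power2_eq_zero_iff intro: exI[of _ 0])
  next
    case False
    then have "(x / r)\<^sup>2 + (y / r)\<^sup>2 = 1"
      by (simp add: r_def power_divide add_divide_distrib[symmetric])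
    then obtain t where "0 \<le> t" "t < 2 * pi" "x / r = cos t" "y / r = sin t"
      using sincos_total_2pi by blast
    then show ?thesis
      using False by (intro exI[of _ t]) (auto simp: field_simps)
  qed
  then obtain t where t: "0 \<le> t" "t \<le> 2 * pi" and xy: "x = r * cos t" "y = r * sin t"
    by blast
  have "cos \<theta> * x + sin \<theta> * y = r * cos (\<theta> - t)" for \<theta>
    by (simp add: xy cos_diff algebra_simps)
  moreover have "cos \<theta> * y - sin \<theta> * x = r * (- sin (\<theta> - t))" for \<theta>
    by (simp add: xy sin_diff algebra_simps)
  ultimately have "(cos \<theta> * x + sin \<theta> * y) ^ a * (cos \<theta> * y - sin \<theta> * x) ^ b =
      r ^ (a + b) * (cos (\<theta> - t) ^ a * (- sin (\<theta> - t)) ^ b)" for \<theta>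
    by (simp only: power_mult_distrib power_add) (simp add: mult_ac)
  then have "circle_mean (\<lambda>\<theta>. (cos \<theta> * x + sin \<theta> * y) ^ a * (cos \<theta> * y - sin \<theta> * x) ^ b) =
      r ^ (a + b) * circle_mean (\<lambda>\<theta>. cos (\<theta> - t) ^ a * (- sin (\<theta> - t)) ^ b)"
    by (subst circle_mean_mult[symmetric]) (rule arg_cong[where f = circle_mean], rule ext)
  also have "circle_mean (\<lambda>\<theta>. cos (\<theta> - t) ^ a * (- sin (\<theta> - t)) ^ b) = circ a b"
    using t by (rule circle_mean_shift_monomial)
  finally show ?thesis
    by (simp add: r_def)
qed

text \<open>A half turn changes the sign. Odd powers of the square root in the preceding formula
  thus have coefficient 0, which is why averages of polynomials are polynomials.\<close>

lemma circ_odd: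
  assumes "odd (a + b)"
  shows "circ a b = 0"
proof -
  have "circle_mean (\<lambda>\<theta>. cos (\<theta> - pi) ^ a * (- sin (\<theta> - pi)) ^ b) = circ a b"
    by (rule circle_mean_shift_monomial) auto
  moreover have "cos (\<theta> - pi) ^ a * (- sin (\<theta> - pi)) ^ b =
      - 1 * (cos \<theta> ^ a * (- sin \<theta>) ^ b)" for \<theta>
  proof -
    have "cos (\<theta> - pi) = (- 1) * cos \<theta>" "- sin (\<theta> - pi) = (- 1) * (- sin \<theta>)"
      by (simp_all add: cos_diff sin_diff)
    then have "cos (\<theta> - pi) ^ a * (- sin (\<theta> - pi)) ^ b =
        (- 1) ^ (a + b) * (cos \<theta> ^ a * (- sin \<theta>) ^ b)"
      by (simp only: power_mult_distrib power_add) (simp only: mult_ac)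
    also have "(- 1 :: real) ^ (a + b) = - 1"
      using assms by simp
    finally show ?thesis .
  qed
  ultimately have "- 1 * circ a b = circ a b"
    by (simp only: circle_mean_mult circ_def)
  then show ?thesis by simp
qed

section \<open>The averaging projections\<close>

definition kac_avg :: "'n \<Rightarrow> 'n \<Rightarrow> (real ^ 'n \<Rightarrow> real) \<Rightarrow> real ^ 'n \<Rightarrow> real" where
  "kac_avg i j f \<eta> = circle_mean (\<lambda>\<theta>. f (kac_rotation i j \<theta> \<eta>))"

definition rot_invariant :: "'n \<Rightarrow> 'n \<Rightarrow> (real ^ 'n \<Rightarrow> real) \<Rightarrow> bool" where
  "rot_invariant i j f \<longleftrightarrow> (\<forall>\<theta> \<eta>. f (kac_rotation i j \<theta> \<eta>) = f \<eta>)"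

lemma continuous_on_orbit:
  "continuous_on UNIV f \<Longrightarrow> continuous_on UNIV (\<lambda>\<theta>. f (kac_rotation i j \<theta> \<eta>))"
  by (rule continuous_on_compose2[of UNIV f]) (auto intro!: continuous_intros)

lemma kac_avg_add:
  "poly_fun f \<Longrightarrow> poly_fun g \<Longrightarrow> kac_avg i j (f + g) = kac_avg i j f + kac_avg i j g"
  by (intro ext)
    (simp add: kac_avg_def circle_mean_add continuous_on_orbit continuous_on_poly_fun)

lemma kac_avg_smult: "kac_avg i j ((\<lambda>_. c) * f) = (\<lambda>_. c) * kac_avg i j f"
  by (intro ext) (simp add: kac_avg_def circle_mean_mult)

lemma kac_avg_zero [simp]: "kac_avg i j 0 = 0"
  by (intro ext) (simp add: kac_avg_def)

lemma kac_avg_step: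
  "poly_fun f \<Longrightarrow> kac_avg i j ((\<lambda>_. c) * monom_fun \<alpha> + f) =
    (\<lambda>_. c) * kac_avg i j (monom_fun \<alpha>) + kac_avg i j f"
  using kac_avg_add[of "(\<lambda>_. c) * monom_fun \<alpha>" f i j] by (simp add: kac_avg_smult)

lemma kac_avg_mult_invariant:
  "rot_invariant i j c \<Longrightarrow> kac_avg i j (c * f) = c * kac_avg i j f"
  by (intro ext) (simp add: kac_avg_def circle_mean_mult rot_invariant_def)

lemma kac_avg_invariant: "rot_invariant i j f \<Longrightarrow> kac_avg i j f = f"
  by (intro ext) (simp add: kac_avg_def rot_invariant_def)

lemma rot_invariant_same [simp]: "rot_invariant i i f"
  by (simp add: rot_invariant_def)

lemma kac_avg_same [simp]: "kac_avg i i f = f"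
  by (simp add: kac_avg_invariant)

lemma rot_invariant_add: "rot_invariant i j f \<Longrightarrow> rot_invariant i j g \<Longrightarrow> rot_invariant i j (f + g)"
  and rot_invariant_diff: "rot_invariant i j f \<Longrightarrow> rot_invariant i j g \<Longrightarrow> rot_invariant i j (f - g)"
  and rot_invariant_mult: "rot_invariant i j f \<Longrightarrow> rot_invariant i j g \<Longrightarrow> rot_invariant i j (f * g)"
  and rot_invariant_0: "rot_invariant i j 0"
  and rot_invariant_const: "rot_invariant i j (\<lambda>_. c)"
  by (simp_all add: rot_invariant_def)

lemma rot_invariant_swap: "rot_invariant i j f \<Longrightarrow> rot_invariant j i f"
  by (simp add: rot_invariant_def kac_rotation_swap[of j i])

lemma prod_split2:
  fixes g :: "'n::finite \<Rightarrow> real"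
  assumes "i \<noteq> j"
  shows "prod g UNIV = g i * g j * prod g (UNIV - {i, j})"
proof -
  have "UNIV - {i, j} = UNIV - {i} - {j}" by auto
  then show ?thesis
    using assms prod.remove[of UNIV i g] prod.remove[of "UNIV - {i}" j g] by (simp add: mult.assoc)
qed

text \<open>Truncation in \<open>div 2\<close> is harmless: for an odd exponent sum
  \<open>circ\<close> is 0.\<close>

lemma kac_avg_monom:
  assumes ij: "i \<noteq> j"
  shows "kac_avg i j (monom_fun \<alpha>) =
    (\<lambda>_. circ (\<alpha> i) (\<alpha> j)) * (\<lambda>\<eta>. ((\<eta> $ i)\<^sup>2 + (\<eta> $ j)\<^sup>2) ^ ((\<alpha> i + \<alpha> j) div 2)) *
      monom_fun (\<alpha>(i := 0, j := 0))" (is "_ = ?R")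
proof
  fix \<eta> :: "real ^ 'a"
  let ?p = "\<Prod>k\<in>UNIV - {i, j}. \<eta> $ k ^ \<alpha> k"
  have "monom_fun \<alpha> (kac_rotation i j \<theta> \<eta>) =
     ?p * ((cos \<theta> * \<eta> $ i + sin \<theta> * \<eta> $ j) ^ \<alpha> i * (cos \<theta> * \<eta> $ j - sin \<theta> * \<eta> $ i) ^ \<alpha> j)" for \<theta>
  proof -
    have "(\<Prod>k\<in>UNIV - {i, j}. kac_rotation i j \<theta> \<eta> $ k ^ \<alpha> k) = ?p"
      using ij by (intro prod.cong) (auto simp: kac_rotation_nth)
    then show ?thesis
      using ij by (simp add: monom_fun_def prod_split2[OF ij] kac_rotation_nth)
  qed
  then have "kac_avg i j (monom_fun \<alpha>) \<eta> =
      ?p * (circ (\<alpha> i) (\<alpha> j) * sqrt ((\<eta> $ i)\<^sup>2 + (\<eta> $ j)\<^sup>2) ^ (\<alpha> i + \<alpha> j))"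
    by (simp add: kac_avg_def circle_mean_mult circle_mean_rotated_monomial)
  also have "circ (\<alpha> i) (\<alpha> j) * sqrt ((\<eta> $ i)\<^sup>2 + (\<eta> $ j)\<^sup>2) ^ (\<alpha> i + \<alpha> j) =
      circ (\<alpha> i) (\<alpha> j) * ((\<eta> $ i)\<^sup>2 + (\<eta> $ j)\<^sup>2) ^ ((\<alpha> i + \<alpha> j) div 2)"
  proof (cases "odd (\<alpha> i + \<alpha> j)")
    case False
    then obtain m where "\<alpha> i + \<alpha> j = 2 * m" by blast
    then show ?thesis by (simp add: power_mult)
  qed (simp add: circ_odd)
  also have "?p = monom_fun (\<alpha>(i := 0, j := 0)) \<eta>"
    using ij by (simp add: monom_fun_def prod_split2[OF ij])
  finally show "kac_avg i j (monom_fun \<alpha>) \<eta> = ?R \<eta>"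
    by (simp add: mult_ac)
qed

text \<open>In the explicit formula the factors are a power of the planar radius and a monomial in
  the other coordinates, both untouched by the rotation, and their total degree does not exceed that
  of the monomial. Keeping the degree bound is what later confines the iterates of
  \<open>kac_op\<close> to a finite-dimensional space.\<close>

lemma kac_avg_monom_mpoly_invariant:
  assumes ij: "i \<noteq> j" and d: "sum \<alpha> UNIV \<le> d"
  shows "mpoly d (kac_avg i j (monom_fun \<alpha>))" "rot_invariant i j (kac_avg i j (monom_fun \<alpha>))"
proof -
  let ?m = "(\<alpha> i + \<alpha> j) div 2"
  let ?\<beta> = "\<alpha>(i := 0, j := 0)"
  have "mpoly (1 + 1) ((\<lambda>\<eta>. \<eta> $ k) * (\<lambda>\<eta>. \<eta> $ k))" for k :: 'a
    by (intro mpoly_mult mpoly_nth)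
  then have "mpoly 2 ((\<lambda>\<eta>. (\<eta> $ i)\<^sup>2) + (\<lambda>\<eta>. (\<eta> $ j)\<^sup>2))"
    by (intro mpoly_add) (simp_all add: times_fun_def power2_eq_square numeral_2_eq_2)
  then have "mpoly (?m * 2) (\<lambda>\<eta>. ((\<eta> $ i)\<^sup>2 + (\<eta> $ j)\<^sup>2) ^ ?m)"
    using mpoly_power[of 2 "(\<lambda>\<eta>. (\<eta> $ i)\<^sup>2) + (\<lambda>\<eta>. (\<eta> $ j)\<^sup>2)" ?m] by simp
  moreover have "mpoly (sum ?\<beta> UNIV) (monom_fun ?\<beta>)"
    using mpoly_monom[OF order_refl, of ?\<beta> 1] by (simp add: times_fun_def)
  ultimately have "mpoly (0 + ?m * 2 + sum ?\<beta> UNIV) (kac_avg i j (monom_fun \<alpha>))"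
    unfolding kac_avg_monom[OF ij] by (intro mpoly_mult mpoly_const)
  moreover have "0 + ?m * 2 + sum ?\<beta> UNIV \<le> sum \<alpha> UNIV"
    using ij by (simp add: sum.remove[of UNIV i] sum.remove[of "UNIV - {i}" j])
  ultimately show "mpoly d (kac_avg i j (monom_fun \<alpha>))"
    using d mpoly_mono by (metis order_trans)
  have "monom_fun ?\<beta> (kac_rotation i j \<theta> \<eta>) = monom_fun ?\<beta> \<eta>" for \<theta> \<eta>
    unfolding monom_fun_def using ij by (intro prod.cong) (auto simp: kac_rotation_nth)
  then show "rot_invariant i j (kac_avg i j (monom_fun \<alpha>))"
    unfolding kac_avg_monom[OF ij] using ij
    by (simp add: rot_invariant_def kac_rotation_nth sum_squares_rotated)
qed

lemma mpoly_kac_avg: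
  assumes "mpoly d f"
  shows "mpoly d (kac_avg i j f)"
proof (cases "i = j")
  case False
  show ?thesis
    using assms
  proof (induction rule: mpoly.induct)
    case (step f \<alpha> c)
    then show ?case
      by (subst kac_avg_add)
        (auto simp: kac_avg_smult intro: mpoly_add mpoly_smult kac_avg_monom_mpoly_invariant[OF False]
          mpoly_imp_poly_fun mpoly_monom)
  qed (simp only: kac_avg_zero mpoly.zero)
qed (use assms in simp)

lemma poly_fun_kac_avg [simp]: "poly_fun f \<Longrightarrow> poly_fun (kac_avg i j f)"
  by (auto simp: poly_fun_def intro: mpoly_kac_avg)

lemma rot_invariant_kac_avg:
  assumes "poly_fun f"
  shows "rot_invariant i j (kac_avg i j f)"
proof (cases "i = j")
  case False
  show ?thesis
    using assms
  proof (induction rule: poly_fun_induct)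
    case (step c \<alpha> f)
    then show ?case
      unfolding kac_avg_step[OF step.hyps(1)]
      by (intro rot_invariant_add rot_invariant_mult rot_invariant_const
          kac_avg_monom_mpoly_invariant(2)[OF False order_refl])
  qed (simp only: kac_avg_zero rot_invariant_0)
qed simp

lemma kac_avg_idem: "poly_fun f \<Longrightarrow> kac_avg i j (kac_avg i j f) = kac_avg i j f"
  by (intro kac_avg_invariant rot_invariant_kac_avg)

lemma kac_avg_diff:
  assumes "poly_fun f" "poly_fun g"
  shows "kac_avg i j (f - g) = kac_avg i j f - kac_avg i j g"
  using kac_avg_add[of "f - g" g i j] assms by simp

lemma kac_avg_sum:
  "(\<And>x. x \<in> X \<Longrightarrow> poly_fun (f x)) \<Longrightarrow> kac_avg i j (\<Sum>x\<in>X. f x) = (\<Sum>x\<in>X. kac_avg i j (f x))"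
  by (induction X rule: infinite_finite_induct) (auto simp: kac_avg_add)

text \<open>Exchanging the indices reverses the angle, and the mean over a full period is invariant
  under reflection.\<close>

lemma kac_avg_swap:
  assumes "poly_fun f"
  shows "kac_avg j i f = kac_avg i j f"
proof
  fix \<eta>
  have "continuous_on UNIV (\<lambda>\<theta>. f (kac_rotation i j \<theta> \<eta>))"
    by (intro continuous_on_orbit continuous_on_poly_fun assms)
  moreover have "kac_rotation i j (\<theta> + 2 * pi) \<eta> = kac_rotation i j \<theta> \<eta>" for \<theta>
    by (auto simp: kac_rotation_def vec_eq_iff)
  ultimately show "kac_avg j i f \<eta> = kac_avg i j f \<eta>"
    using circle_mean_reflect[of "\<lambda>\<theta>. f (kac_rotation i j \<theta> \<eta>)"]
    by (simp add: kac_avg_def kac_rotation_swap[of j i])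
qed

section \<open>Fubini's theorem\<close>

lemma measurable_rotation_pair:
  "(\<lambda>(\<eta>, \<theta>). kac_rotation i j \<theta> \<eta>) \<in>
    (\<nu> :: (real ^ 'n) measure) \<Otimes>\<^sub>M lborel \<rightarrow>\<^sub>M \<nu>"
proof -
  have "(\<lambda>p :: (real ^ 'n) \<times> real. kac_rotation i j (snd p) (fst p)) \<in> borel_measurable borel"
    by (intro borel_measurable_continuous_onI continuous_intros)
  then have m1: "(\<lambda>p :: (real ^ 'n) \<times> real. kac_rotation i j (snd p) (fst p)) \<in> borel_measurable (borel \<Otimes>\<^sub>M borel)"
    by (simp add: borel_prod)
  have m2: "(\<lambda>p. (fst p, snd p)) \<in>
      (\<nu> :: (real ^ 'n) measure) \<Otimes>\<^sub>M lborel \<rightarrow>\<^sub>M borel \<Otimes>\<^sub>M borel"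
  proof (intro measurable_Pair)
    have "(\<lambda>x. x) \<in> (\<nu> :: (real ^ 'n) measure) \<rightarrow>\<^sub>M borel"
      by (intro measurable_sphere_measureI continuous_intros)
    then show "fst \<in> (\<nu> :: (real ^ 'n) measure) \<Otimes>\<^sub>M lborel \<rightarrow>\<^sub>M borel"
      using measurable_compose[OF measurable_fst] by blast
  qed (simp add: measurable_snd)
  have "(\<lambda>(\<eta>, \<theta>). kac_rotation i j \<theta> \<eta>) \<in>
      (\<nu> :: (real ^ 'n) measure) \<Otimes>\<^sub>M lborel \<rightarrow>\<^sub>M borel"
    using measurable_compose[OF m2 m1] by (simp add: case_prod_beta)
  then have "(\<lambda>(\<eta>, \<theta>). kac_rotation i j \<theta> \<eta>) \<in>
      (\<nu> :: (real ^ 'n) measure) \<Otimes>\<^sub>M lborel \<rightarrow>\<^sub>M restrict_space borel (sphere 0 1)"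
    by (intro measurable_restrict_space2) (auto simp: space_pair_measure space_sphere_measure)
  then show ?thesis
    by (simp add: measurable_cong_sets[OF refl sets_sphere_measure])
qed

lemma sphere_circle_Fubini:
  fixes F :: "real ^ 'n \<Rightarrow> real \<Rightarrow> real"
  assumes "integrable (\<nu> \<Otimes>\<^sub>M lborel) (\<lambda>(\<eta>, \<theta>). indicator {0..2 * pi} \<theta> * F \<eta> \<theta>)"
  shows "(\<integral>\<eta>. circle_mean (F \<eta>) \<partial>\<nu>) = circle_mean (\<lambda>\<theta>. \<integral>\<eta>. F \<eta> \<theta> \<partial>\<nu>)"
proof -
  interpret S: prob_space "\<nu> :: (real ^ 'n) measure"
    by (rule prob_space_sphere_measure)
  interpret pair_sigma_finite "\<nu> :: (real ^ 'n) measure" "lborel :: real measure" ..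
  from Fubini_integral[OF assms]
  have "(\<integral>\<theta>. indicator {0..2 * pi} \<theta> * (\<integral>\<eta>. F \<eta> \<theta> \<partial>\<nu>) \<partial>lborel) =
      (\<integral>\<eta>. (\<integral>\<theta>. indicator {0..2 * pi} \<theta> * F \<eta> \<theta> \<partial>lborel) \<partial>\<nu>)"
    by simp
  then show ?thesis
    by (simp add: circle_mean_def set_lebesgue_integral_def)
qed

lemma sphere_circle_integrable_bounded:
  fixes F :: "real ^ 'n \<Rightarrow> real \<Rightarrow> real"
  assumes "(\<lambda>(\<eta>, \<theta>). F \<eta> \<theta>) \<in> borel_measurable (\<nu> \<Otimes>\<^sub>M lborel)"
    and B: "\<And>\<eta> \<theta>. norm \<eta> = 1 \<Longrightarrow> \<bar>F \<eta> \<theta>\<bar> \<le> B"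
  shows "integrable (\<nu> \<Otimes>\<^sub>M lborel) (\<lambda>(\<eta>, \<theta>). indicator {0..2 * pi} \<theta> * F \<eta> \<theta>)"
proof -
  interpret S: prob_space "\<nu> :: (real ^ 'n) measure"
    by (rule prob_space_sphere_measure)
  interpret pair_sigma_finite "\<nu> :: (real ^ 'n) measure" "lborel :: real measure" ..
  let ?A = "space (\<nu> :: (real ^ 'n) measure) \<times> {0..2 * pi}"
  have B': "\<bar>F \<eta> \<theta>\<bar> \<le> \<bar>B\<bar>" if "norm \<eta> = 1" for \<eta> \<theta>
    using B[OF that, of \<theta>] by linarith
  have "emeasure (\<nu> \<Otimes>\<^sub>M lborel) ?A = ennreal (2 * pi)"
    by (subst lborel.emeasure_pair_measure_Times) (auto simp: S.emeasure_space_1)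
  then have "integrable (\<nu> \<Otimes>\<^sub>M lborel) (\<lambda>p. B * indicator ?A p)"
    by (intro integrable_mult_right integrable_real_indicator) auto
  then show ?thesis
  proof (rule Bochner_Integration.integrable_bound)
    show "AE p in \<nu> \<Otimes>\<^sub>M lborel.
        norm (case p of (\<eta>, \<theta>) \<Rightarrow> indicator {0..2 * pi} \<theta> * F \<eta> \<theta>) \<le> norm (B * indicator ?A p)"
      using B'
      by (intro AE_I2) (auto simp: space_pair_measure space_sphere_measure indicator_def)
    have "(\<lambda>p. indicator {0..2 * pi} (snd p) * (case p of (\<eta>, \<theta>) \<Rightarrow> F \<eta> \<theta>)) \<in>
        borel_measurable (\<nu> \<Otimes>\<^sub>M lborel)"
      using assms(1) by measurable
    then show "(\<lambda>(\<eta>, \<theta>). indicator {0..2 * pi} \<theta> * F \<eta> \<theta>) \<in>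
        borel_measurable (\<nu> \<Otimes>\<^sub>M lborel)"
      by (simp add: case_prod_beta)
  qed
qed

lemma poly_fun_bounded_sphere:
  assumes "poly_fun f"
  obtains B where "B > 0" "\<And>\<eta>. norm \<eta> = 1 \<Longrightarrow> \<bar>f \<eta>\<bar> \<le> B"
proof -
  have "bounded (f ` sphere 0 1)"
    using assms by (intro compact_imp_bounded compact_continuous_image continuous_on_poly_fun) auto
  then obtain B where "B > 0" "\<forall>\<eta>\<in>sphere 0 1. norm (f \<eta>) \<le> B"
    by (auto simp: bounded_pos)
  then show ?thesis
    by (intro that[of B]) auto
qed

text \<open>An invariant \<open>g\<close> can be moved inside the average; after Fubini each rotated
  product has the same integral as the unrotated one.\<close>

lemma nu_inner_kac_avg_left:
  fixes f :: "real ^ 'n \<Rightarrow> real"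
  assumes f: "poly_fun f" and g: "poly_fun g" and inv: "rot_invariant i j g"
  shows "nu_inner (kac_avg i j f) g = nu_inner f g"
proof -
  let ?F = "\<lambda>\<eta> \<theta>. (f * g) (kac_rotation i j \<theta> \<eta>)"
  have fg: "poly_fun (f * g)" using f g by simp
  then have m: "f * g \<in> borel_measurable \<nu>"
    by (intro borel_measurable_integrable integrable_poly_fun)
  obtain B where B: "\<And>\<eta>. norm \<eta> = 1 \<Longrightarrow> \<bar>(f * g) \<eta>\<bar> \<le> B"
    using poly_fun_bounded_sphere[OF fg] by metis
  have "nu_inner (kac_avg i j f) g = (\<integral>\<eta>. kac_avg i j (g * f) \<eta> \<partial>\<nu>)"
    unfolding kac_avg_mult_invariant[OF inv] by (simp add: nu_inner_def mult.commute)
  also have "\<dots> = (\<integral>\<eta>. circle_mean (?F \<eta>) \<partial>\<nu>)"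
    unfolding kac_avg_def mult.commute[of g f] ..
  also have "\<dots> = circle_mean (\<lambda>\<theta>. \<integral>\<eta>. ?F \<eta> \<theta> \<partial>\<nu>)"
  proof (intro sphere_circle_Fubini sphere_circle_integrable_bounded)
    show "(\<lambda>(\<eta>, \<theta>). ?F \<eta> \<theta>) \<in> borel_measurable (\<nu> \<Otimes>\<^sub>M lborel)"
      using measurable_compose[OF measurable_rotation_pair m] by (simp add: case_prod_beta)
    show "\<bar>?F \<eta> \<theta>\<bar> \<le> B" if "norm \<eta> = 1" for \<eta> \<theta>
      using B[of "kac_rotation i j \<theta> \<eta>"] that by simp
  qed
  also have "\<dots> = nu_inner f g"
    unfolding integral_kac_rotation[OF m] by (simp add: nu_inner_def times_fun_def)
  finally show ?thesis .
qed

text \<open>On a monomial each average produces a radial factor of its own plane, and the other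
  plane's rotations leave that factor fixed. So both orders give the same product.\<close>

lemma kac_avg_commute:
  assumes f: "poly_fun f" and dis: "k \<noteq> i" "k \<noteq> j" "l \<noteq> i" "l \<noteq> j"
  shows "kac_avg i j (kac_avg k l f) = kac_avg k l (kac_avg i j f)"
  using f
proof (induction rule: poly_fun_induct)
  case (step c \<alpha> f)
  have "kac_avg i j (kac_avg k l (monom_fun \<alpha>)) = kac_avg k l (kac_avg i j (monom_fun \<alpha>))"
  proof (cases "i = j \<or> k = l")
    case False
    then have ij: "i \<noteq> j" and kl: "k \<noteq> l" by auto
    let ?P = "\<lambda>i j. (\<lambda>_. circ (\<alpha> i) (\<alpha> j)) * (\<lambda>\<eta>. ((\<eta> $ i)\<^sup>2 + (\<eta> $ j)\<^sup>2) ^ ((\<alpha> i + \<alpha> j) div 2))"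
    have "rot_invariant i j (?P k l)" "rot_invariant k l (?P i j)"
      using dis ij kl by (simp_all add: rot_invariant_def kac_rotation_nth)
    then show ?thesis
      using dis ij kl
      by (simp add: kac_avg_monom kac_avg_mult_invariant fun_upd_twist)
  qed auto
  with step show ?case
    by (simp only: kac_avg_add kac_avg_smult kac_avg_step poly_fun_mult poly_fun_const poly_fun_monom
        poly_fun_kac_avg)
qed (simp only: kac_avg_zero)

section \<open>Legendre polynomials and the case of three coordinates\<close>

definition wallis :: "nat \<Rightarrow> real" where
  "wallis n = circ (2 * n) 0"

lemma wallis_0 [simp]: "wallis 0 = 1"
  by (simp add: wallis_def circ_def)

text \<open>The derivative of \<open>cos^(m+1) sin\<close> integrates to 0 over a period. The
  recursion identifies \<open>wallis n\<close> with the central binomial coefficient of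
  \<open>2n\<close> divided by \<open>4^n\<close>, the absolute value at 0 of the Legendre
  polynomial of degree \<open>2n\<close>.\<close>

lemma wallis_Suc: "wallis (Suc n) = (2 * n + 1) / (2 * n + 2) * wallis n"
proof -
  define m where "m = 2 * n"
  have cont: "continuous_on UNIV (\<lambda>\<theta> :: real. cos \<theta> ^ k)" for k
    by (intro continuous_intros)
  have C: "circ k 0 = 1 / (2 * pi) * integral {0..2 * pi} (\<lambda>\<theta>. cos \<theta> ^ k)" for k
    using circle_mean_HK[OF cont] by (simp add: circ_def)
  have int: "(\<lambda>\<theta> :: real. cos \<theta> ^ k) integrable_on {0..2 * pi}" for k
    by (intro integrable_continuous_real continuous_on_subset[OF cont]) auto
  have deriv: "((\<lambda>\<theta>. cos \<theta> ^ Suc m * sin \<theta>) has_real_derivative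
      ((m + 2) * cos \<theta> ^ (m + 2) - (m + 1) * cos \<theta> ^ m)) (at \<theta> within X)" for \<theta> :: real and X
  proof -
    have "((\<lambda>\<theta>. cos \<theta> ^ Suc m * sin \<theta>) has_real_derivative
        ((m + 2) * cos \<theta> ^ (m + 2) - (m + 1) * cos \<theta> ^ m)) (at \<theta>)"
    proof (rule DERIV_cong[OF DERIV_mult[OF DERIV_power[OF DERIV_cos] DERIV_sin]])
      have "real (Suc m) * (- sin \<theta> * cos \<theta> ^ m) * sin \<theta> + cos \<theta> * cos \<theta> ^ Suc m =
          cos \<theta> ^ m * (cos \<theta>)\<^sup>2 - real (Suc m) * cos \<theta> ^ m * (sin \<theta>)\<^sup>2"
        by (simp add: power2_eq_square)
      also have "\<dots> = (m + 2) * cos \<theta> ^ (m + 2) - (m + 1) * cos \<theta> ^ m"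
        unfolding sin_squared_eq power_add by (simp add: algebra_simps)
      finally show "real (Suc m) * (- sin \<theta> * cos \<theta> ^ (Suc m - Suc 0)) * sin \<theta> +
          cos \<theta> * cos \<theta> ^ Suc m = (m + 2) * cos \<theta> ^ (m + 2) - (m + 1) * cos \<theta> ^ m"
        by simp
    qed
    then show ?thesis
      by (rule has_field_derivative_at_within)
  qed
  have "((\<lambda>\<theta>. (m + 2) * cos \<theta> ^ (m + 2) - (m + 1) * cos \<theta> ^ m) has_integral
      (cos (2 * pi) ^ Suc m * sin (2 * pi) - cos 0 ^ Suc m * sin (0 :: real))) {0..2 * pi}"
    using deriv by (intro fundamental_theorem_of_calculus)
      (auto simp: has_real_derivative_iff_has_vector_derivative)
  then have "integral {0..2 * pi} (\<lambda>\<theta> :: real. (m + 2) * cos \<theta> ^ (m + 2) - (m + 1) * cos \<theta> ^ m) = 0"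
    by (simp add: integral_unique)
  also have "integral {0..2 * pi} (\<lambda>\<theta> :: real. (m + 2) * cos \<theta> ^ (m + 2) - (m + 1) * cos \<theta> ^ m) =
      (m + 2) * integral {0..2 * pi} (\<lambda>\<theta>. cos \<theta> ^ (m + 2)) -
      (m + 1) * integral {0..2 * pi} (\<lambda>\<theta>. cos \<theta> ^ m)"
  proof -
    have i: "(\<lambda>\<theta> :: real. (m + 2) * cos \<theta> ^ (m + 2)) integrable_on {0..2 * pi}"
      "(\<lambda>\<theta> :: real. (m + 1) * cos \<theta> ^ m) integrable_on {0..2 * pi}"
      by (intro integrable_on_mult_right int)+
    show ?thesis
      unfolding Henstock_Kurzweil_Integration.integral_diff[OF i]
        Henstock_Kurzweil_Integration.integral_mult_right ..
  qed
  finally have "(m + 2) * circ (m + 2) 0 = (m + 1) * circ m 0"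
    unfolding C by (simp add: field_simps)
  then show ?thesis
    by (simp add: wallis_def m_def field_simps)
qed

lemma wallis_pos: "wallis n > 0"
  by (induction n) (auto simp: wallis_Suc)

lemma wallis_strict_antimono: "m < n \<Longrightarrow> wallis n < wallis m"
proof -
  assume "m < n"
  have "wallis (Suc k) < wallis k" for k
  proof -
    have "(2 * real k + 1) / (2 * real k + 2) * wallis k < 1 * wallis k"
      by (intro mult_strict_right_mono wallis_pos) (simp add: field_simps)
    then show ?thesis
      by (simp only: wallis_Suc mult_1)
  qed
  then show ?thesis
    using lift_Suc_mono_less[of "\<lambda>n. - wallis n" m n] \<open>m < n\<close> by simp
qed

text \<open>The value at 0 of the Legendre polynomial of degree \<open>2n\<close>.\<close>

definition leg_ev :: "nat \<Rightarrow> real" where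
  "leg_ev n = (- 1) ^ n * wallis n"

text \<open>The absolute values are the strictly decreasing numbers \<open>wallis n\<close>.
  Distinctness serves twice: it makes the back substitution for \<open>leg_coeff\<close> solvable,
  and it separates the Legendre degrees.\<close>

lemma leg_ev_neq:
  assumes "m \<noteq> n"
  shows "leg_ev m \<noteq> leg_ev n"
proof -
  have "\<bar>leg_ev k\<bar> = wallis k" for k
    using wallis_pos[of k] by (simp add: leg_ev_def abs_mult)
  then show ?thesis
    using wallis_strict_antimono[of m n] wallis_strict_antimono[of n m] assms
    by (metis less_irrefl linorder_neqE_nat)
qed

text \<open>Degree 0 is left out because \<open>leg_ev 0 = 1\<close>. The upper bound is attained at
  \<open>n = 2\<close>; the lower bound is the threshold at which the eigenvalue
  \<open>1 - leg_ev n\<close> of the Gram matrix would reach \<open>7/4\<close>.\<close>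

lemma leg_ev_bounds:
  assumes "n \<ge> 1"
  shows "leg_ev n \<le> 3 / 8" "- (3 / 4) \<le> leg_ev n"
proof -
  have 1: "wallis 1 = 1 / 2" and 2: "wallis 2 = 3 / 8"
    by (simp_all add: wallis_Suc numeral_2_eq_2)
  have "n = 1 \<or> n = 2 \<or> n > 2" using assms by linarith
  then have "leg_ev n = - (1 / 2) \<or> \<bar>leg_ev n\<bar> \<le> 3 / 8"
    using wallis_strict_antimono[of 2 n] wallis_pos[of n] 1 2
    by (auto simp: leg_ev_def abs_mult)
  then show "leg_ev n \<le> 3 / 8" "- (3 / 4) \<le> leg_ev n"
    by auto
qed

text \<open>Coefficients of the Legendre polynomial of degree \<open>2n\<close> in even powers, normalised to leading
  coefficient 1, found by back substitution in a triangular eigenvalue problem.\<close>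

function leg_coeff :: "nat \<Rightarrow> nat \<Rightarrow> real" where
  "leg_coeff n k =
     (if k < n then (- 1) ^ k * (\<Sum>l\<in>{k<..n}. leg_coeff n l * wallis l * (l choose k)) /
        (leg_ev n - leg_ev k)
      else 1)"
  by auto
termination
  by (relation "Wellfounded.measure (\<lambda>(n, k). n - k)") auto

declare leg_coeff.simps [simp del]

lemma leg_coeff_top [simp]: "leg_coeff n n = 1"
  by (simp add: leg_coeff.simps)

text \<open>The recursion for \<open>leg_coeff\<close>, read as an eigenvector equation. Terms with
  \<open>k < m\<close> vanish with the binomial coefficient, so the matrix is triangular, and its
  diagonal entries are the values \<open>leg_ev m\<close>.\<close>

lemma leg_coeff_eigen:
  assumes "m \<le> n"
  shows "(- 1) ^ m * (\<Sum>k\<le>n. leg_coeff n k * wallis k * (k choose m)) = leg_ev n * leg_coeff n m"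
proof -
  let ?t = "\<lambda>k. leg_coeff n k * wallis k * (k choose m)"
  have "{..n} = {..<m} \<union> {m} \<union> {m<..n}"
    using assms by auto
  then have "sum ?t {..n} = sum ?t {..<m} + ?t m + sum ?t {m<..n}"
    by (subst \<open>{..n} = _\<close>) (subst sum.union_disjoint; auto)+
  moreover have "sum ?t {..<m} = 0"
    by (intro sum.neutral) auto
  ultimately have *: "(- 1) ^ m * sum ?t {..n} = leg_ev m * leg_coeff n m + (- 1) ^ m * sum ?t {m<..n}"
    by (simp add: leg_ev_def algebra_simps)
  show ?thesis
  proof (cases "m = n")
    case False
    then have "leg_coeff n m * (leg_ev n - leg_ev m) = (- 1) ^ m * sum ?t {m<..n}"
      using assms leg_ev_neq[of n m] by (subst leg_coeff.simps) simp
    then show ?thesis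
      unfolding * by (simp add: algebra_simps)
  qed (use * in simp)
qed

text \<open>Here \<open>t\<close> stands for the square of one coordinate and \<open>r\<close> for
  the squared radius of the block. Replacing \<open>t ^ k\<close> by
  \<open>wallis k * (r - t) ^ k\<close> is the effect of averaging about a perpendicular axis; after
  binomial expansion, comparing coefficients leaves the triangular eigenvector equation.\<close>

lemma leg_eigen_identity:
  fixes r t :: real
  shows "(\<Sum>k\<le>n. leg_coeff n k * wallis k * (r - t) ^ k * r ^ (n - k)) =
    leg_ev n * (\<Sum>k\<le>n. leg_coeff n k * t ^ k * r ^ (n - k))"
proof -
  have expand: "wallis k * (r - t) ^ k * r ^ (n - k) =
      (\<Sum>m\<le>n. wallis k * (k choose m) * ((- 1) ^ m * t ^ m * r ^ (n - m)))" if "k \<le> n" for k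
  proof -
    have "(r - t) ^ k = (\<Sum>m\<le>k. (k choose m) * (- t) ^ m * r ^ (k - m))"
      using binomial_ring[of "- t" r k] by simp
    then have "wallis k * (r - t) ^ k * r ^ (n - k) =
        (\<Sum>m\<le>k. wallis k * (k choose m) * ((- t) ^ m * (r ^ (k - m) * r ^ (n - k))))"
      by (simp add: sum_distrib_left sum_distrib_right mult_ac)
    also have "\<dots> = (\<Sum>m\<le>k. wallis k * (k choose m) * ((- 1) ^ m * t ^ m * r ^ (n - m)))"
      using that by (intro sum.cong) (auto simp: power_add[symmetric] power_minus[of t])
    also have "\<dots> = (\<Sum>m\<le>n. wallis k * (k choose m) * ((- 1) ^ m * t ^ m * r ^ (n - m)))"
      using that by (intro sum.mono_neutral_left) auto
    finally show ?thesis .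
  qed
  have "(\<Sum>k\<le>n. leg_coeff n k * wallis k * (r - t) ^ k * r ^ (n - k)) =
      (\<Sum>k\<le>n. \<Sum>m\<le>n. leg_coeff n k * (wallis k * (k choose m) * ((- 1) ^ m * t ^ m * r ^ (n - m))))"
  proof (intro sum.cong refl)
    fix k assume "k \<in> {..n}"
    have "leg_coeff n k * wallis k * (r - t) ^ k * r ^ (n - k) =
        leg_coeff n k * (wallis k * (r - t) ^ k * r ^ (n - k))"
      by (simp only: mult.assoc)
    also have "\<dots> = (\<Sum>m\<le>n. leg_coeff n k * (wallis k * (k choose m) * ((- 1) ^ m * t ^ m * r ^ (n - m))))"
      unfolding sum_distrib_left[symmetric] using \<open>k \<in> {..n}\<close> by (subst expand) auto
    finally show "leg_coeff n k * wallis k * (r - t) ^ k * r ^ (n - k) =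
        (\<Sum>m\<le>n. leg_coeff n k * (wallis k * (k choose m) * ((- 1) ^ m * t ^ m * r ^ (n - m))))" .
  qed
  also have "\<dots> = (\<Sum>m\<le>n. \<Sum>k\<le>n. leg_coeff n k * (wallis k * (k choose m) * ((- 1) ^ m * t ^ m * r ^ (n - m))))"
    by (rule sum.swap)
  also have "\<dots> = (\<Sum>m\<le>n. ((- 1) ^ m * (\<Sum>k\<le>n. leg_coeff n k * wallis k * (k choose m))) * (t ^ m * r ^ (n - m)))"
    by (simp add: sum_distrib_left sum_distrib_right mult_ac)
  also have "\<dots> = (\<Sum>m\<le>n. (leg_ev n * leg_coeff n m) * (t ^ m * r ^ (n - m)))"
    by (intro sum.cong) (simp_all add: leg_coeff_eigen)
  finally show ?thesis
    by (simp add: sum_distrib_left mult_ac)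
qed

section \<open>Zonal functions in a block of three coordinates\<close>

definition sq_radius :: "'n set \<Rightarrow> real ^ 'n \<Rightarrow> real" where
  "sq_radius T \<eta> = (\<Sum>x\<in>T. (\<eta> $ x)\<^sup>2)"

text \<open>The zonal harmonic of degree \<open>2n\<close> about the \<open>x\<close> axis,
  homogenised by the squared radius so that it is a polynomial on the whole space.\<close>

definition leg_fun :: "'n set \<Rightarrow> nat \<Rightarrow> 'n \<Rightarrow> real ^ 'n \<Rightarrow> real" where
  "leg_fun T n x \<eta> = (\<Sum>k\<le>n. leg_coeff n k * (\<eta> $ x) ^ (2 * k) * sq_radius T \<eta> ^ (n - k))"

text \<open>These functions play the role of scalars: every average within the block commutes with
  multiplication by them. Typical ones are the block radius and monomials in the coordinates outside
  \<open>T\<close>.\<close>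

definition block_invariant :: "'n set \<Rightarrow> (real ^ 'n \<Rightarrow> real) \<Rightarrow> bool" where
  "block_invariant T g \<longleftrightarrow> poly_fun g \<and> (\<forall>x\<in>T. \<forall>y\<in>T. rot_invariant x y g)"

definition triple :: "'n set \<Rightarrow> 'n \<Rightarrow> 'n \<Rightarrow> 'n \<Rightarrow> bool" where
  "triple T x y z \<longleftrightarrow> T = {x, y, z} \<and> x \<noteq> y \<and> x \<noteq> z \<and> y \<noteq> z"

lemma triple_neq:
  assumes "triple T x y z"
  shows "x \<noteq> y" "y \<noteq> x" "x \<noteq> z" "z \<noteq> x" "y \<noteq> z" "z \<noteq> y"
  using assms by (auto simp: triple_def)

lemma sq_radius_triple:
  "triple T x y z \<Longrightarrow> sq_radius T \<eta> = (\<eta> $ x)\<^sup>2 + (\<eta> $ y)\<^sup>2 + (\<eta> $ z)\<^sup>2"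
  by (auto simp: triple_def sq_radius_def)

lemma poly_fun_sq_radius [simp]: "poly_fun (sq_radius T)"
  unfolding sq_radius_def[abs_def] by simp

lemma poly_fun_leg_fun [simp]: "poly_fun (leg_fun T n x)"
  unfolding leg_fun_def[abs_def] by simp

lemma sq_radius_rotation:
  assumes "triple T x y z"
  shows "sq_radius T (kac_rotation x y \<theta> \<eta>) = sq_radius T \<eta>"
  by (simp add: sq_radius_triple[OF assms] triple_neq[OF assms] kac_rotation_nth sum_squares_rotated)

lemma block_invariant_rotation:
  "block_invariant T g \<Longrightarrow> x \<in> T \<Longrightarrow> y \<in> T \<Longrightarrow> g (kac_rotation x y \<theta> \<eta>) = g \<eta>"
  by (auto simp: block_invariant_def rot_invariant_def)

lemma block_invariant_sq_radius:
  assumes "triple T x y z"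
  shows "block_invariant T (sq_radius T)"
proof -
  have "triple T x z y" "triple T y z x"
    using assms by (auto simp: triple_def)
  then have "rot_invariant x y (sq_radius T)" "rot_invariant x z (sq_radius T)"
      "rot_invariant y z (sq_radius T)"
    using assms by (auto simp: rot_invariant_def sq_radius_rotation)
  then show ?thesis
    using assms by (auto simp: block_invariant_def triple_def intro: rot_invariant_swap)
qed

lemma block_invariant_add: "block_invariant T g \<Longrightarrow> block_invariant T h \<Longrightarrow> block_invariant T (g + h)"
  and block_invariant_diff: "block_invariant T g \<Longrightarrow> block_invariant T h \<Longrightarrow> block_invariant T (g - h)"
  and block_invariant_mult: "block_invariant T g \<Longrightarrow> block_invariant T h \<Longrightarrow> block_invariant T (g * h)"
  and block_invariant_const: "block_invariant T (\<lambda>_. c)"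
  by (simp_all add: block_invariant_def rot_invariant_add rot_invariant_diff rot_invariant_mult
      rot_invariant_const)

lemma block_invariant_0: "block_invariant T 0"
  using block_invariant_const[of T 0] by (simp add: zero_fun_def)

lemma block_invariant_power: "block_invariant T g \<Longrightarrow> block_invariant T (\<lambda>\<eta>. g \<eta> ^ n)"
  by (auto simp: block_invariant_def rot_invariant_def)

lemma block_invariant_poly_fun [simp]: "block_invariant T g \<Longrightarrow> poly_fun g"
  by (simp add: block_invariant_def)

lemma leg_fun_0 [simp]: "leg_fun T 0 x = 1"
  by (simp add: leg_fun_def fun_eq_iff)

lemma leg_fun_rot_invariant:
  assumes "triple T x y z"
  shows "rot_invariant y z (leg_fun T n x)"
proof -
  have "triple T y z x" using assms by (auto simp: triple_def)
  then have "sq_radius T (kac_rotation y z \<theta> \<eta>) = sq_radius T \<eta>" for \<theta> \<eta>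
    by (rule sq_radius_rotation)
  moreover have "kac_rotation y z \<theta> \<eta> $ x = \<eta> $ x" for \<theta> \<eta>
    using assms by (simp add: triple_def kac_rotation_nth)
  ultimately show ?thesis
    by (simp add: rot_invariant_def leg_fun_def)
qed

lemma leg_fun_half_turn:
  assumes "triple T x y z"
  shows "leg_fun T n x (kac_rotation x y pi \<eta>) = leg_fun T n x \<eta>"
  by (simp add: leg_fun_def sq_radius_rotation[OF assms] triple_neq[OF assms] kac_rotation_nth)

lemma leg_fun_quarter_turn:
  assumes "triple T x y z"
  shows "leg_fun T n x (kac_rotation x y (pi / 2) \<eta>) = leg_fun T n y \<eta>"
  by (simp add: leg_fun_def sq_radius_rotation[OF assms] triple_neq[OF assms] kac_rotation_nth)

text \<open>The Funk--Hecke identity: the rotation average about the \<open>z\<close> axis of a zonal harmonic about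
  the orthogonal \<open>x\<close> axis is a multiple of the zonal harmonic about the \<open>z\<close> axis.\<close>

lemma kac_avg_leg_fun:
  assumes T: "triple T x y z"
  shows "kac_avg x y (leg_fun T n x) = (\<lambda>_. leg_ev n) * leg_fun T n z"
proof
  fix \<eta> :: "real ^ 'a"
  let ?r = "sq_radius T \<eta>"
  let ?g = "\<lambda>k. (\<lambda>\<eta>. leg_coeff n k * sq_radius T \<eta> ^ (n - k)) * (\<lambda>\<eta>. (\<eta> $ x) ^ (2 * k))"
  have xy: "x \<noteq> y" using T by (simp add: triple_def)
  have pow: "kac_avg x y (\<lambda>\<eta>. (\<eta> $ x) ^ (2 * k)) \<eta> = wallis k * (?r - (\<eta> $ z)\<^sup>2) ^ k" for k
    using circle_mean_rotated_monomial[of "\<eta> $ x" "\<eta> $ y" "2 * k" 0] xy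
    by (simp add: kac_avg_def kac_rotation_nth wallis_def sq_radius_triple[OF T] power_mult)
  have "leg_fun T n x = (\<Sum>k\<le>n. ?g k)"
    by (auto simp: fun_eq_iff leg_fun_def intro: sum.cong)
  then have "kac_avg x y (leg_fun T n x) = (\<Sum>k\<le>n. kac_avg x y (?g k))"
    by (simp add: kac_avg_sum)
  also have "\<dots> = (\<Sum>k\<le>n. (\<lambda>\<eta>. leg_coeff n k * sq_radius T \<eta> ^ (n - k)) * kac_avg x y (\<lambda>\<eta>. (\<eta> $ x) ^ (2 * k)))"
    by (intro sum.cong refl kac_avg_mult_invariant)
      (simp add: rot_invariant_def sq_radius_rotation[OF T])
  finally have "kac_avg x y (leg_fun T n x) \<eta> =
      (\<Sum>k\<le>n. leg_coeff n k * wallis k * (?r - (\<eta> $ z)\<^sup>2) ^ k * ?r ^ (n - k))"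
    by (simp only: sum_fun_apply times_fun_apply pow) (simp only: mult_ac)
  also have "\<dots> = leg_ev n * leg_fun T n z \<eta>"
    by (simp add: leg_eigen_identity leg_fun_def power_mult)
  finally show "kac_avg x y (leg_fun T n x) \<eta> = ((\<lambda>_. leg_ev n) * leg_fun T n z) \<eta>"
    by simp
qed

text \<open>Among functions invariant about the \<open>x\<close> axis, a half turn in a plane
  containing that axis acts as the reflection of the \<open>x\<close> coordinate. Oddness is phrased
  through it so that rotation invariance of the measure applies directly.\<close>

definition odd_part :: "'n set \<Rightarrow> 'n \<Rightarrow> (real ^ 'n \<Rightarrow> real) \<Rightarrow> bool" where
  "odd_part T x f \<longleftrightarrow> poly_fun f \<and>
     (\<forall>y\<in>T - {x}. \<forall>z\<in>T - {x}. rot_invariant y z f) \<and>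
     (\<forall>y\<in>T - {x}. \<forall>\<eta>. f (kac_rotation x y pi \<eta>) = - f \<eta>)"

text \<open>Only the even part is expanded into Legendre degrees; the odd part is orthogonal to
  everything that occurs about the other axes and can be kept whole.\<close>

definition zonal :: "'n set \<Rightarrow> 'n \<Rightarrow> nat \<Rightarrow> (real ^ 'n \<Rightarrow> real) \<Rightarrow> bool" where
  "zonal T x D f \<longleftrightarrow> (\<exists>u c. odd_part T x u \<and> (\<forall>n. block_invariant T (c n)) \<and>
     f = u + (\<Sum>n\<le>D. c n * leg_fun T n x))"

lemma zonalI:
  "odd_part T x u \<Longrightarrow> (\<And>n. block_invariant T (c n)) \<Longrightarrow>
    f = u + (\<Sum>n\<le>D. c n * leg_fun T n x) \<Longrightarrow> zonal T x D f"
  unfolding zonal_def by (rule exI[of _ u], rule exI[of _ c], intro conjI allI)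

lemma odd_part_poly_fun [simp]: "odd_part T x u \<Longrightarrow> poly_fun u"
  by (simp add: odd_part_def)

lemma odd_part_add: "odd_part T x u \<Longrightarrow> odd_part T x v \<Longrightarrow> odd_part T x (u + v)"
  by (simp add: odd_part_def rot_invariant_add)

lemma odd_part_mult:
  assumes "block_invariant T g" "odd_part T x u" "x \<in> T"
  shows "odd_part T x (g * u)"
  unfolding odd_part_def
proof (intro conjI ballI allI)
  fix y z assume *: "y \<in> T - {x}" "z \<in> T - {x}"
  then have "rot_invariant y z g"
    using assms(1) unfolding block_invariant_def by blast
  moreover have "rot_invariant y z u"
    using assms(2) * unfolding odd_part_def by blast
  ultimately show "rot_invariant y z (g * u)"
    by (rule rot_invariant_mult)
next
  fix y \<eta> assume *: "y \<in> T - {x}"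
  then have "g (kac_rotation x y pi \<eta>) = g \<eta>"
    using assms by (intro block_invariant_rotation) auto
  moreover have "u (kac_rotation x y pi \<eta>) = - u \<eta>"
    using assms(2) * unfolding odd_part_def by blast
  ultimately show "(g * u) (kac_rotation x y pi \<eta>) = - (g * u) \<eta>"
    by simp
qed (use assms in simp)

lemma odd_part_0: "odd_part T x 0"
  by (simp add: odd_part_def rot_invariant_0)

lemma zonal_odd_part: "odd_part T x u \<Longrightarrow> zonal T x D u"
  by (rule zonalI[where c = "\<lambda>_. 0"]) (simp_all only: block_invariant_0 mult_zero_left sum.neutral_const add_0_right)

lemma zonal_0: "zonal T x D 0"
  by (intro zonal_odd_part odd_part_0)

lemma zonal_mono:
  assumes "zonal T x D f" "D \<le> E"
  shows "zonal T x E f"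
proof -
  obtain u c where u: "odd_part T x u" and c: "\<forall>n. block_invariant T (c n)"
    and f: "f = u + (\<Sum>n\<le>D. c n * leg_fun T n x)"
    using assms(1) unfolding zonal_def by (elim exE conjE)
  show ?thesis
  proof (rule zonalI)
    \<comment> \<open>The coefficients beyond \<open>D\<close> are arbitrary, so they must be set to
      0 before the range is enlarged.\<close>
    have "(\<Sum>n\<le>D. c n * leg_fun T n x) = (\<Sum>n\<le>E. (if n \<le> D then c n else 0) * leg_fun T n x)"
      using assms(2) by (intro sum.mono_neutral_cong_left) auto
    then show "f = u + (\<Sum>n\<le>E. (if n \<le> D then c n else 0) * leg_fun T n x)"
      by (simp only: f)
    show "block_invariant T (if n \<le> D then c n else 0)" for n
      using c block_invariant_0[of T] by simp
  qed (rule u)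
qed

lemma zonal_add:
  assumes "zonal T x D f" "zonal T x D g"
  shows "zonal T x D (f + g)"
proof -
  obtain u c where u: "odd_part T x u" and c: "\<forall>n. block_invariant T (c n)"
    and f: "f = u + (\<Sum>n\<le>D. c n * leg_fun T n x)"
    using assms(1) unfolding zonal_def by (elim exE conjE)
  obtain v d where v: "odd_part T x v" and d: "\<forall>n. block_invariant T (d n)"
    and g: "g = v + (\<Sum>n\<le>D. d n * leg_fun T n x)"
    using assms(2) unfolding zonal_def by (elim exE conjE)
  show ?thesis
  proof (rule zonalI)
    show "f + g = (u + v) + (\<Sum>n\<le>D. (c n + d n) * leg_fun T n x)"
      by (simp add: f g distrib_right sum.distrib)
  qed (use u v c d in \<open>auto intro: odd_part_add block_invariant_add\<close>)
qed

lemma zonal_mult: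
  assumes "zonal T x D f" "block_invariant T g" "x \<in> T"
  shows "zonal T x D (g * f)"
proof -
  obtain u c where u: "odd_part T x u" and c: "\<forall>n. block_invariant T (c n)"
    and f: "f = u + (\<Sum>n\<le>D. c n * leg_fun T n x)"
    using assms(1) unfolding zonal_def by (elim exE conjE)
  show ?thesis
  proof (rule zonalI)
    show "g * f = g * u + (\<Sum>n\<le>D. (g * c n) * leg_fun T n x)"
      by (simp add: f distrib_left sum_distrib_left mult.assoc)
  qed (use u c assms in \<open>auto intro: odd_part_mult block_invariant_mult\<close>)
qed

lemma zonal_diff:
  assumes "zonal T x D f" "zonal T x D g" "x \<in> T"
  shows "zonal T x D (f - g)"
  using zonal_add[OF assms(1) zonal_mult[OF assms(2) block_invariant_const[of T "- 1"] assms(3)]]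
  by (simp add: fun_diff_def plus_fun_def times_fun_def)

lemma zonal_sum:
  "(\<And>k. k \<in> K \<Longrightarrow> zonal T x D (f k)) \<Longrightarrow> zonal T x D (\<Sum>k\<in>K. f k)"
  by (induction K rule: infinite_finite_induct) (auto intro: zonal_add zonal_0)

lemma zonal_leg_fun: "zonal T x n (leg_fun T n x)"
proof -
  have "(\<Sum>k\<le>n. (if k = n then 1 else 0) * leg_fun T k x) =
      (\<Sum>k\<le>n. if k = n then leg_fun T k x else 0)"
    by (intro sum.cong) auto
  then have "leg_fun T n x = 0 + (\<Sum>k\<le>n. (if k = n then 1 else 0) * leg_fun T k x)"
    by simp
  moreover have "block_invariant T (if k = n then 1 else 0)" for k
    using block_invariant_const[of T 1] by (simp add: block_invariant_0 one_fun_def)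
  ultimately show ?thesis
    by (intro zonalI[OF odd_part_0])
qed

text \<open>The leading coefficient of \<open>leg_fun\<close> is 1, so the power equals
  \<open>leg_fun T k x\<close> minus lower even powers with block-invariant coefficients.\<close>

lemma zonal_even_power:
  assumes T: "triple T x y z"
  shows "zonal T x k (\<lambda>\<eta>. (\<eta> $ x) ^ (2 * k))"
proof (induction k rule: less_induct)
  case (less k)
  let ?g = "\<lambda>l \<eta>. leg_coeff k l * sq_radius T \<eta> ^ (k - l)"
  have x: "x \<in> T" using T by (simp add: triple_def)
  have g: "block_invariant T (?g l)" for l
  proof -
    have "block_invariant T ((\<lambda>_. leg_coeff k l) * (\<lambda>\<eta>. sq_radius T \<eta> ^ (k - l)))"
      by (intro block_invariant_mult block_invariant_const block_invariant_power
          block_invariant_sq_radius[OF T])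
    then show ?thesis by (simp add: times_fun_def)
  qed
  have IH: "zonal T x k (\<lambda>\<eta>. (\<eta> $ x) ^ (2 * l))" if "l \<in> {..<k}" for l
    using that by (intro zonal_mono[OF less]) auto
  have "leg_fun T k x \<eta> = (\<eta> $ x) ^ (2 * k) + (\<Sum>l<k. ?g l \<eta> * (\<eta> $ x) ^ (2 * l))" for \<eta>
    by (simp add: leg_fun_def lessThan_Suc_atMost[symmetric] mult_ac)
  then have "(\<lambda>\<eta>. (\<eta> $ x) ^ (2 * k)) =
      leg_fun T k x - (\<Sum>l<k. ?g l * (\<lambda>\<eta>. (\<eta> $ x) ^ (2 * l)))"
    by (simp add: fun_eq_iff)
  moreover have "zonal T x k (leg_fun T k x - (\<Sum>l<k. ?g l * (\<lambda>\<eta>. (\<eta> $ x) ^ (2 * l))))"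
    by (intro zonal_diff zonal_sum zonal_mult g x zonal_leg_fun IH) auto
  ultimately show ?case by (simp only:)
qed

lemma zonal_power:
  assumes T: "triple T x y z"
  shows "\<exists>D. zonal T x D (\<lambda>\<eta>. (\<eta> $ x) ^ l)"
proof (cases "even l")
  case True
  then obtain k where "l = 2 * k" by blast
  then show ?thesis using zonal_even_power[OF T] by auto
next
  case False
  have "odd_part T x (\<lambda>\<eta>. (\<eta> $ x) ^ l)"
    unfolding odd_part_def
  proof (intro conjI ballI allI)
    fix u v assume "u \<in> T - {x}" "v \<in> T - {x}"
    then have "kac_rotation u v \<theta> \<eta> $ x = \<eta> $ x" for \<theta> \<eta>
      by (cases "u = v") (auto simp: kac_rotation_nth)
    then show "rot_invariant u v (\<lambda>\<eta>. (\<eta> $ x) ^ l)"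
      by (simp add: rot_invariant_def)
  next
    fix v \<eta> assume "v \<in> T - {x}"
    then have "kac_rotation x v pi \<eta> $ x = - \<eta> $ x"
      by (auto simp: kac_rotation_nth)
    then show "(kac_rotation x v pi \<eta> $ x) ^ l = - ((\<eta> $ x) ^ l)"
      using False by simp
  qed simp
  then show ?thesis using zonal_odd_part by metis
qed

text \<open>\<open>sq_radius T\<close> minus the square of the \<open>x\<close> coordinate is the
  squared radius of the plane perpendicular to the axis. One factor is multiplied out at a time,
  which raises the power of the \<open>x\<close> coordinate by 2; hence the induction for arbitrary
  \<open>l\<close>.\<close>

lemma zonal_power_mult:
  assumes T: "triple T x y z"
  shows "\<exists>D. zonal T x D (\<lambda>\<eta>. (sq_radius T \<eta> - (\<eta> $ x)\<^sup>2) ^ m * (\<eta> $ x) ^ l)"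
proof (induction m arbitrary: l)
  case 0
  then show ?case using zonal_power[OF T] by simp
next
  case (Suc m)
  let ?h = "\<lambda>l \<eta>. (sq_radius T \<eta> - (\<eta> $ x)\<^sup>2) ^ m * (\<eta> $ x) ^ l"
  have x: "x \<in> T" using T by (simp add: triple_def)
  obtain D E where "zonal T x D (?h l)" "zonal T x E (?h (l + 2))"
    using Suc[of l] Suc[of "l + 2"] by auto
  then have "zonal T x (max D E) (sq_radius T * ?h l - ?h (l + 2))"
    by (intro zonal_diff zonal_mult block_invariant_sq_radius[OF T] x) (auto elim: zonal_mono)
  moreover have "sq_radius T * ?h l - ?h (l + 2) =
      (\<lambda>\<eta>. (sq_radius T \<eta> - (\<eta> $ x)\<^sup>2) ^ Suc m * (\<eta> $ x) ^ l)"
    by (simp add: fun_eq_iff algebra_simps power2_eq_square)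
  ultimately show ?case by metis
qed

text \<open>The average of a monomial is a power of the perpendicular radius, times a power of the
  \<open>x\<close> coordinate, times a monomial in coordinates outside \<open>T\<close>, and the
  last factor is block invariant.\<close>

lemma zonal_kac_avg:
  assumes T: "triple T x y z" and f: "poly_fun f"
  shows "\<exists>D. zonal T x D (kac_avg y z f)"
  using f
proof (induction rule: poly_fun_induct)
  case zero
  show ?case by (simp only: kac_avg_zero) (blast intro: zonal_0)
next
  case (step c \<alpha> f)
  note ne = triple_neq[OF T]
  have x: "x \<in> T" using T by (simp add: triple_def)
  let ?m = "(\<alpha> y + \<alpha> z) div 2"
  let ?\<beta> = "\<alpha>(y := 0, z := 0)"
  let ?\<gamma> = "?\<beta>(x := 0)"
  let ?h = "\<lambda>\<eta>. (sq_radius T \<eta> - (\<eta> $ x)\<^sup>2) ^ ?m * (\<eta> $ x) ^ \<alpha> x"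
  have "monom_fun ?\<beta> \<eta> = (\<eta> $ x) ^ \<alpha> x * monom_fun ?\<gamma> \<eta>" for \<eta>
    unfolding monom_fun_def using ne
    by (subst (1 2) prod.remove[of UNIV x]) (auto intro!: prod.cong)
  then have eq: "kac_avg y z (monom_fun \<alpha>) = ((\<lambda>_. circ (\<alpha> y) (\<alpha> z)) * monom_fun ?\<gamma>) * ?h"
    unfolding kac_avg_monom[OF ne(5)]
    by (simp add: fun_eq_iff sq_radius_triple[OF T] mult_ac)
  have "kac_rotation u v \<theta> \<eta> $ i = \<eta> $ i" if "u \<in> T" "v \<in> T" "i \<notin> T" for u v i \<theta> and \<eta> :: "real ^ 'a"
    using that by (cases "u = v") (auto simp: kac_rotation_nth)
  then have "block_invariant T (monom_fun ?\<gamma>)"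
    using T by (auto simp: block_invariant_def rot_invariant_def monom_fun_def triple_def
        intro!: prod.cong)
  then have inv: "block_invariant T ((\<lambda>_. c) * ((\<lambda>_. circ (\<alpha> y) (\<alpha> z)) * monom_fun ?\<gamma>))"
    by (intro block_invariant_mult block_invariant_const)
  obtain D E where D: "zonal T x D ?h" and E: "zonal T x E (kac_avg y z f)"
    using step.IH zonal_power_mult[OF T] by blast
  have "zonal T x (max D E) ((\<lambda>_. c) * ((\<lambda>_. circ (\<alpha> y) (\<alpha> z)) * monom_fun ?\<gamma>) * ?h + kac_avg y z f)"
    using D E by (intro zonal_add zonal_mult inv x) (auto elim: zonal_mono)
  then show ?case
    unfolding kac_avg_step[OF step.hyps] eq by (auto simp only: mult.assoc)
qed

section \<open>Orthogonality between axes and degrees\<close>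

lemma nu_inner_rotation:
  assumes "poly_fun f" "poly_fun g"
  shows "nu_inner (\<lambda>\<eta>. f (kac_rotation i j \<theta> \<eta>)) (\<lambda>\<eta>. g (kac_rotation i j \<theta> \<eta>)) = nu_inner f g"
proof -
  have "f * g \<in> borel_measurable \<nu>"
    using assms by (intro borel_measurable_integrable integrable_poly_fun) simp
  from integral_kac_rotation[OF this, of i j \<theta>] show ?thesis
    by (simp add: nu_inner_def times_fun_def)
qed

text \<open>The rotation preserves the measure and negates the product, so the integral equals its
  own negative.\<close>

lemma nu_inner_antisymmetric:
  assumes "poly_fun f" "poly_fun g"
    and f: "\<And>\<eta>. f (kac_rotation i j \<theta> \<eta>) = - f \<eta>" and g: "\<And>\<eta>. g (kac_rotation i j \<theta> \<eta>) = g \<eta>"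
  shows "nu_inner f g = 0"
proof -
  have "nu_inner (\<lambda>\<eta>. - f \<eta>) g = nu_inner f g"
    using nu_inner_rotation[OF assms(1,2), of i j \<theta>] by (simp add: f g)
  then show ?thesis by (simp add: nu_inner_def)
qed

lemma nu_inner_odd_part_zonal:
  assumes T: "triple T x y z" and u: "odd_part T x u" and c: "block_invariant T c"
  shows "nu_inner u (c * leg_fun T n x) = 0"
proof (rule nu_inner_antisymmetric)
  have xy: "x \<in> T" "y \<in> T" "x \<noteq> y" using T by (auto simp: triple_def)
  show "u (kac_rotation x y pi \<eta>) = - u \<eta>" for \<eta>
    using u xy by (auto simp: odd_part_def)
  show "(c * leg_fun T n x) (kac_rotation x y pi \<eta>) = (c * leg_fun T n x) \<eta>" for \<eta>
    using c xy by (simp add: leg_fun_half_turn[OF T] block_invariant_rotation)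
qed (use assms in simp_all)

text \<open>A function zonal about the \<open>y\<close> axis is fixed by the half turn in the
  \<open>(x, z)\<close> plane, which negates \<open>u\<close>.\<close>

lemma nu_inner_odd_part_other:
  assumes T: "triple T x y z" and u: "odd_part T x u" and g: "poly_fun g" "rot_invariant x z g"
  shows "nu_inner u g = 0"
proof (rule nu_inner_antisymmetric)
  show "u (kac_rotation x z pi \<eta>) = - u \<eta>" for \<eta>
    using u T by (auto simp: odd_part_def triple_def)
  show "g (kac_rotation x z pi \<eta>) = g \<eta>" for \<eta>
    using g by (simp add: rot_invariant_def)
qed (use assms in simp_all)

lemma nu_inner_leg_fun_same:
  assumes T: "triple T x y z" and g: "block_invariant T g" and h: "block_invariant T h"
  shows "nu_inner (g * leg_fun T n x) (h * leg_fun T m x) =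
    nu_inner (g * leg_fun T n y) (h * leg_fun T m y)"
proof -
  have xy: "x \<in> T" "y \<in> T" using T by (auto simp: triple_def)
  have "(\<lambda>\<eta>. (k * leg_fun T n x) (kac_rotation x y (pi / 2) \<eta>)) = k * leg_fun T n y"
    if "block_invariant T k" for k n
    using that xy by (simp add: fun_eq_iff leg_fun_quarter_turn[OF T] block_invariant_rotation)
  then show ?thesis
    using nu_inner_rotation[of "g * leg_fun T n x" "h * leg_fun T m x" x y "pi / 2"] g h
    by simp
qed

text \<open>The left factor is invariant about the \<open>x\<close> axis, so the right one may be
  replaced by its average about that axis. By the Funk--Hecke identity this average moves the
  harmonic from the \<open>y\<close> axis to the \<open>x\<close> axis at the cost of the factor
  \<open>leg_ev m\<close>.\<close>

lemma nu_inner_leg_fun_other: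
  assumes T: "triple T x y z" and g: "block_invariant T g" and h: "block_invariant T h"
  shows "nu_inner (g * leg_fun T n x) (h * leg_fun T m y) =
    leg_ev m * nu_inner (g * leg_fun T n x) (h * leg_fun T m x)"
proof -
  have T': "triple T y z x" and yz: "y \<in> T" "z \<in> T" using T by (auto simp: triple_def)
  have inv: "rot_invariant y z (g * leg_fun T n x)"
    using g yz by (intro rot_invariant_mult leg_fun_rot_invariant[OF T]) (auto simp: block_invariant_def)
  have "rot_invariant y z h"
    using h yz by (auto simp: block_invariant_def)
  then have "kac_avg y z (h * leg_fun T m y) = h * ((\<lambda>_. leg_ev m) * leg_fun T m x)"
    by (simp add: kac_avg_mult_invariant kac_avg_leg_fun[OF T'])
  also have "\<dots> = (\<lambda>_. leg_ev m) * (h * leg_fun T m x)"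
    by (simp add: mult.left_commute)
  finally have "nu_inner ((\<lambda>_. leg_ev m) * (h * leg_fun T m x)) (g * leg_fun T n x) =
      nu_inner (h * leg_fun T m y) (g * leg_fun T n x)"
    using nu_inner_kac_avg_left[OF _ _ inv, of "h * leg_fun T m y"] g h by simp
  then show ?thesis
    by (simp add: nu_inner_commute)
qed

text \<open>Averaging about either axis evaluates the mixed product in two ways, as
  \<open>leg_ev m\<close> and as \<open>leg_ev n\<close> times the same number, and these two
  factors differ.\<close>

lemma nu_inner_leg_fun_orthogonal:
  assumes T: "triple T x y z" and g: "block_invariant T g" and h: "block_invariant T h"
    and "n \<noteq> m"
  shows "nu_inner (g * leg_fun T n x) (h * leg_fun T m x) = 0"
    "nu_inner (g * leg_fun T n x) (h * leg_fun T m y) = 0"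
proof -
  let ?B = "nu_inner (g * leg_fun T n x) (h * leg_fun T m x)"
  have T': "triple T y x z" using T by (auto simp: triple_def)
  have *: "nu_inner (g * leg_fun T n x) (h * leg_fun T m y) = leg_ev m * ?B"
    by (rule nu_inner_leg_fun_other[OF T g h])
  moreover have "nu_inner (h * leg_fun T m y) (g * leg_fun T n x) =
      leg_ev n * nu_inner (h * leg_fun T m y) (g * leg_fun T n y)"
    by (rule nu_inner_leg_fun_other[OF T' h g])
  ultimately have "leg_ev m * ?B = leg_ev n * ?B"
    using nu_inner_leg_fun_same[OF T g h, of n m] by (simp add: nu_inner_commute)
  then show "?B = 0"
    using leg_ev_neq[OF \<open>n \<noteq> m\<close>] by simp
  with * show "nu_inner (g * leg_fun T n x) (h * leg_fun T m y) = 0"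
    by simp
qed

text \<open>A matrix with diagonal 1 and off-diagonal \<open>\<mu>\<close> has eigenvalues
  \<open>1 + 2 * \<mu>\<close> and \<open>1 - \<mu>\<close>, and the bounds on \<open>\<mu>\<close>
  keep both at most \<open>7/4\<close>. Since the coefficients are functions, the matrix acts on a
  Gram form \<open>b\<close>; the proof uses only its trace \<open>S\<close> and off-diagonal sum
  \<open>C\<close>, with \<open>- S \<le> C \<le> 2 * S\<close>.\<close>

lemma quadratic_form_bound:
  fixes b :: "'a \<Rightarrow> 'a \<Rightarrow> real"
  assumes sym: "b x y = b y x" "b x z = b z x" "b y z = b z y"
    and nonneg: "b x x + b y y + b z z + 2 * b x y + 2 * b x z + 2 * b y z \<ge> 0"
    and le: "2 * b x y \<le> b x x + b y y" "2 * b x z \<le> b x x + b z z" "2 * b y z \<le> b y y + b z z"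
    and pos: "b x x \<ge> 0" "b y y \<ge> 0" "b z z \<ge> 0"
    and \<mu>: "- (3 / 4) \<le> \<mu>" "\<mu> \<le> 3 / 8"
  shows "b x x + b y y + b z z + \<mu> * (2 * b x y + 2 * b x z + 2 * b y z) \<le>
    7 / 4 * (b x x + b y y + b z z)"
proof -
  define S C where "S = b x x + b y y + b z z" and "C = 2 * b x y + 2 * b x z + 2 * b y z"
  have C: "- S \<le> C"
    using nonneg by (simp add: S_def C_def)
  have C': "C \<le> 2 * S"
    using add_mono[OF add_mono[OF le(1,2)] le(3)] by (simp add: S_def C_def)
  have S: "S \<ge> 0"
    using pos by (simp add: S_def)
  have "\<mu> * C \<le> 3 / 4 * S"
  proof (cases "\<mu> \<ge> 0")
    case True
    then have "\<mu> * C \<le> \<mu> * (2 * S)"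
      using C' by (intro mult_left_mono)
    also have "\<dots> \<le> 3 / 8 * (2 * S)"
      using \<mu> S by (intro mult_right_mono) auto
    finally show ?thesis by simp
  next
    case False
    then have "(- \<mu>) * (- C) \<le> (- \<mu>) * S"
      using C by (intro mult_left_mono) auto
    also have "\<dots> \<le> 3 / 4 * S"
      using \<mu> S by (intro mult_right_mono) auto
    finally show ?thesis by simp
  qed
  then have "S + \<mu> * C \<le> 7 / 4 * S" by simp
  then show ?thesis by (simp only: S_def C_def)
qed

lemma nu_inner_double_le:
  assumes "poly_fun f" "poly_fun g"
  shows "2 * nu_inner f g \<le> nu_inner f f + nu_inner g g"
  using nu_inner_nonneg[of "f - g"] assms by (simp add: nu_inner_commute[of g f])

lemma sum_triple:
  "triple T x y z \<Longrightarrow> (\<Sum>i\<in>T. f i) = f x + f y + f z" for f :: "_ \<Rightarrow> 'b::comm_monoid_add"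
  by (auto simp: triple_def add_ac)

text \<open>Components in different Legendre degrees are orthogonal, and in degree \<open>2n\<close> the Gram matrix of
  the three axes has diagonal entries 1 and off-diagonal entries \<open>leg_ev n\<close>, with
  largest eigenvalue at most \<open>7/4\<close> unless \<open>n = 0\<close>.\<close>

lemma nu_inner_sum_zonal:
  fixes T :: "'n::finite set"
  assumes T: "triple T a b c"
    and u: "\<And>x. x \<in> T \<Longrightarrow> odd_part T x (u x)"
    and g: "\<And>x n. block_invariant T (g x n)"
    and g0: "\<And>x. x \<in> T \<Longrightarrow> nu_inner (g x 0) (g x 0) = 0"
    and \<phi>: "\<And>x. x \<in> T \<Longrightarrow> \<phi> x = u x + (\<Sum>n\<le>D. g x n * leg_fun T n x)"
  shows "nu_inner (\<Sum>x\<in>T. \<phi> x) (\<Sum>x\<in>T. \<phi> x) \<le> 7 / 4 * (\<Sum>x\<in>T. nu_inner (\<phi> x) (\<phi> x))"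
proof -
  let ?L = "\<lambda>x n. g x n * leg_fun T n x"
  have third: "\<exists>z. triple T x y z" if "x \<in> T" "y \<in> T" "x \<noteq> y" for x y
    using that T by (auto simp: triple_def)
  have poly [simp]: "poly_fun (g x n)" "poly_fun (?L x n)" for x n
    using g[of x n] by simp_all
  have upoly [simp]: "poly_fun (u x)" if "x \<in> T" for x
    using u[OF that] by simp
  \<comment> \<open>About the same axis the half turn separates odd from even; about different axes
    the invariance of the second factor contains a half turn that negates the first.\<close>
  have uL: "nu_inner (u x) (?L y n) = 0" if xy: "x \<in> T" "y \<in> T" for x y n
  proof (cases "x = y")
    case True
    obtain y' z where "triple T x y' z"
      using T xy by (auto simp: triple_def)
    then show ?thesis
      using True u[OF xy(1)] g by (auto intro: nu_inner_odd_part_zonal)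
  next
    case False
    then obtain z where z: "triple T x y z" using third[OF xy False] by blast
    then have "triple T y x z" by (auto simp: triple_def)
    moreover have "rot_invariant x z (g y n)"
      using g[of y n] z by (auto simp: block_invariant_def triple_def)
    ultimately have "rot_invariant x z (?L y n)"
      by (intro rot_invariant_mult leg_fun_rot_invariant)
    then show ?thesis
      by (intro nu_inner_odd_part_other[OF z u[OF xy(1)]]) auto
  qed
  have uu: "nu_inner (u x) (u y) = 0" if xy: "x \<in> T" "y \<in> T" "x \<noteq> y" for x y
  proof -
    obtain z where z: "triple T x y z" using third[OF xy] by blast
    then have "rot_invariant x z (u y)"
      using u[OF xy(2)] unfolding odd_part_def triple_def by blast
    then show ?thesis
      using xy by (intro nu_inner_odd_part_other[OF z u[OF xy(1)]]) auto
  qed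
  have LL: "nu_inner (?L x n) (?L y m) = 0" if xy: "x \<in> T" "y \<in> T" and "n \<noteq> m" for x y n m
  proof (cases "x = y")
    case True
    obtain y' z where "triple T x y' z"
      using T xy by (auto simp: triple_def)
    then show ?thesis
      using True \<open>n \<noteq> m\<close> g by (auto intro: nu_inner_leg_fun_orthogonal)
  next
    case False
    then obtain z where z: "triple T x y z" using third[OF xy False] by blast
    show ?thesis
      by (rule nu_inner_leg_fun_orthogonal(2)[OF z g g \<open>n \<noteq> m\<close>])
  qed
  have \<phi>\<phi>: "nu_inner (\<phi> x) (\<phi> y) =
      (if x = y then nu_inner (u x) (u x) else 0) + (\<Sum>n\<le>D. nu_inner (?L x n) (?L y n))"
    if xy: "x \<in> T" "y \<in> T" for x y
  proof -
    have "nu_inner (\<phi> x) (\<phi> y) = nu_inner (u x) (u y) +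
        (\<Sum>n\<le>D. \<Sum>m\<le>D. nu_inner (?L x n) (?L y m))"
      using xy by (simp add: \<phi> uL) (simp add: nu_inner_commute[of _ "u y"] uL, rule sum.swap)
    also have "(\<Sum>n\<le>D. \<Sum>m\<le>D. nu_inner (?L x n) (?L y m)) =
        (\<Sum>n\<le>D. \<Sum>m\<le>D. if m = n then nu_inner (?L x n) (?L y m) else 0)"
      using xy LL by (intro sum.cong) auto
    finally show ?thesis by (cases "x = y") (simp_all add: uu xy)
  qed
  have block: "(\<Sum>x\<in>T. \<Sum>y\<in>T. nu_inner (?L x n) (?L y n)) \<le>
      7 / 4 * (\<Sum>x\<in>T. nu_inner (?L x n) (?L x n))" for n
  proof -
    \<comment> \<open>All coefficients are compared on the harmonic of one fixed axis
      \<open>a\<close>; quarter turns show that the choice of axis does not change the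
      values.\<close>
    define B where "B x y = nu_inner (g x n * leg_fun T n a) (g y n * leg_fun T n a)" for x y
    have abc: "a \<in> T" "b \<in> T" "c \<in> T" using T by (auto simp: triple_def)
    have same: "nu_inner (?L x n) (?L x n) = B x x" if x: "x \<in> T" for x
    proof (cases "x = a")
      case False
      then obtain z where "triple T x a z" using third[OF x abc(1)] by blast
      then show ?thesis unfolding B_def by (rule nu_inner_leg_fun_same[OF _ g g])
    qed (simp add: B_def)
    have other: "nu_inner (?L x n) (?L y n) = leg_ev n * B x y"
      if xy: "x \<in> T" "y \<in> T" "x \<noteq> y" for x y
    proof -
      obtain z where z: "triple T x y z" using third[OF xy] by blast
      have "nu_inner (?L x n) (?L y n) =
          leg_ev n * nu_inner (g x n * leg_fun T n x) (g y n * leg_fun T n x)"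
        by (rule nu_inner_leg_fun_other[OF z g g])
      also have "nu_inner (g x n * leg_fun T n x) (g y n * leg_fun T n x) = B x y"
      proof (cases "x = a")
        case False
        then obtain z where "triple T x a z" using third[OF xy(1) abc(1)] by blast
        then show ?thesis unfolding B_def by (rule nu_inner_leg_fun_same[OF _ g g])
      qed (simp add: B_def)
      finally show ?thesis .
    qed
    have ne: "a \<noteq> b" "a \<noteq> c" "b \<noteq> c" "b \<noteq> a" "c \<noteq> a" "c \<noteq> b" using T by (auto simp: triple_def)
    have bsym: "B b a = B a b" "B c a = B a c" "B c b = B b c"
      by (simp_all add: B_def nu_inner_commute)
    have expand: "p + m * q + m * r + (m * q + s + m * t) + (m * r + m * t + w) =
        p + s + w + m * (2 * q + 2 * r + 2 * t)" for p m q r s t w :: real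
      by (simp add: algebra_simps)
    have lhs: "(\<Sum>x\<in>T. \<Sum>y\<in>T. nu_inner (?L x n) (?L y n)) =
        B a a + B b b + B c c + leg_ev n * (2 * B a b + 2 * B a c + 2 * B b c)"
      unfolding sum_triple[OF T] same[OF abc(1)] same[OF abc(2)] same[OF abc(3)]
        other[OF abc(1,2) ne(1)] other[OF abc(1,3) ne(2)] other[OF abc(2,3) ne(3)]
        other[OF abc(2,1) ne(4)] other[OF abc(3,1) ne(5)] other[OF abc(3,2) ne(6)] bsym
      by (rule expand)
    have rhs: "(\<Sum>x\<in>T. nu_inner (?L x n) (?L x n)) = B a a + B b b + B c c"
      unfolding sum_triple[OF T] same[OF abc(1)] same[OF abc(2)] same[OF abc(3)] ..
    have le: "2 * B x y \<le> B x x + B y y" for x y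
      unfolding B_def by (rule nu_inner_double_le) simp_all
    have Bpos: "0 \<le> B x x" for x
      by (simp add: B_def)
    show ?thesis
    proof (cases "n = 0")
      \<comment> \<open>In degree 0 the Gram matrix is all ones, with eigenvalue 3, so the bound
        \<open>7/4\<close> holds only because the degree-0 coefficients are assumed null.\<close>
      case True
      have "B x x = 0" if "x \<in> T" for x
        using g0[OF that] True by (simp add: B_def)
      moreover have "B x y = 0" if "y \<in> T" for x y
        using g0[OF that] True by (simp add: B_def nu_inner_null)
      ultimately show ?thesis
        unfolding lhs rhs using abc by simp
    next
      case False
      have nonneg: "B a a + B b b + B c c + 2 * B a b + 2 * B a c + 2 * B b c \<ge> 0"
        using nu_inner_nonneg[of "g a n * leg_fun T n a + g b n * leg_fun T n a + g c n * leg_fun T n a"]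
        by (simp add: B_def[symmetric] bsym)
      show ?thesis
        unfolding lhs rhs
        by (rule quadratic_form_bound) (use False nonneg le leg_ev_bounds[of n] bsym Bpos in auto)
    qed
  qed
  have \<phi>poly: "poly_fun (\<phi> x)" if "x \<in> T" for x
    using that by (simp add: \<phi>)
  have "finite T" using T by (auto simp: triple_def)
  have "nu_inner (\<Sum>x\<in>T. \<phi> x) (\<Sum>x\<in>T. \<phi> x) = (\<Sum>x\<in>T. \<Sum>y\<in>T. nu_inner (\<phi> x) (\<phi> y))"
    using \<phi>poly by (simp, intro sum.swap)
  also have "\<dots> = (\<Sum>x\<in>T. \<Sum>y\<in>T. (if x = y then nu_inner (u x) (u x) else 0) +
      (\<Sum>n\<le>D. nu_inner (?L x n) (?L y n)))"
    by (rule sum.cong[OF refl], rule sum.cong[OF refl], rule \<phi>\<phi>)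
  also have "\<dots> = (\<Sum>x\<in>T. nu_inner (u x) (u x)) +
      (\<Sum>x\<in>T. \<Sum>y\<in>T. \<Sum>n\<le>D. nu_inner (?L x n) (?L y n))"
    using \<open>finite T\<close> by (simp add: sum.distrib)
  also have "(\<Sum>x\<in>T. \<Sum>y\<in>T. \<Sum>n\<le>D. nu_inner (?L x n) (?L y n)) =
      (\<Sum>x\<in>T. \<Sum>n\<le>D. \<Sum>y\<in>T. nu_inner (?L x n) (?L y n))"
    by (rule sum.cong[OF refl], rule sum.swap)
  also have "\<dots> = (\<Sum>n\<le>D. \<Sum>x\<in>T. \<Sum>y\<in>T. nu_inner (?L x n) (?L y n))"
    by (rule sum.swap)
  also have "\<dots> \<le> (\<Sum>n\<le>D. 7 / 4 * (\<Sum>x\<in>T. nu_inner (?L x n) (?L x n)))"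
    by (intro sum_mono block)
  also have "\<dots> = 7 / 4 * (\<Sum>n\<le>D. \<Sum>x\<in>T. nu_inner (?L x n) (?L x n))"
    by (simp only: sum_distrib_left)
  also have "(\<Sum>n\<le>D. \<Sum>x\<in>T. nu_inner (?L x n) (?L x n)) =
      (\<Sum>x\<in>T. \<Sum>n\<le>D. nu_inner (?L x n) (?L x n))"
    by (rule sum.swap)
  also have "(\<Sum>x\<in>T. nu_inner (u x) (u x)) \<le> 7 / 4 * (\<Sum>x\<in>T. nu_inner (u x) (u x))"
    using sum_nonneg[of T "\<lambda>x. nu_inner (u x) (u x)"] by simp
  finally have "nu_inner (\<Sum>x\<in>T. \<phi> x) (\<Sum>x\<in>T. \<phi> x) \<le>
      7 / 4 * ((\<Sum>x\<in>T. nu_inner (u x) (u x)) + (\<Sum>x\<in>T. \<Sum>n\<le>D. nu_inner (?L x n) (?L x n)))"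
    by (simp only: distrib_left)
  also have "(\<Sum>x\<in>T. nu_inner (u x) (u x)) + (\<Sum>x\<in>T. \<Sum>n\<le>D. nu_inner (?L x n) (?L x n)) =
      (\<Sum>x\<in>T. nu_inner (\<phi> x) (\<phi> x))"
    by (simp add: \<phi>\<phi> sum.distrib)
  finally show ?thesis .
qed

section \<open>The inequality for one triangle\<close>

lemma kac_avg_adjoint:
  assumes "poly_fun f" "poly_fun g"
  shows "nu_inner (kac_avg i j f) g = nu_inner f (kac_avg i j g)"
proof -
  have "nu_inner (kac_avg i j f) g = nu_inner g (kac_avg i j f)"
    by (rule nu_inner_commute)
  also have "\<dots> = nu_inner (kac_avg i j g) (kac_avg i j f)"
    using assms by (intro nu_inner_kac_avg_left[symmetric]) (auto intro: rot_invariant_kac_avg)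
  also have "\<dots> = nu_inner (kac_avg i j f) (kac_avg i j g)"
    by (rule nu_inner_commute)
  also have "\<dots> = nu_inner f (kac_avg i j g)"
    using assms by (intro nu_inner_kac_avg_left) (auto intro: rot_invariant_kac_avg)
  finally show ?thesis .
qed

definition kac_diff :: "'n \<Rightarrow> 'n \<Rightarrow> (real ^ 'n \<Rightarrow> real) \<Rightarrow> real ^ 'n \<Rightarrow> real" where
  "kac_diff i j f = f - kac_avg i j f"

lemma poly_fun_kac_diff [simp]: "poly_fun f \<Longrightarrow> poly_fun (kac_diff i j f)"
  by (simp add: kac_diff_def)

lemma nu_inner_kac_diff_self:
  assumes f: "poly_fun f"
  shows "nu_inner (kac_diff i j f) (kac_diff i j f) = nu_inner f (kac_diff i j f)"
proof -
  have "nu_inner (kac_avg i j f) (kac_avg i j f) = nu_inner f (kac_avg i j f)"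
    using f by (simp add: kac_avg_adjoint kac_avg_idem)
  then show ?thesis
    using f by (simp add: kac_diff_def nu_inner_commute)
qed

text \<open>Let \<open>P\<close> be the sum of the three averages, so that \<open>A + B + C\<close>
  is \<open>3 - P\<close> applied to \<open>f\<close>. Once the component invariant under the whole
  block is removed, \<open>P\<close> is bounded by \<open>7/4\<close>, and the claim amounts to
  \<open>(3 - P) (7/4 - P) \<ge> 0\<close>.\<close>

lemma triple_inequality:
  fixes f :: "real ^ 'n \<Rightarrow> real"
  assumes ne: "a \<noteq> b" "a \<noteq> c" "b \<noteq> c" and f: "poly_fun f"
  defines "A \<equiv> kac_diff b c f" and "B \<equiv> kac_diff a c f" and "C \<equiv> kac_diff a b f"
  shows "nu_inner (A + B + C) (A + B + C) \<ge>
    5 / 4 * (nu_inner A A + nu_inner B B + nu_inner C C)"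
proof -
  define T where "T = {a, b, c}"
  have T: "triple T a b c" "triple T b a c" "triple T c a b"
    using ne by (auto simp: T_def triple_def)
  have abc: "a \<in> T" "b \<in> T" "c \<in> T" by (auto simp: T_def)
  \<comment> \<open>For \<open>x\<close> in \<open>T\<close> these are the two other indices, so
    \<open>P x\<close> averages about the \<open>x\<close> axis. The defaults outside
    \<open>T\<close> still lie in \<open>T\<close>, so \<open>P_eq\<close> needs no case
    distinction.\<close>
  define i j where "i x = (if x = a then b else a)" and "j x = (if x = a \<or> x = b then c else b)" for x
  define P where "P = (\<lambda>x. kac_avg (i x) (j x))"
  have P: "P a = kac_avg b c" "P b = kac_avg a c" "P c = kac_avg a b"
    using ne by (auto simp: P_def i_def j_def)
  have P_eq: "\<exists>i j. i \<in> T \<and> j \<in> T \<and> P x = kac_avg i j" for x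
    by (rule exI[of _ "i x"], rule exI[of _ "j x"]) (auto simp: P_def i_def j_def abc)
  have "\<exists>D. zonal T x D (P x f)" if "x \<in> T" for x
    using that zonal_kac_avg[OF T(1) f] zonal_kac_avg[OF T(2) f] zonal_kac_avg[OF T(3) f]
    by (auto simp: T_def P)
  then obtain D' where D': "\<And>x. x \<in> T \<Longrightarrow> zonal T x (D' x) (P x f)" by metis
  define D where "D = Max (D' ` T)"
  have "zonal T x D (P x f)" if "x \<in> T" for x
    using that by (intro zonal_mono[OF D']) (auto simp: D_def T_def)
  then have "\<forall>x\<in>T. \<exists>u. \<exists>g. odd_part T x u \<and> (\<forall>n. block_invariant T (g n)) \<and>
      P x f = u + (\<Sum>n\<le>D. g n * leg_fun T n x)"
    unfolding zonal_def by (rule ballI)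
  from bchoice[OF this] obtain u where "\<forall>x\<in>T. \<exists>g. odd_part T x (u x) \<and>
      (\<forall>n. block_invariant T (g n)) \<and> P x f = u x + (\<Sum>n\<le>D. g n * leg_fun T n x)" ..
  from bchoice[OF this] obtain g where "\<forall>x\<in>T. odd_part T x (u x) \<and>
      (\<forall>n. block_invariant T (g x n)) \<and> P x f = u x + (\<Sum>n\<le>D. g x n * leg_fun T n x)" ..
  then have ug: "\<And>x. x \<in> T \<Longrightarrow> odd_part T x (u x)"
      "\<And>x n. x \<in> T \<Longrightarrow> block_invariant T (g x n)"
      "\<And>x. x \<in> T \<Longrightarrow> P x f = u x + (\<Sum>n\<le>D. g x n * leg_fun T n x)"
    by blast+
  \<comment> \<open>Tested against block-invariant functions, each degree-0 coefficient agrees with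
    \<open>f\<close>. Hence the three coefficients coincide up to a null function, and one of them
    can be subtracted for all three axes.\<close>
  have inner_g0: "nu_inner f k = nu_inner (g x 0) k" if x: "x \<in> T" and k: "block_invariant T k" for x k
  proof -
    obtain y z where xyz: "triple T x y z" using T x by (auto simp: T_def)
    have gp: "poly_fun (g x n)" for n
      by (rule block_invariant_poly_fun[OF ug(2)[OF x]])
    obtain i j where ij: "i \<in> T" "j \<in> T" "P x = kac_avg i j" using P_eq by blast
    have "nu_inner f k = nu_inner (P x f) k"
      using k ij f by (simp add: nu_inner_kac_avg_left block_invariant_def)
    also have "\<dots> = nu_inner (u x) k + (\<Sum>n\<le>D. nu_inner (g x n * leg_fun T n x) k)"
      using ug(1)[OF x] k gp by (simp add: ug(3)[OF x])
    also have "nu_inner (u x) k = 0"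
      using nu_inner_odd_part_zonal[OF xyz ug(1)[OF x] k, of 0] by simp
    also have "(\<Sum>n\<le>D. nu_inner (g x n * leg_fun T n x) k) =
        (\<Sum>n\<le>D. if n = 0 then nu_inner (g x 0) k else 0)"
    proof (intro sum.cong refl)
      fix n
      show "nu_inner (g x n * leg_fun T n x) k = (if n = 0 then nu_inner (g x 0) k else 0)"
        using nu_inner_leg_fun_orthogonal(1)[OF xyz ug(2)[OF x] k, of n 0 n] by simp
    qed
    finally show ?thesis by simp
  qed
  define h where "h = g a 0"
  have h: "block_invariant T h" "poly_fun h" using ug(2)[OF abc(1), of 0] by (auto simp: h_def)
  define f' where "f' = f - h"
  have f': "poly_fun f'" using f h by (simp add: f'_def)
  have Ph: "P x h = h" for x
  proof -
    obtain i j where ij: "i \<in> T" "j \<in> T" "P x = kac_avg i j" using P_eq by blast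
    then have "rot_invariant i j h" using h(1) by (simp add: block_invariant_def)
    then show ?thesis by (simp add: ij kac_avg_invariant)
  qed
  have Pf': "P x f' = P x f - h" for x
    using P_eq[of x] Ph[of x] f h by (auto simp: f'_def kac_avg_diff)
  \<comment> \<open>Set to 0 outside \<open>T\<close>, since block invariance is required for every
    index.\<close>
  define g' where "g' = (\<lambda>x n. if x \<in> T then (if n = 0 then g x 0 - h else g x n) else 0)"
  let ?S = "\<Sum>x\<in>T. P x f'"
  let ?q = "nu_inner ?S ?S" and ?s = "nu_inner f' ?S" and ?N = "nu_inner f' f'"
  have Pp: "poly_fun (P x f')" for x
    using P_eq[of x] f' by auto
  have Ps: "nu_inner (P x f') (P x f') = nu_inner f' (P x f')" for x
    using P_eq[of x] f' by (auto simp: kac_avg_adjoint kac_avg_idem)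
  have "?q \<le> 7 / 4 * (\<Sum>x\<in>T. nu_inner (P x f') (P x f'))"
  proof (rule nu_inner_sum_zonal[OF T(1) ug(1)])
    show inv: "block_invariant T (g' x n)" for x n
      using ug(2) h by (auto simp: g'_def intro: block_invariant_diff block_invariant_0)
    show "nu_inner (g' x 0) (g' x 0) = 0" if "x \<in> T" for x
    proof -
      have "nu_inner (g x 0) (g' x 0) = nu_inner h (g' x 0)"
        using inner_g0[OF that inv] inner_g0[OF abc(1) inv] by (simp add: h_def)
      moreover have "nu_inner (g' x 0) (g' x 0) = nu_inner (g x 0) (g' x 0) - nu_inner h (g' x 0)"
        using that inv[of x 0] h ug(2)[OF that, of 0] by (subst (1) g'_def) simp
      ultimately show ?thesis by simp
    qed
    show "P x f' = u x + (\<Sum>n\<le>D. g' x n * leg_fun T n x)" if "x \<in> T" for x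
    proof -
      have "(\<Sum>n\<le>D. g' x n * leg_fun T n x) =
          (\<Sum>n\<le>D. g x n * leg_fun T n x - (if n = 0 then h else 0))"
        using that by (intro sum.cong) (auto simp: g'_def left_diff_distrib)
      also have "\<dots> = (\<Sum>n\<le>D. g x n * leg_fun T n x) - h"
        by (simp add: sum_subtractf)
      finally show ?thesis
        by (simp add: Pf' ug(3)[OF that])
    qed
  qed
  also have "(\<Sum>x\<in>T. nu_inner (P x f') (P x f')) = ?s"
    using Pp f' by (simp add: Ps)
  finally have q: "?q \<le> 7 / 4 * ?s" .
  have Sp: "poly_fun ?S" using Pp by simp
  have cs: "?s\<^sup>2 \<le> ?N * ?q"
    by (rule nu_inner_Cauchy_Schwarz[OF f' Sp])
  have N: "?N \<ge> 0" and qp: "?q \<ge> 0" by simp_all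
  have diff: "kac_diff i j f = f' - kac_avg i j f'" if "i \<in> T" "j \<in> T" for i j
  proof -
    have "rot_invariant i j h" using h that by (simp add: block_invariant_def)
    then show ?thesis
      using f h by (simp add: kac_diff_def f'_def kac_avg_diff kac_avg_invariant)
  qed
  have ABC: "A = f' - P a f'" "B = f' - P b f'" "C = f' - P c f'"
    using abc by (simp_all add: A_def B_def C_def diff P)
  have sumT: "(\<Sum>x\<in>T. k x) = k a + k b + k c" for k :: "'n \<Rightarrow> real ^ 'n \<Rightarrow> real"
    by (rule sum_triple[OF T(1)])
  have "A + B + C = (\<lambda>_. 3) * f' - ?S"
    by (simp add: ABC sumT fun_eq_iff)
  then have lhs: "nu_inner (A + B + C) (A + B + C) = 9 * ?N - 6 * ?s + ?q"
    using f' Sp by (simp add: nu_inner_commute[of "\<Sum>x\<in>T. P x f'" f'] del: nu_inner_sum_right nu_inner_sum_left)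
  have self: "nu_inner (f' - P x f') (f' - P x f') = ?N - nu_inner f' (P x f')" for x
    using f' Pp[of x] Ps[of x] by (simp add: nu_inner_commute[of "P x f'" f'])
  have rhs: "nu_inner A A + nu_inner B B + nu_inner C C = 3 * ?N - ?s"
    unfolding ABC self using f' Pp by (simp add: sumT)
  have "0 \<le> ?s" using q qp by linarith
  have "5 / 4 * (3 * ?N - ?s) \<le> 9 * ?N - 6 * ?s + ?q"
  proof (cases "?N = 0")
    case True
    then have "?s = 0" using cs by simp
    then show ?thesis using True qp by simp
  next
    case False
    then have N: "?N > 0" using N by linarith
    have "?s\<^sup>2 \<le> ?N * (7 / 4 * ?s)"
      using cs q N by (meson less_imp_le mult_left_mono order_trans)
    then have "?s * ?s \<le> (7 / 4 * ?N) * ?s"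
      by (simp add: power2_eq_square algebra_simps)
    then have s: "?s \<le> 7 / 4 * ?N"
      using \<open>0 \<le> ?s\<close> N by (cases "?s = 0") auto
    \<comment> \<open>The operator inequality \<open>(3 - P) (7/4 - P) \<ge> 0\<close> in scalar
      form: \<open>?s / ?N\<close> takes the place of \<open>P\<close>, and Cauchy--Schwarz replaces
      the square of \<open>?s\<close> by \<open>?N * ?q\<close>.\<close>
    have "0 \<le> (3 * ?N - ?s) * (7 / 4 * ?N - ?s)"
      using s N by (intro mult_nonneg_nonneg) auto
    also have "\<dots> = ?N * (21 / 4 * ?N - 19 / 4 * ?s) + ?s\<^sup>2"
      by (simp add: power2_eq_square algebra_simps)
    also have "\<dots> \<le> ?N * (21 / 4 * ?N - 19 / 4 * ?s + ?q)"
      using cs by (simp add: distrib_left)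
    finally have "0 \<le> 21 / 4 * ?N - 19 / 4 * ?s + ?q"
      using N by (simp add: zero_le_mult_iff)
    then show ?thesis by simp
  qed
  then show ?thesis unfolding lhs rhs .
qed

section \<open>Caputo's argument\<close>

definition kac_op :: "(real ^ 'n \<Rightarrow> real) \<Rightarrow> real ^ 'n \<Rightarrow> real" where
  "kac_op f = (\<Sum>i\<in>UNIV. \<Sum>j\<in>UNIV. kac_diff i j f)"

lemma kac_diff_same [simp]: "kac_diff i i f = 0"
  by (simp add: kac_diff_def)

lemma kac_diff_swap: "poly_fun f \<Longrightarrow> kac_diff j i f = kac_diff i j f"
  by (simp add: kac_diff_def kac_avg_swap)

lemma kac_diff_adjoint:
  "poly_fun f \<Longrightarrow> poly_fun g \<Longrightarrow> nu_inner (kac_diff i j f) g = nu_inner f (kac_diff i j g)"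
  by (simp add: kac_diff_def kac_avg_adjoint)

lemma kac_diff_idem: "poly_fun f \<Longrightarrow> kac_diff i j (kac_diff i j f) = kac_diff i j f"
  by (simp add: kac_diff_def kac_avg_diff kac_avg_idem)

lemma kac_diff_commute:
  assumes f: "poly_fun f" and dis: "k \<noteq> i" "k \<noteq> j" "l \<noteq> i" "l \<noteq> j"
  shows "kac_diff i j (kac_diff k l f) = kac_diff k l (kac_diff i j f)"
  using kac_avg_commute[OF assms] f
  by (simp add: kac_diff_def kac_avg_diff algebra_simps)

text \<open>The two projections commute, so their product is again a projection, and the inner
  product is the squared norm of its value at \<open>f\<close>.\<close>

lemma nu_inner_kac_diff_disjoint:
  assumes f: "poly_fun f" and dis: "k \<noteq> i" "k \<noteq> j" "l \<noteq> i" "l \<noteq> j"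
  shows "0 \<le> nu_inner (kac_diff i j f) (kac_diff k l f)"
proof -
  let ?w = "kac_diff i j (kac_diff k l f)"
  have "nu_inner ?w ?w = nu_inner (kac_diff k l f) ?w"
    using f by (intro nu_inner_kac_diff_self) simp
  also have "\<dots> = nu_inner (kac_diff k l f) (kac_diff k l (kac_diff i j f))"
    by (simp only: kac_diff_commute[OF f dis])
  also have "\<dots> = nu_inner (kac_diff k l (kac_diff k l f)) (kac_diff i j f)"
    using f by (intro kac_diff_adjoint[symmetric]) simp_all
  also have "\<dots> = nu_inner (kac_diff i j f) (kac_diff k l f)"
    unfolding kac_diff_idem[OF f] by (rule nu_inner_commute)
  finally show ?thesis
    using nu_inner_nonneg[of ?w] by (simp only:)
qed

text \<open>Pairs disjoint from \<open>{i, j}\<close> are dropped. The factors 2 come from counting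
  both orders of each pair.\<close>

lemma sum_pairs_lower_bound:
  fixes h :: "'n::finite \<Rightarrow> 'n \<Rightarrow> real"
  assumes ij: "i \<noteq> j" and sym: "\<And>k l. h k l = h l k" and diag: "\<And>k. h k k = 0"
    and nonneg: "\<And>k l. k \<notin> {i, j} \<Longrightarrow> l \<notin> {i, j} \<Longrightarrow> 0 \<le> h k l"
  shows "2 * h i j + 2 * (\<Sum>l\<in>UNIV - {i, j}. h i l + h j l) \<le> (\<Sum>k\<in>UNIV. \<Sum>l\<in>UNIV. h k l)"
proof -
  let ?R = "UNIV - {i, j}"
  have row: "(\<Sum>l\<in>UNIV. h k l) = h k i + h k j + (\<Sum>l\<in>?R. h k l)" for k
    by (rule sum_split2[OF ij])
  have "(\<Sum>k\<in>UNIV. \<Sum>l\<in>UNIV. h k l) =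
      (h i i + h i j + (\<Sum>l\<in>?R. h i l)) + (h j i + h j j + (\<Sum>l\<in>?R. h j l)) +
      (\<Sum>k\<in>?R. h k i + h k j + (\<Sum>l\<in>?R. h k l))"
    unfolding row by (rule sum_split2[OF ij])
  also have "\<dots> = 2 * h i j + 2 * (\<Sum>l\<in>?R. h i l + h j l) + (\<Sum>k\<in>?R. \<Sum>l\<in>?R. h k l)"
  proof -
    have "(\<Sum>k\<in>?R. h k i) = (\<Sum>k\<in>?R. h i k)" "(\<Sum>k\<in>?R. h k j) = (\<Sum>k\<in>?R. h j k)"
      by (intro sum.cong refl sym)+
    then show ?thesis
      by (simp add: diag sym[of j i] sum.distrib)
  qed
  finally have "(\<Sum>k\<in>UNIV. \<Sum>l\<in>UNIV. h k l) =
      2 * h i j + 2 * (\<Sum>l\<in>?R. h i l + h j l) + (\<Sum>k\<in>?R. \<Sum>l\<in>?R. h k l)" .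
  moreover have "(\<Sum>k\<in>?R. \<Sum>l\<in>?R. h k l) \<ge> 0"
    by (intro sum_nonneg nonneg) auto
  ultimately show ?thesis by linarith
qed

section \<open>Sums over ordered triangles and the inequality for the square\<close>

definition tri_sum :: "('n::finite \<Rightarrow> 'n \<Rightarrow> 'n \<Rightarrow> real) \<Rightarrow> real" where
  "tri_sum F = (\<Sum>i\<in>UNIV. \<Sum>j\<in>UNIV. \<Sum>l\<in>UNIV. if i \<noteq> j \<and> i \<noteq> l \<and> j \<noteq> l then F i j l else 0)"

lemma tri_sum_swap: "tri_sum (\<lambda>i j l. F j i l) = tri_sum F"
proof -
  have "tri_sum (\<lambda>i j l. F j i l) =
      (\<Sum>j\<in>UNIV. \<Sum>i\<in>UNIV. \<Sum>l\<in>UNIV. if i \<noteq> j \<and> i \<noteq> l \<and> j \<noteq> l then F j i l else 0)"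
    unfolding tri_sum_def by (rule sum.swap)
  also have "\<dots> = tri_sum F"
    unfolding tri_sum_def by (intro sum.cong refl) auto
  finally show ?thesis .
qed

lemma tri_sum_swap': "tri_sum (\<lambda>i j l. F i l j) = tri_sum F"
proof -
  have "tri_sum (\<lambda>i j l. F i l j) =
      (\<Sum>i\<in>UNIV. \<Sum>l\<in>UNIV. \<Sum>j\<in>UNIV. if i \<noteq> j \<and> i \<noteq> l \<and> j \<noteq> l then F i l j else 0)"
    unfolding tri_sum_def by (rule sum.cong[OF refl], rule sum.swap)
  also have "\<dots> = tri_sum F"
    unfolding tri_sum_def by (intro sum.cong refl) auto
  finally show ?thesis .
qed

lemma tri_sum_add: "tri_sum (\<lambda>i j l. F i j l + G i j l) = tri_sum F + tri_sum G"
proof -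
  have "(if P then a + b else 0) = (if P then a else 0) + (if P then b else 0)" for P and a b :: real
    by simp
  then show ?thesis
    by (simp only: tri_sum_def sum.distrib)
qed

lemma tri_sum_mult: "tri_sum (\<lambda>i j l. c * F i j l) = c * tri_sum F"
proof -
  have "(if P then c * a else 0) = c * (if P then a else 0)" for P and a :: real
    by simp
  then show ?thesis
    by (simp only: tri_sum_def sum_distrib_left)
qed

lemma tri_sum_mono:
  "(\<And>i j l. i \<noteq> j \<Longrightarrow> i \<noteq> l \<Longrightarrow> j \<noteq> l \<Longrightarrow> F i j l \<le> G i j l) \<Longrightarrow> tri_sum F \<le> tri_sum G"
  unfolding tri_sum_def by (intro sum_mono) auto

lemma tri_sum_inner:
  "tri_sum F = (\<Sum>i\<in>UNIV. \<Sum>j\<in>UNIV. if i = j then 0 else (\<Sum>l\<in>UNIV - {i, j}. F i j l))"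
  unfolding tri_sum_def
proof (intro sum.cong refl)
  fix i j :: 'a
  show "(\<Sum>l\<in>UNIV. if i \<noteq> j \<and> i \<noteq> l \<and> j \<noteq> l then F i j l else 0) =
      (if i = j then 0 else (\<Sum>l\<in>UNIV - {i, j}. F i j l))"
  proof (cases "i = j")
    case False
    have "(\<Sum>l\<in>UNIV. if i \<noteq> j \<and> i \<noteq> l \<and> j \<noteq> l then F i j l else 0) = (\<Sum>l\<in>UNIV - {i, j}. F i j l)"
      by (rule sum.mono_neutral_cong_right) (use False in auto)
    then show ?thesis using False by simp
  qed simp
qed

lemma tri_sum_fst_two:
  fixes F :: "'n::finite \<Rightarrow> 'n \<Rightarrow> real"
  assumes "\<And>i. F i i = 0" and "CARD('n) \<ge> 2"
  shows "tri_sum (\<lambda>i j l. F i j) = (real CARD('n) - 2) * (\<Sum>i\<in>UNIV. \<Sum>j\<in>UNIV. F i j)"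
proof -
  have "real (card (UNIV - {i, j})) = real CARD('n) - 2" if "i \<noteq> j" for i j :: 'n
    using that assms(2) by (simp add: card_Diff_subset of_nat_diff)
  then have "(if i = j then 0 else (\<Sum>l\<in>UNIV - {i, j}. F i j)) = (real CARD('n) - 2) * F i j" for i j
    using assms(1) by simp
  then show ?thesis
    unfolding tri_sum_inner by (simp only: sum_distrib_left)
qed

lemma poly_fun_kac_op [simp]: "poly_fun f \<Longrightarrow> poly_fun (kac_op f)"
  by (simp add: kac_op_def)

lemma nu_inner_kac_op:
  "poly_fun f \<Longrightarrow> nu_inner f (kac_op f) =
    (\<Sum>i\<in>UNIV. \<Sum>j\<in>UNIV. nu_inner (kac_diff i j f) (kac_diff i j f))"
  by (simp add: kac_op_def nu_inner_kac_diff_self)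

text \<open>With \<open>Y\<close> the sum of the squares over ordered pairs and \<open>X\<close> the
  sum of the products over pairs sharing an index, the disjoint pairs only help, leaving
  \<open>2 * Y + 4 * X\<close>. The triangles give \<open>8 * X \<ge> (N - 2) * Y\<close>.\<close>

theorem kac_op_squared_lower_bound:
  fixes f :: "real ^ 'n \<Rightarrow> real"
  assumes f: "poly_fun f" and N: "CARD('n) \<ge> 2"
  shows "(real CARD('n) + 2) / 2 * nu_inner f (kac_op f) \<le> nu_inner (kac_op f) (kac_op f)"
proof -
  define d where "d i j = kac_diff i j f" for i j
  have d: "poly_fun (d i j)" for i j using f by (simp add: d_def)
  have dsym: "d i j = d j i" for i j using f by (simp add: d_def kac_diff_swap)
  have d0: "d i i = 0" for i by (simp add: d_def)
  define g where "g i j k l = nu_inner (d i j) (d k l)" for i j k l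
  have g_comm: "g i j k l = g k l i j" for i j k l by (simp add: g_def nu_inner_commute)
  have g_sym1: "g i j k l = g j i k l" and g_sym2: "g i j k l = g i j l k" for i j k l
    by (simp_all add: g_def dsym[of j i] dsym[of l k])
  have g0: "g i j k k = 0" "g i i k l = 0" for i j k l by (simp_all add: g_def d0)
  define Y where "Y = (\<Sum>i\<in>UNIV. \<Sum>j\<in>UNIV. g i j i j)"
  define X where "X = tri_sum (\<lambda>i j l. g i j i l)"
  have inner: "2 * g i j i j + 2 * (if i = j then 0 else (\<Sum>l\<in>UNIV - {i, j}. g i j i l + g i j j l)) \<le>
      (\<Sum>k\<in>UNIV. \<Sum>l\<in>UNIV. g i j k l)" for i j
  proof (cases "i = j")
    case False
    have "0 \<le> g i j k l" if "k \<notin> {i, j}" "l \<notin> {i, j}" for k l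
      using that nu_inner_kac_diff_disjoint[OF f, of k i j l] by (simp add: g_def d_def)
    then have "2 * g i j i j + 2 * (\<Sum>l\<in>UNIV - {i, j}. g i j i l + g i j j l) \<le>
      (\<Sum>k\<in>UNIV. \<Sum>l\<in>UNIV. g i j k l)"
      using False g0 g_sym2 by (intro sum_pairs_lower_bound)
    then show ?thesis using False by simp
  qed (simp add: g0)
  have "2 * Y + 2 * (tri_sum (\<lambda>i j l. g i j i l + g i j j l)) =
      (\<Sum>i\<in>UNIV. \<Sum>j\<in>UNIV. 2 * g i j i j + 2 * (if i = j then 0 else (\<Sum>l\<in>UNIV - {i, j}. g i j i l + g i j j l)))"
    by (simp only: Y_def tri_sum_inner sum_distrib_left sum.distrib)
  also have "\<dots> \<le> (\<Sum>i\<in>UNIV. \<Sum>j\<in>UNIV. \<Sum>k\<in>UNIV. \<Sum>l\<in>UNIV. g i j k l)"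
    by (intro sum_mono inner)
  also have "\<dots> = nu_inner (kac_op f) (kac_op f)"
  proof -
    have left: "nu_inner (kac_op f) h = (\<Sum>i\<in>UNIV. \<Sum>j\<in>UNIV. nu_inner (d i j) h)" if "poly_fun h" for h
      using that d by (simp add: kac_op_def d_def[symmetric])
    have right: "nu_inner h (kac_op f) = (\<Sum>i\<in>UNIV. \<Sum>j\<in>UNIV. nu_inner h (d i j))" if "poly_fun h" for h
      using that d by (simp add: kac_op_def d_def[symmetric])
    show ?thesis
      unfolding left[OF poly_fun_kac_op[OF f]] right[OF d] g_def ..
  qed
  finally have total: "2 * Y + 2 * tri_sum (\<lambda>i j l. g i j i l + g i j j l) \<le>
      nu_inner (kac_op f) (kac_op f)" .
  have X2: "tri_sum (\<lambda>i j l. g i j j l) = X"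
  proof -
    have "(\<lambda>i j l. g i j j l) = (\<lambda>i j l. g j i j l)"
      by (intro ext) (rule g_sym1)
    then show ?thesis
      using tri_sum_swap[of "\<lambda>i j l. g i j i l"] by (simp only: X_def)
  qed
  \<comment> \<open>The shared index is \<open>l\<close>; two transpositions of the summation
    variables bring it to the front.\<close>
  have X3: "tri_sum (\<lambda>i j l. g i l j l) = X"
  proof -
    have "(\<lambda>i j l. g i l j l) = (\<lambda>i j l. g l i l j)"
      by (intro ext) (rule trans[OF g_sym1 g_sym2])
    then have "tri_sum (\<lambda>i j l. g i l j l) = tri_sum (\<lambda>i j l. g l i l j)"
      by (rule arg_cong)
    also have "\<dots> = tri_sum (\<lambda>i j l. g j i j l)"
      by (rule tri_sum_swap')
    also have "\<dots> = X"
      unfolding X_def by (rule tri_sum_swap)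
    finally show ?thesis .
  qed
  \<comment> \<open>\<open>1 / 8\<close> is half of \<open>5 / 4 - 1\<close>: the squares already
    account for 1, and each cross term occurs twice.\<close>
  have tri: "1 / 8 * (g i j i j + g i l i l + g j l j l) \<le> g i j i l + g i j j l + g i l j l"
    if dis: "i \<noteq> j" "i \<noteq> l" "j \<noteq> l" for i j l
  proof -
    have "5 / 4 * (g j l j l + g i l i l + g i j i j) \<le>
        nu_inner (d j l + d i l + d i j) (d j l + d i l + d i j)"
      using triple_inequality[OF dis f] by (simp add: g_def d_def)
    also have "\<dots> = g j l j l + g i l i l + g i j i j + 2 * g i j i l + 2 * g i j j l + 2 * g i l j l"
      using d by (simp add: g_def[symmetric] g_comm[of j l i l] g_comm[of j l i j] g_comm[of i l i j])
    finally show ?thesis by simp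
  qed
  have Y1: "tri_sum (\<lambda>i j l. g i j i j) = (real CARD('n) - 2) * Y"
    unfolding Y_def by (rule tri_sum_fst_two) (auto simp: g0 N)
  have Y2: "tri_sum (\<lambda>i j l. g i l i l) = (real CARD('n) - 2) * Y"
    using tri_sum_swap'[of "\<lambda>i j l. g i j i j"] Y1 by simp
  have Y3: "tri_sum (\<lambda>i j l. g j l j l) = (real CARD('n) - 2) * Y"
    using tri_sum_swap[of "\<lambda>i j l. g i l i l"] Y2 by simp
  have "1 / 8 * (3 * ((real CARD('n) - 2) * Y)) =
      tri_sum (\<lambda>i j l. 1 / 8 * (g i j i j + g i l i l + g j l j l))"
    unfolding tri_sum_mult tri_sum_add Y1 Y2 Y3 by simp
  also have "\<dots> \<le> tri_sum (\<lambda>i j l. g i j i l + g i j j l + g i l j l)"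
    by (intro tri_sum_mono tri)
  also have "\<dots> = 3 * X"
    unfolding tri_sum_add X2 X3 by (simp add: X_def)
  finally have "(real CARD('n) - 2) * Y \<le> 8 * X" by (simp add: mult.commute)
  moreover have "2 * Y + 4 * X \<le> nu_inner (kac_op f) (kac_op f)"
    using total unfolding tri_sum_add X2 by (simp add: X_def)
  moreover have "(real CARD('n) + 2) / 2 * Y = 2 * Y + (real CARD('n) - 2) * Y / 2"
    by (simp add: field_simps)
  ultimately have "(real CARD('n) + 2) / 2 * Y \<le> nu_inner (kac_op f) (kac_op f)"
    by linarith
  moreover have "nu_inner f (kac_op f) = Y"
    using f by (simp add: nu_inner_kac_op Y_def g_def d_def)
  ultimately show ?thesis by simp
qed

section \<open>The spectral gap on polynomials\<close>

lemma kac_diff_add: "poly_fun f \<Longrightarrow> poly_fun g \<Longrightarrow> kac_diff i j (f + g) = kac_diff i j f + kac_diff i j g"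
  by (simp add: kac_diff_def kac_avg_add)

lemma kac_diff_smult: "kac_diff i j ((\<lambda>_. c) * f) = (\<lambda>_. c) * kac_diff i j f"
  unfolding kac_diff_def kac_avg_smult by (simp add: right_diff_distrib)

lemma kac_op_add: "poly_fun f \<Longrightarrow> poly_fun g \<Longrightarrow> kac_op (f + g) = kac_op f + kac_op g"
  by (simp add: kac_op_def kac_diff_add sum.distrib)

lemma kac_op_smult: "kac_op ((\<lambda>_. c) * f) = (\<lambda>_. c) * kac_op f"
  by (simp add: kac_op_def kac_diff_smult sum_distrib_left)

lemma kac_op_0 [simp]: "kac_op 0 = 0"
  by (simp add: kac_op_def kac_diff_def)

lemma kac_op_sum:
  "(\<And>k. k \<in> K \<Longrightarrow> poly_fun (f k)) \<Longrightarrow> kac_op (\<Sum>k\<in>K. f k) = (\<Sum>k\<in>K. kac_op (f k))"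
  by (induction K rule: infinite_finite_induct) (auto simp: kac_op_add)

lemma kac_op_adjoint:
  "poly_fun f \<Longrightarrow> poly_fun g \<Longrightarrow> nu_inner (kac_op f) g = nu_inner f (kac_op g)"
  by (simp add: kac_op_def kac_diff_adjoint)

lemma mpoly_kac_op: "mpoly d f \<Longrightarrow> mpoly d (kac_op f)"
  unfolding kac_op_def kac_diff_def by (intro mpoly_sum mpoly_diff mpoly_kac_avg)

section \<open>The Krylov relation and the gap for polynomials\<close>

lemma homogeneous_system_nontrivial_solution:
  fixes a :: "'k \<Rightarrow> 's \<Rightarrow> real"
  assumes "finite S" "finite I" "card S < card I"
  shows "\<exists>c. (\<exists>k\<in>I. c k \<noteq> 0) \<and> (\<forall>s\<in>S. (\<Sum>k\<in>I. c k * a k s) = 0)"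
  using assms
proof (induction S arbitrary: I a rule: finite_induct)
  case empty
  then obtain k where "k \<in> I" by (metis all_not_in_conv card.empty less_irrefl)
  then show ?case by (intro exI[of _ "\<lambda>_. 1"]) auto
next
  case (insert s S)
  show ?case
  proof (cases "\<forall>k\<in>I. a k s = 0")
    case True
    have "card S < card I" using insert by simp
    from insert.IH[OF insert.prems(1) this, of a] True show ?thesis
      by auto
  next
    case False
    then obtain k0 where k0: "k0 \<in> I" "a k0 s \<noteq> 0" by blast
    let ?I = "I - {k0}"
    \<comment> \<open>Gaussian elimination: the unknown \<open>k0\<close> is the pivot of equation
      \<open>s\<close>, and \<open>b\<close> is the system left for the other unknowns.\<close>
    define b where "b k t = a k t - a k s / a k0 s * a k0 t" for k t
    have "finite ?I" "card S < card ?I"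
      using insert k0 by auto
    from insert.IH[OF this, of b] obtain c where c: "\<exists>k\<in>?I. c k \<noteq> 0"
      "\<forall>t\<in>S. (\<Sum>k\<in>?I. c k * b k t) = 0" by blast
    \<comment> \<open>The pivot unknown is solved from equation \<open>s\<close>; the others keep
      the values found for the reduced system.\<close>
    define c' where "c' k = (if k = k0 then - (\<Sum>k\<in>?I. c k * (a k s / a k0 s)) else c k)" for k
    have "(\<Sum>k\<in>I. c' k * a k t) = (\<Sum>k\<in>?I. c k * b k t)" for t
    proof -
      have "(\<Sum>k\<in>I. c' k * a k t) = c' k0 * a k0 t + (\<Sum>k\<in>?I. c' k * a k t)"
        using insert k0 by (intro sum.remove) auto
      also have "(\<Sum>k\<in>?I. c' k * a k t) = (\<Sum>k\<in>?I. c k * a k t)"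
        by (intro sum.cong) (auto simp: c'_def)
      also have "c' k0 * a k0 t = - (\<Sum>k\<in>?I. c k * (a k s / a k0 s * a k0 t))"
        by (simp add: c'_def sum_distrib_right mult.assoc)
      finally show ?thesis
        by (simp add: b_def right_diff_distrib sum_subtractf)
    qed
    moreover have "b k s = 0" for k
      using k0 by (simp add: b_def)
    ultimately have "\<forall>t\<in>insert s S. (\<Sum>k\<in>I. c' k * a k t) = 0"
      using c(2) by auto
    moreover have "\<exists>k\<in>I. c' k \<noteq> 0"
      using c(1) by (auto simp: c'_def)
    ultimately show ?thesis by blast
  qed
qed

lemma norm_axis_eq_abs: "norm (axis i x :: real ^ 'n) = \<bar>x\<bar>"
proof -
  have "axis i x = x *\<^sub>R (axis i 1 :: real ^ 'n)"
    by (simp add: vec_eq_iff axis_def)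
  then show ?thesis by simp
qed

text \<open>Rotations in the planes \<open>(i, j)\<close> remove the coordinates other than
  \<open>i\<close> one at a time, which brings any unit vector to plus or minus the
  \<open>i\<close>-th basis vector. The induction is on the number of nonzero coordinates still to
  be removed.\<close>

lemma invariant_imp_constant_on_sphere:
  fixes g :: "real ^ 'n \<Rightarrow> real"
  assumes inv: "\<And>i j \<theta> \<eta>. norm \<eta> = 1 \<Longrightarrow> g (kac_rotation i j \<theta> \<eta>) = g \<eta>"
    and N: "CARD('n) \<ge> 2" and \<eta>: "norm \<eta> = 1"
  shows "g \<eta> = g (axis i 1)"
  using \<eta>
proof (induction "card {j. j \<noteq> i \<and> \<eta> $ j \<noteq> 0}" arbitrary: \<eta> rule: less_induct)
  case less
  show ?case
  proof (cases "\<exists>j. j \<noteq> i \<and> \<eta> $ j \<noteq> 0")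
    case True
    then obtain j where j: "j \<noteq> i" "\<eta> $ j \<noteq> 0" by blast
    define r where "r = sqrt ((\<eta> $ i)\<^sup>2 + (\<eta> $ j)\<^sup>2)"
    have r: "r \<noteq> 0" using j by (simp add: r_def sum_power2_eq_zero_iff)
    have "(\<eta> $ i / r)\<^sup>2 + (\<eta> $ j / r)\<^sup>2 = 1"
      using r by (simp add: r_def power_divide add_divide_distrib[symmetric])
    then obtain t where t: "\<eta> $ i / r = cos t" "\<eta> $ j / r = sin t"
      using sincos_total_2pi by metis
    let ?\<xi> = "kac_rotation i j t \<eta>"
    have "?\<xi> $ j = 0"
      using j t[symmetric] by (simp add: kac_rotation_nth)
    moreover have "?\<xi> $ k = \<eta> $ k" if "k \<noteq> i" "k \<noteq> j" for k
      using that j by (simp add: kac_rotation_nth)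
    ultimately have "{k. k \<noteq> i \<and> ?\<xi> $ k \<noteq> 0} = {k. k \<noteq> i \<and> \<eta> $ k \<noteq> 0} - {j}"
      by auto metis
    then have "card {k. k \<noteq> i \<and> ?\<xi> $ k \<noteq> 0} < card {k. k \<noteq> i \<and> \<eta> $ k \<noteq> 0}"
      using j by (metis (mono_tags, lifting) card_Diff1_less finite mem_Collect_eq)
    from less(1)[OF this] have "g ?\<xi> = g (axis i 1)"
      using less(2) by simp
    then show ?thesis
      using inv less(2) by simp
  next
    case False
    have eq: "\<eta> = axis i (\<eta> $ i)"
      using False by (auto simp: vec_eq_iff axis_def)
    then have "\<bar>\<eta> $ i\<bar> = 1"
      using less(2) by (metis norm_axis_eq_abs)
    then consider "\<eta> $ i = 1" | "\<eta> $ i = - 1" by linarith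
    then show ?thesis
    proof cases
      case 1
      then show ?thesis using eq by simp
    next
      case 2
      have "UNIV \<noteq> {i}" using N by (metis card.empty card_insert_disjoint empty_iff finite.emptyI
            not_less_eq_eq numeral_2_eq_2 order_refl)
      then obtain j where j: "j \<noteq> i" by auto
      \<comment> \<open>The antipode of the basis vector is reached by a half turn, which uses a
        second coordinate.\<close>
      have "kac_rotation i j pi \<eta> = axis i 1"
        using 2 j False by (auto simp: vec_eq_iff axis_def kac_rotation_nth)
      then show ?thesis
        using inv[OF less(2), of i j pi] by simp
    qed
  qed
qed

lemma poly_fun_kac_op_pow [simp]: "poly_fun f \<Longrightarrow> poly_fun ((kac_op ^^ k) f)"
  by (induction k) auto

lemma mpoly_kac_op_pow: "mpoly d f \<Longrightarrow> mpoly d ((kac_op ^^ k) f)"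
  by (induction k) (auto intro: mpoly_kac_op)

lemma kac_op_linear_combination:
  "(\<And>k. k \<in> K \<Longrightarrow> poly_fun (f k)) \<Longrightarrow>
    kac_op (\<Sum>k\<in>K. (\<lambda>_. c k) * f k) = (\<Sum>k\<in>K. (\<lambda>_. c k) * kac_op (f k))"
  by (subst kac_op_sum) (simp_all only: poly_fun_mult poly_fun_const kac_op_smult)

lemma kac_op_pow_linear_combination:
  assumes f: "\<And>k. k \<in> K \<Longrightarrow> poly_fun (f k)"
  shows "(kac_op ^^ j) (\<Sum>k\<in>K. (\<lambda>_. c k) * f k) = (\<Sum>k\<in>K. (\<lambda>_. c k) * (kac_op ^^ j) (f k))"
proof (induction j)
  case (Suc j)
  have "(kac_op ^^ Suc j) (\<Sum>k\<in>K. (\<lambda>_. c k) * f k) =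
      kac_op (\<Sum>k\<in>K. (\<lambda>_. c k) * (kac_op ^^ j) (f k))"
    by (simp only: funpow.simps comp_apply Suc)
  also have "\<dots> = (\<Sum>k\<in>K. (\<lambda>_. c k) * kac_op ((kac_op ^^ j) (f k)))"
    using f by (intro kac_op_linear_combination poly_fun_kac_op_pow)
  finally show ?case
    by (simp only: funpow.simps comp_apply)
qed (simp only: funpow_0)

text \<open>By self-adjointness, \<open>kac_op\<close> and its powers have the same kernel modulo null functions.\<close>

lemma kac_op_pow_null:
  assumes g: "poly_fun g" and 0: "nu_inner ((kac_op ^^ Suc j) g) ((kac_op ^^ Suc j) g) = 0"
  shows "nu_inner (kac_op g) (kac_op g) = 0"
  using 0
proof (induction j)
  case (Suc j)
  let ?y = "(kac_op ^^ j) g"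
  have "nu_inner (kac_op ?y) (kac_op ?y) = nu_inner ?y (kac_op (kac_op ?y))"
    using g by (simp add: kac_op_adjoint)
  also have "\<dots> = 0"
    using g Suc.prems by (subst nu_inner_null) simp_all
  finally show ?case
    using Suc.IH by simp
qed simp

text \<open>The form is a sum of squared norms of the \<open>kac_diff i j g\<close>, so each of
  these vanishes on the sphere. There \<open>g\<close> equals all its averages, hence is rotation
  invariant, hence constant.\<close>

lemma kac_op_null_imp_constant:
  fixes g :: "real ^ 'n \<Rightarrow> real"
  assumes g: "poly_fun g" and 0: "nu_inner (kac_op g) (kac_op g) = 0"
    and N: "CARD('n) \<ge> 2"
  obtains K where "\<And>\<eta>. norm \<eta> = 1 \<Longrightarrow> g \<eta> = K"
proof -
  have "nu_inner g (kac_op g) = 0"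
    using g 0 by (subst nu_inner_null) simp_all
  then have *: "(\<Sum>i\<in>UNIV. \<Sum>j\<in>UNIV. nu_inner (kac_diff i j g) (kac_diff i j g)) = 0"
    using g by (simp add: nu_inner_kac_op)
  have *: "nu_inner (kac_diff i j g) (kac_diff i j g) = 0" for i j
  proof -
    have "\<forall>i\<in>UNIV. (\<Sum>j\<in>UNIV. nu_inner (kac_diff i j g) (kac_diff i j g)) = 0"
      using * by (subst (asm) sum_nonneg_eq_0_iff) (auto intro: sum_nonneg)
    then have "(\<Sum>j\<in>UNIV. nu_inner (kac_diff i j g) (kac_diff i j g)) = 0" by blast
    then show ?thesis
      by (subst (asm) sum_nonneg_eq_0_iff) auto
  qed
  have "kac_diff i j g \<eta> = 0" if "norm \<eta> = 1" for i j \<eta>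
    by (rule nu_inner_eq_0_imp[OF poly_fun_kac_diff[OF g] _ that]) (rule *)
  then have eq: "g \<eta> = kac_avg i j g \<eta>" if "norm \<eta> = 1" for i j \<eta>
    using that by (simp add: kac_diff_def)
  have "g (kac_rotation i j \<theta> \<eta>) = g \<eta>" if "norm \<eta> = 1" for i j \<theta> \<eta>
    using rot_invariant_kac_avg[OF g, of i j] eq[of \<eta> i j] eq[of "kac_rotation i j \<theta> \<eta>" i j] that
    by (simp add: rot_invariant_def)
  from invariant_imp_constant_on_sphere[OF this N] show ?thesis
    by (rule that)
qed

text \<open>The iterates of \<open>f\<close> stay in a finite-dimensional space, so a nontrivial
  polynomial in \<open>kac_op\<close> kills \<open>f\<close>. Factoring out its lowest power leaves
  a polynomial with nonzero constant term \<open>c\<close>, whose other terms are collected in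
  \<open>kac_op h\<close>.\<close>

lemma kac_op_krylov:
  fixes f :: "real ^ 'n \<Rightarrow> real"
  assumes f: "poly_fun f"
  obtains c h k where "c \<noteq> 0" "poly_fun h"
    "(kac_op ^^ k) ((\<lambda>_. c) * f + kac_op h) = 0"
proof -
  obtain d where d: "mpoly d f" using f by (auto simp: poly_fun_def)
  define S :: "('n \<Rightarrow> nat) set" where "S = {\<alpha>. sum \<alpha> UNIV \<le> d}"
  define m where "m = card S"
  let ?x = "\<lambda>k. (kac_op ^^ k) f"
  have "\<exists>a. ?x k = (\<Sum>\<alpha>\<in>S. (\<lambda>_. a \<alpha>) * monom_fun \<alpha>)" for k
    unfolding S_def by (rule mpoly_finite_combination[OF mpoly_kac_op_pow[OF d]])
  then obtain a where a: "?x k = (\<Sum>\<alpha>\<in>S. (\<lambda>_. a k \<alpha>) * monom_fun \<alpha>)" for k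
    by metis
  have "card S < card {..m}" by (simp add: m_def)
  moreover have "finite S" unfolding S_def by (rule finite_exponents)
  ultimately obtain c where c: "\<exists>k\<in>{..m}. c k \<noteq> 0" "\<forall>\<alpha>\<in>S. (\<Sum>k\<le>m. c k * a k \<alpha>) = 0"
    using homogeneous_system_nontrivial_solution[of S "{..m}" a] by auto
  \<comment> \<open>The lowest power with nonzero coefficient; its exponent becomes the
    \<open>k\<close> of the statement.\<close>
  define k0 where "k0 = (LEAST k. k \<le> m \<and> c k \<noteq> 0)"
  have k0: "k0 \<le> m \<and> c k0 \<noteq> 0"
    unfolding k0_def using c(1) by (intro LeastI_ex[of "\<lambda>k. k \<le> m \<and> c k \<noteq> 0"]) auto
  have small: "c k = 0" if "k < k0" for k
    using not_less_Least[OF that[unfolded k0_def]] that k0 by auto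
  have zero: "(\<Sum>k\<le>m. (\<lambda>_. c k) * ?x k) = 0"
  proof
    fix \<eta>
    have "?x k \<eta> = (\<Sum>\<alpha>\<in>S. a k \<alpha> * monom_fun \<alpha> \<eta>)" for k
      by (subst a) simp
    then have "(\<Sum>k\<le>m. c k * ?x k \<eta>) = (\<Sum>k\<le>m. \<Sum>\<alpha>\<in>S. c k * a k \<alpha> * monom_fun \<alpha> \<eta>)"
      by (simp only: sum_distrib_left mult.assoc)
    also have "\<dots> = (\<Sum>\<alpha>\<in>S. \<Sum>k\<le>m. c k * a k \<alpha> * monom_fun \<alpha> \<eta>)"
      by (rule sum.swap)
    also have "\<dots> = (\<Sum>\<alpha>\<in>S. (\<Sum>k\<le>m. c k * a k \<alpha>) * monom_fun \<alpha> \<eta>)"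
      by (simp only: sum_distrib_right)
    also have "\<dots> = 0"
      using c(2) by simp
    finally show "(\<Sum>k\<le>m. (\<lambda>_. c k) * ?x k) \<eta> = 0 \<eta>" by simp
  qed
  \<comment> \<open>One more power is split off from the terms above \<open>k0\<close>, hence the
    exponent \<open>k - k0 - 1\<close>.\<close>
  define h where "h = (\<Sum>k\<in>{k0<..m}. (\<lambda>_. c k) * ?x (k - k0 - 1))"
  have h: "poly_fun h" using f by (simp add: h_def)
  let ?g = "\<Sum>k\<in>{k0..m}. (\<lambda>_. c k) * ?x (k - k0)"
  have "?g = (\<lambda>_. c k0) * ?x 0 + (\<Sum>k\<in>{k0<..m}. (\<lambda>_. c k) * ?x (k - k0))"
    using k0 by (subst sum.head) simp_all
  also have "(\<Sum>k\<in>{k0<..m}. (\<lambda>_. c k) * ?x (k - k0)) =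
      (\<Sum>k\<in>{k0<..m}. (\<lambda>_. c k) * kac_op (?x (k - k0 - 1)))"
  proof (intro sum.cong refl)
    fix k assume "k \<in> {k0<..m}"
    then have "k - k0 = Suc (k - k0 - 1)" by auto
    then have "?x (k - k0) = kac_op (?x (k - k0 - 1))"
      by (metis comp_apply funpow.simps(2))
    then show "(\<lambda>_. c k) * ?x (k - k0) = (\<lambda>_. c k) * kac_op (?x (k - k0 - 1))"
      by (simp only:)
  qed
  also have "\<dots> = kac_op h"
    unfolding h_def using f by (intro kac_op_linear_combination[symmetric]) simp
  finally have g: "?g = (\<lambda>_. c k0) * f + kac_op h" by (simp only: funpow_0)
  have "(kac_op ^^ k0) ?g = (\<Sum>k\<in>{k0..m}. (\<lambda>_. c k) * (kac_op ^^ k0) (?x (k - k0)))"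
    using f by (intro kac_op_pow_linear_combination) simp
  also have "\<dots> = (\<Sum>k\<in>{k0..m}. (\<lambda>_. c k) * ?x k)"
  proof (intro sum.cong refl)
    fix k assume "k \<in> {k0..m}"
    then have "k0 + (k - k0) = k" by simp
    then have "(kac_op ^^ k0) (?x (k - k0)) = ?x k"
      using fun_cong[OF funpow_add[of k0 "k - k0" kac_op], of f] by (simp only: comp_apply)
    then show "(\<lambda>_. c k) * (kac_op ^^ k0) (?x (k - k0)) = (\<lambda>_. c k) * ?x k"
      by (simp only:)
  qed
  also have "\<dots> = (\<Sum>k\<le>m. (\<lambda>_. c k) * ?x k)"
  proof (rule sum.mono_neutral_left)
    show "\<forall>k\<in>{..m} - {k0..m}. (\<lambda>_. c k) * ?x k = 0"
      using small by (auto simp: fun_eq_iff)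
  qed auto
  also have "\<dots> = 0" by (rule zero)
  finally show ?thesis
    unfolding g using k0 h by (intro that[of "c k0" h k0] conjunct2[OF k0])
qed

lemma nu_inner_one: "nu_inner 1 f = (\<integral>\<eta>. f \<eta> \<partial>\<nu>)"
  by (simp add: nu_inner_def)

lemma nu_inner_one_kac_op:
  assumes "poly_fun f"
  shows "nu_inner 1 (kac_op f) = 0"
proof -
  have one: "poly_fun 1" by (simp add: one_fun_def)
  have "rot_invariant i j 1" for i j :: 'a by (simp add: rot_invariant_def)
  then have "kac_op (1 :: real ^ 'a \<Rightarrow> real) = 0"
    by (simp add: kac_op_def kac_diff_def kac_avg_invariant)
  then show ?thesis
    using kac_op_adjoint[OF one assms] by simp
qed

text \<open>The power in the Krylov relation can be lowered to 1 by self-adjointness, so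
  \<open>c f + kac_op h\<close> is constant on the sphere; having mean 0, it is null. Thus
  \<open>f\<close> lies in the range of \<open>kac_op\<close> up to a null function, and there the
  inequality for the square can be used.\<close>

theorem polynomial_spectral_gap:
  fixes f :: "real ^ 'n \<Rightarrow> real"
  assumes f: "poly_fun f" and mean: "(\<integral>\<eta>. f \<eta> \<partial>\<nu>) = 0" and N: "CARD('n) \<ge> 2"
  shows "(real CARD('n) + 2) / 2 * nu_inner f f \<le> nu_inner f (kac_op f)"
proof -
  let ?l = "(real CARD('n) + 2) / 2"
  obtain c h k where c: "c \<noteq> 0" and h: "poly_fun h"
    and null: "(kac_op ^^ k) ((\<lambda>_. c) * f + kac_op h) = 0"
    using kac_op_krylov[OF f] by metis
  define g where "g = (\<lambda>_. c) * f + kac_op h"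
  have g: "poly_fun g" using f h by (simp add: g_def)
  have "(kac_op ^^ Suc k) g = 0"
    using null by (simp add: g_def)
  then have Ag: "nu_inner (kac_op g) (kac_op g) = 0"
    by (intro kac_op_pow_null[OF g, of k]) simp
  obtain K where K: "\<And>\<eta>. norm \<eta> = 1 \<Longrightarrow> g \<eta> = K"
    using kac_op_null_imp_constant[OF g Ag N] by blast
  interpret prob_space "\<nu> :: (real ^ 'n) measure"
    by (rule prob_space_sphere_measure)
  have one: "poly_fun (1 :: real ^ 'n \<Rightarrow> real)" by (simp add: one_fun_def)
  have "nu_inner 1 g = c * nu_inner 1 f + nu_inner 1 (kac_op h)"
    unfolding g_def using f h one by simp
  then have "nu_inner 1 g = 0"
    using mean nu_inner_one_kac_op[OF h] by (simp add: nu_inner_one)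
  moreover have "nu_inner 1 g = (\<integral>\<eta>. K \<partial>(\<nu> :: (real ^ 'n) measure))"
    unfolding nu_inner_one
    by (intro Bochner_Integration.integral_cong refl K) (simp add: space_sphere_measure)
  ultimately have "K = 0"
    by (simp add: prob_space)
  have gg: "nu_inner g g = 0"
  proof -
    have "nu_inner g g = (\<integral>\<eta>. 0 \<partial>(\<nu> :: (real ^ 'n) measure))"
      unfolding nu_inner_def
      by (intro Bochner_Integration.integral_cong refl) (simp add: K \<open>K = 0\<close> space_sphere_measure)
    then show ?thesis by simp
  qed
  \<comment> \<open>Solving \<open>g = c f + kac_op h\<close> for \<open>f\<close> gives a value of
    \<open>kac_op\<close> plus the null function \<open>g / c\<close>.\<close>
  define u where "u = kac_op ((\<lambda>_. - 1 / c) * h)"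
  define n where "n = (\<lambda>_. 1 / c) * g"
  have u: "poly_fun u" and n: "poly_fun n" using h g by (simp_all add: u_def n_def)
  have f_eq: "f = u + n"
    unfolding u_def n_def kac_op_smult g_def using c by (simp add: fun_eq_iff field_simps)
  have nn: "nu_inner n n = 0" using gg by (simp add: n_def)
  have An: "nu_inner x n = 0" "nu_inner n x = 0" if "poly_fun x" for x
  proof -
    show "nu_inner x n = 0" by (rule nu_inner_null[OF that n nn])
    then show "nu_inner n x = 0" by (subst nu_inner_commute)
  qed
  have "nu_inner f (kac_op f) = nu_inner u (kac_op u) + nu_inner (kac_op u) n +
      nu_inner n (kac_op u) + nu_inner n (kac_op n)"
    using u n kac_op_adjoint[OF u n] by (simp add: f_eq kac_op_add)
  then have q: "nu_inner f (kac_op f) = nu_inner u (kac_op u)"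
    using u n An by simp
  have s: "nu_inner f f = nu_inner u u"
    using u n An by (simp add: f_eq)
  define w where "w = (\<lambda>_. - 1 / c) * h"
  have w: "poly_fun w" and uw: "u = kac_op w" using h by (simp_all add: w_def u_def)
  have form_nonneg: "0 \<le> nu_inner x (kac_op x)" if "poly_fun x" for x
    using that by (simp add: nu_inner_kac_op sum_nonneg)
  let ?a = "nu_inner w (kac_op w)" and ?b = "nu_inner u u"
  have ab: "?l * ?a \<le> ?b"
    using kac_op_squared_lower_bound[OF w N] by (simp add: uw)
  have Aw: "nu_inner w (kac_op u) = ?b" "nu_inner u (kac_op w) = ?b"
    using kac_op_adjoint[OF w u] by (simp_all only: uw)
  have expand: "nu_inner (u - (\<lambda>_. l) * w) (kac_op u - (\<lambda>_. l) * kac_op w) =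
      nu_inner u (kac_op u) - 2 * l * ?b + l * (l * ?a)" for l
  proof -
    have "nu_inner (u - (\<lambda>_. l) * w) (kac_op u - (\<lambda>_. l) * kac_op w) =
        (nu_inner u (kac_op u) - l * nu_inner u (kac_op w)) -
        l * (nu_inner w (kac_op u) - l * ?a)"
      using u w by (simp add: right_diff_distrib)
    then show ?thesis
      unfolding Aw by (simp add: right_diff_distrib)
  qed
  \<comment> \<open>Positivity of the form at \<open>u - l w\<close>, with
    \<open>u = kac_op w\<close> and \<open>l\<close> the claimed constant. Since \<open>l\<close>
    times the form at \<open>w\<close> is at most \<open>nu_inner u u\<close>, the expansion leaves
    \<open>l * nu_inner u u\<close> below the form at \<open>u\<close>.\<close>
  have "0 \<le> nu_inner (u - (\<lambda>_. ?l) * w) (kac_op (u - (\<lambda>_. ?l) * w))"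
    using u w by (intro form_nonneg) simp
  also have "kac_op (u - (\<lambda>_. ?l) * w) = kac_op u - (\<lambda>_. ?l) * kac_op w"
    using kac_op_add[of "u - (\<lambda>_. ?l) * w" "(\<lambda>_. ?l) * w"] u w
    by (simp add: kac_op_smult)
  also have "nu_inner (u - (\<lambda>_. ?l) * w) (kac_op u - (\<lambda>_. ?l) * kac_op w) =
      nu_inner u (kac_op u) - 2 * ?l * ?b + ?l * (?l * ?a)"
    by (rule expand)
  also have "\<dots> \<le> nu_inner u (kac_op u) - 2 * ?l * ?b + ?l * ?b"
    using ab by (intro add_left_mono mult_left_mono) auto
  finally have "0 \<le> nu_inner u (kac_op u) - 2 * ?l * ?b + ?l * ?b" .
  moreover have "l * b \<le> r" if "0 \<le> r - 2 * l * b + l * b" for r l b :: real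
    using that by (simp add: mult_ac)
  ultimately show ?thesis
    unfolding q s by blast
qed

section \<open>Density of polynomials\<close>

lemma square_add_le: "(a + b)\<^sup>2 \<le> 2 * a\<^sup>2 + 2 * (b :: real)\<^sup>2"
proof -
  have "0 \<le> (a - b)\<^sup>2" by simp
  then show ?thesis by (simp add: power2_eq_square algebra_simps)
qed

lemma integrable_square_add:
  fixes f g :: "'a \<Rightarrow> real"
  assumes [measurable]: "f \<in> borel_measurable M" "g \<in> borel_measurable M"
    and "integrable M (\<lambda>x. (f x)\<^sup>2)" "integrable M (\<lambda>x. (g x)\<^sup>2)"
  shows "integrable M (\<lambda>x. (f x + g x)\<^sup>2)"
    "(\<integral>x. (f x + g x)\<^sup>2 \<partial>M) \<le> 2 * (\<integral>x. (f x)\<^sup>2 \<partial>M) + 2 * (\<integral>x. (g x)\<^sup>2 \<partial>M)"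
proof -
  have b: "integrable M (\<lambda>x. 2 * (f x)\<^sup>2 + 2 * (g x)\<^sup>2)"
    using assms by simp
  show i: "integrable M (\<lambda>x. (f x + g x)\<^sup>2)"
  proof (rule Bochner_Integration.integrable_bound[OF b])
    show "AE x in M. norm ((f x + g x)\<^sup>2) \<le> norm (2 * (f x)\<^sup>2 + 2 * (g x)\<^sup>2)"
      using square_add_le by (intro AE_I2) (auto intro: order_trans)
  qed measurable
  have "(\<integral>x. (f x + g x)\<^sup>2 \<partial>M) \<le> (\<integral>x. 2 * (f x)\<^sup>2 + 2 * (g x)\<^sup>2 \<partial>M)"
    by (intro integral_mono i b square_add_le)
  then show "(\<integral>x. (f x + g x)\<^sup>2 \<partial>M) \<le> 2 * (\<integral>x. (f x)\<^sup>2 \<partial>M) + 2 * (\<integral>x. (g x)\<^sup>2 \<partial>M)"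
    using assms by simp
qed

lemma L2_functions_add: "f \<in> L2_functions M \<Longrightarrow> g \<in> L2_functions M \<Longrightarrow> (\<lambda>x. f x + g x) \<in> L2_functions M"
  by (auto simp: L2_functions_def intro: integrable_square_add)

lemma L2_functions_mult: "f \<in> L2_functions M \<Longrightarrow> (\<lambda>x. c * f x) \<in> L2_functions M"
  by (auto simp: L2_functions_def power_mult_distrib)

lemma L2_functions_diff: "f \<in> L2_functions M \<Longrightarrow> g \<in> L2_functions M \<Longrightarrow> (\<lambda>x. f x - g x) \<in> L2_functions M"
  using L2_functions_add[OF _ L2_functions_mult[of g M "- 1"], of f] by simp

lemma L2_functions_continuous:
  fixes f :: "real ^ 'n \<Rightarrow> real"
  assumes "continuous_on UNIV f"
  shows "f \<in> L2_sphere"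
  unfolding L2_functions_def
proof (intro CollectI conjI)
  show "f \<in> borel_measurable \<nu>"
    using assms by (intro measurable_sphere_measureI) (rule continuous_on_subset, auto)
  have "continuous_on UNIV (\<lambda>x. (f x)\<^sup>2)"
    using assms by (intro continuous_intros)
  then show "integrable \<nu> (\<lambda>x. (f x)\<^sup>2)"
    by (intro integrable_sphere_measureI) (rule continuous_on_subset, auto)
qed

lemma L2_functions_poly_fun: "poly_fun p \<Longrightarrow> p \<in> L2_sphere"
  by (intro L2_functions_continuous continuous_on_poly_fun)

text \<open>Closeness is measured by the squared distance, so the triangle inequality costs a factor
  2 on each term.\<close>

definition poly_approx :: "(real ^ 'n \<Rightarrow> real) \<Rightarrow> bool" where
  "poly_approx f \<longleftrightarrow> f \<in> L2_sphere \<and>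
     (\<forall>\<delta>>0. \<exists>p. poly_fun p \<and> sq_dist f p < \<delta>)"

lemma square_distance_triangle:
  assumes "f \<in> L2_functions M" "g \<in> L2_functions M" "h \<in> L2_functions M"
  shows "(\<integral>x. (f x - h x)\<^sup>2 \<partial>M) \<le> 2 * (\<integral>x. (f x - g x)\<^sup>2 \<partial>M) + 2 * (\<integral>x. (g x - h x)\<^sup>2 \<partial>M)"
proof -
  have "(\<lambda>x. f x - g x) \<in> L2_functions M" "(\<lambda>x. g x - h x) \<in> L2_functions M"
    using assms by (auto intro: L2_functions_diff)
  then show ?thesis
    using integrable_square_add(2)[of "\<lambda>x. f x - g x" M "\<lambda>x. g x - h x"]
    by (simp add: L2_functions_def)
qed

lemma poly_approx_limit:
  assumes f: "f \<in> L2_sphere"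
    and lim: "\<And>\<delta>. \<delta> > 0 \<Longrightarrow> \<exists>g. poly_approx g \<and> sq_dist f g < \<delta>"
  shows "poly_approx f"
  unfolding poly_approx_def
proof (intro conjI allI impI f)
  fix \<delta> :: real assume "\<delta> > 0"
  \<comment> \<open>Two errors below \<open>\<delta> / 4\<close>, each doubled, add up to less than
    \<open>\<delta>\<close>.\<close>
  then have "\<delta> / 4 > 0" by simp
  from lim[OF this] obtain g where g: "poly_approx g" "sq_dist f g < \<delta> / 4"
    by blast
  from g(1) \<open>\<delta> / 4 > 0\<close> obtain p where p: "poly_fun p" "sq_dist g p < \<delta> / 4"
    unfolding poly_approx_def by blast
  have "sq_dist f p < \<delta>"
    using square_distance_triangle[OF f _ L2_functions_poly_fun[OF p(1)], of g] g p(2)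
    by (simp add: poly_approx_def)
  with p(1) show "\<exists>p. poly_fun p \<and> sq_dist f p < \<delta>" by blast
qed

lemma poly_approx_cong:
  assumes "poly_approx f" "\<And>x. norm x = 1 \<Longrightarrow> f x = g x"
  shows "poly_approx g"
proof -
  have s: "x \<in> space \<nu> \<Longrightarrow> f x = g x" for x
    using assms(2) by (simp add: space_sphere_measure)
  have "g \<in> L2_sphere"
    using assms(1) unfolding poly_approx_def L2_functions_def
    by (simp add: s cong: measurable_cong Bochner_Integration.integrable_cong)
  moreover have "sq_dist f p = sq_dist g p" for p
    by (intro Bochner_Integration.integral_cong) (auto simp: s)
  ultimately show ?thesis
    using assms(1) by (simp add: poly_approx_def)
qed

lemma poly_approx_dominated_limit:
  fixes f :: "real ^ 'n \<Rightarrow> real"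
  assumes F: "\<And>n :: nat. poly_approx (F n)"
    and f: "f \<in> L2_sphere" and h: "integrable \<nu> h"
    and lim: "\<And>x. norm x = 1 \<Longrightarrow> (\<lambda>n. F n x) \<longlonglongrightarrow> f x"
    and bound: "\<And>n x. norm x = 1 \<Longrightarrow> (f x - F n x)\<^sup>2 \<le> h x"
  shows "poly_approx f"
proof (rule poly_approx_limit[OF f])
  fix \<delta> :: real assume "\<delta> > 0"
  have m: "f \<in> borel_measurable \<nu>" "F n \<in> borel_measurable \<nu>" for n
    using f F[of n] by (auto simp: poly_approx_def L2_functions_def)
  have "(\<lambda>n. \<integral>x. (f x - F n x)\<^sup>2 \<partial>\<nu>) \<longlonglongrightarrow> (\<integral>x. 0 \<partial>(\<nu> :: (real ^ 'n) measure))"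
  proof (rule integral_dominated_convergence[where w = h])
    show "(\<lambda>x. (f x - F n x)\<^sup>2) \<in> borel_measurable \<nu>" for n
      using m by measurable
    show "AE x in \<nu>. (\<lambda>n. (f x - F n x)\<^sup>2) \<longlonglongrightarrow> 0"
    proof (rule AE_I2)
      fix x :: "real ^ 'n" assume "x \<in> space \<nu>"
      then have "(\<lambda>n. F n x) \<longlonglongrightarrow> f x"
        by (intro lim) (simp add: space_sphere_measure)
      then have "(\<lambda>n. (f x - F n x)\<^sup>2) \<longlonglongrightarrow> (f x - f x)\<^sup>2"
        by (intro tendsto_intros)
      then show "(\<lambda>n. (f x - F n x)\<^sup>2) \<longlonglongrightarrow> 0" by simp
    qed
    show "AE x in \<nu>. norm ((f x - F n x)\<^sup>2) \<le> h x" for n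
      using bound by (intro AE_I2) (simp add: space_sphere_measure)
  qed (use h in simp_all)
  then have "(\<lambda>n. \<integral>x. (f x - F n x)\<^sup>2 \<partial>\<nu>) \<longlonglongrightarrow> 0" by simp
  then have "\<forall>\<^sub>F n in sequentially. (\<integral>x. (f x - F n x)\<^sup>2 \<partial>\<nu>) < \<delta>"
    using \<open>\<delta> > 0\<close> by (rule order_tendstoD)
  then obtain n where "(\<integral>x. (f x - F n x)\<^sup>2 \<partial>\<nu>) < \<delta>"
    using eventually_happens'[OF sequentially_bot] by fast
  with F show "\<exists>g. poly_approx g \<and> sq_dist f g < \<delta>" by blast
qed

lemma poly_approx_add:
  assumes "poly_approx f" "poly_approx g"
  shows "poly_approx (\<lambda>x. f x + g x)"
  unfolding poly_approx_def
proof (intro conjI allI impI)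
  have fg: "f \<in> L2_sphere" "g \<in> L2_sphere"
    using assms by (auto simp: poly_approx_def)
  then show "(\<lambda>x. f x + g x) \<in> L2_sphere"
    by (rule L2_functions_add)
  fix \<delta> :: real assume "\<delta> > 0"
  then have "\<delta> / 4 > 0" by simp
  then obtain p q where p: "poly_fun p" "sq_dist f p < \<delta> / 4"
    and q: "poly_fun q" "sq_dist g q < \<delta> / 4"
    using assms unfolding poly_approx_def by meson
  have L2: "(\<lambda>x. f x - p x) \<in> L2_sphere" "(\<lambda>x. g x - q x) \<in> L2_sphere"
    using fg p q by (auto intro: L2_functions_diff L2_functions_poly_fun)
  have "(\<integral>x. ((f x - p x) + (g x - q x))\<^sup>2 \<partial>\<nu>) < \<delta>"
    using integrable_square_add(2)[of "\<lambda>x. f x - p x" \<nu> "\<lambda>x. g x - q x"] L2 p(2) q(2)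
    by (simp add: L2_functions_def)
  then have "(\<integral>x. (f x + g x - (p + q) x)\<^sup>2 \<partial>\<nu>) < \<delta>"
    by (simp add: algebra_simps)
  moreover have "poly_fun (p + q)" using p q by simp
  ultimately show "\<exists>p. poly_fun p \<and> (\<integral>x. (f x + g x - p x)\<^sup>2 \<partial>\<nu>) < \<delta>" by blast
qed

lemma poly_approx_mult:
  assumes "poly_approx f"
  shows "poly_approx (\<lambda>x. c * f x)"
  unfolding poly_approx_def
proof (intro conjI allI impI)
  show "(\<lambda>x. c * f x) \<in> L2_sphere"
    using assms by (intro L2_functions_mult) (simp add: poly_approx_def)
  fix \<delta> :: real assume "\<delta> > 0"
  \<comment> \<open>Adding 1 in the denominator covers \<open>c = 0\<close>.\<close>
  then have "\<delta> / (c\<^sup>2 + 1) > 0" by (simp add: add_nonneg_pos)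
  then obtain p where p: "poly_fun p" "sq_dist f p < \<delta> / (c\<^sup>2 + 1)"
    using assms unfolding poly_approx_def by meson
  have "(\<integral>x. (c * f x - ((\<lambda>_. c) * p) x)\<^sup>2 \<partial>\<nu>) = (\<integral>x. c\<^sup>2 * (f x - p x)\<^sup>2 \<partial>\<nu>)"
    by (simp add: power_mult_distrib[symmetric] right_diff_distrib)
  also have "\<dots> = c\<^sup>2 * sq_dist f p" by simp
  also have "\<dots> \<le> (c\<^sup>2 + 1) * sq_dist f p"
    by (intro mult_right_mono) auto
  also have "\<dots> < \<delta>"
    using p(2) by (simp add: pos_less_divide_eq add_nonneg_pos mult.commute)
  finally have "(\<integral>x. (c * f x - ((\<lambda>_. c) * p) x)\<^sup>2 \<partial>\<nu>) < \<delta>" .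
  moreover have "poly_fun ((\<lambda>_. c) * p)" using p(1) by simp
  ultimately show "\<exists>p. poly_fun p \<and> (\<integral>x. (c * f x - p x)\<^sup>2 \<partial>\<nu>) < \<delta>" by blast
qed

lemma poly_approx_continuous:
  fixes f :: "real ^ 'n \<Rightarrow> real"
  assumes f: "continuous_on UNIV f"
  shows "poly_approx f"
  unfolding poly_approx_def
proof (intro conjI allI impI)
  show "f \<in> L2_sphere" using f by (rule L2_functions_continuous)
  fix \<delta> :: real assume \<delta>: "\<delta> > 0"
  interpret prob_space "\<nu> :: (real ^ 'n) measure"
    by (rule prob_space_sphere_measure)
  \<comment> \<open>A uniform error of \<open>sqrt \<delta> / 2\<close> squares to
    \<open>\<delta> / 4\<close>, and the total mass is 1.\<close>
  have "compact (sphere (0 :: real ^ 'n) 1)" "continuous_on (sphere 0 1) f" "0 < sqrt \<delta> / 2"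
    using f \<delta> by (auto intro: continuous_on_subset)
  then obtain p where p: "real_polynomial_function p" "\<And>x. x \<in> sphere 0 1 \<Longrightarrow> \<bar>f x - p x\<bar> < sqrt \<delta> / 2"
    by (rule Stone_Weierstrass_real_polynomial_function) blast
  have poly: "poly_fun p" using p(1) by (rule real_polynomial_function_imp_poly_fun)
  have "continuous_on UNIV (\<lambda>x. (f x - p x)\<^sup>2)"
    using f continuous_on_poly_fun[OF poly] by (intro continuous_intros)
  then have "integrable \<nu> (\<lambda>x. (f x - p x)\<^sup>2)"
    by (intro integrable_sphere_measureI) (rule continuous_on_subset, auto)
  then have "sq_dist f p \<le> (\<integral>x. \<delta> / 4 \<partial>(\<nu> :: (real ^ 'n) measure))"
  proof (rule integral_mono)
    fix x :: "real ^ 'n" assume "x \<in> space \<nu>"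
    then have "\<bar>f x - p x\<bar> \<le> sqrt \<delta> / 2"
      using p(2)[of x] by (simp add: space_sphere_measure)
    then have "\<bar>f x - p x\<bar>\<^sup>2 \<le> (sqrt \<delta> / 2)\<^sup>2"
      by (intro power_mono) auto
    then show "(f x - p x)\<^sup>2 \<le> \<delta> / 4"
      using \<delta> by (simp add: power_divide)
  qed simp
  also have "\<dots> < \<delta>" using \<delta> by (simp add: prob_space)
  finally show "\<exists>p. poly_fun p \<and> sq_dist f p < \<delta>"
    using poly by blast
qed

lemma poly_approx_sum:
  "(\<And>k. k \<in> K \<Longrightarrow> poly_approx (f k)) \<Longrightarrow> poly_approx (\<lambda>x. \<Sum>k\<in>K. f k x)"
  by (induction K rule: infinite_finite_induct)
    (simp_all add: poly_approx_add poly_approx_continuous)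

lemma L2_functions_indicator:
  assumes "A \<in> sets borel"
  shows "(indicator A :: real ^ 'n \<Rightarrow> real) \<in> L2_sphere"
proof -
  interpret prob_space "\<nu> :: (real ^ 'n) measure"
    by (rule prob_space_sphere_measure)
  have "(\<lambda>x. x) \<in> (\<nu> :: (real ^ 'n) measure) \<rightarrow>\<^sub>M borel"
    by (intro measurable_sphere_measureI continuous_intros)
  from measurable_compose[OF this borel_measurable_indicator[OF assms]]
  have "(indicator A :: real ^ 'n \<Rightarrow> real) \<in> borel_measurable \<nu>" .
  moreover have "(\<lambda>x. (indicator A x :: real)\<^sup>2) = indicator A"
    by (auto simp: indicator_def)
  ultimately show ?thesis
    unfolding L2_functions_def
    by (auto intro!: integrable_const_bound[where B = 1] simp: indicator_def)
qed

text \<open>The continuous functions \<open>max 0 (1 - n * infdist x C)\<close> decrease to the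
  indicator, precisely because \<open>C\<close> is closed.\<close>

lemma poly_approx_indicator_closed:
  fixes C :: "(real ^ 'n) set"
  assumes C: "closed C"
  shows "poly_approx (indicator C)"
proof (cases "C = {}")
  case True
  then show ?thesis by (simp add: poly_approx_continuous)
next
  case False
  let ?F = "\<lambda>n x. max 0 (1 - real n * infdist x C)"
  show ?thesis
  proof (rule poly_approx_dominated_limit[where F = ?F and h = "\<lambda>_. 1"])
    show "poly_approx (?F n)" for n
      by (intro poly_approx_continuous continuous_intros)
    show "(indicator C :: real ^ 'n \<Rightarrow> real) \<in> L2_sphere"
      using C by (intro L2_functions_indicator borel_closed)
    show "integrable \<nu> (\<lambda>_ :: real ^ 'n. 1 :: real)"
      by (intro integrable_sphere_measureI continuous_intros)
    fix x :: "real ^ 'n"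
    show "(indicator C x - ?F n x)\<^sup>2 \<le> 1" for n
      using infdist_nonneg[of x C] in_closed_iff_infdist_zero[OF C False, of x]
      by (auto simp: indicator_def power_le_one_iff abs_le_iff intro!: power_le_one)
    show "(\<lambda>n. ?F n x) \<longlonglongrightarrow> indicator C x"
    proof (cases "x \<in> C")
      case True
      then show ?thesis
        using in_closed_iff_infdist_zero[OF C False, of x] by simp
    next
      case notin: False
      then have pos: "infdist x C > 0"
        using C False by (intro infdist_pos_not_in_closed)
      obtain m where m: "1 / infdist x C < real m"
        using reals_Archimedean2 by blast
      have "\<forall>\<^sub>F n in sequentially. ?F n x = indicator C x"
        unfolding eventually_sequentially
      proof (intro exI[of _ m] allI impI)
        fix n assume "m \<le> n"
        then have "1 / infdist x C < real n" using m by linarith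
        then have "1 < real n * infdist x C" using pos by (simp add: field_simps)
        then show "?F n x = indicator C x" using notin by simp
      qed
      then show ?thesis by (rule tendsto_eventually)
    qed
  qed
qed

text \<open>Closed sets are stable under intersection and generate the Borel sets, so only
  complements and disjoint unions have to be checked.\<close>

lemma poly_approx_indicator:
  fixes A :: "(real ^ 'n) set"
  assumes "A \<in> sets borel"
  shows "poly_approx (indicator A)"
proof -
  have gen: "sets (borel :: (real ^ 'n) measure) = sigma_sets UNIV (Collect closed)"
    by (simp add: borel_eq_closed)
  have sub: "Collect closed \<subseteq> Pow (UNIV :: (real ^ 'n) set)"
    by simp
  have "Int_stable (Collect closed :: (real ^ 'n) set set)"
    by (auto simp: Int_stable_def)
  then show ?thesis
    using sub assms[unfolded gen]
  proof (induction rule: sigma_sets_induct_disjoint)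
    case (basic A)
    then show ?case by (simp add: poly_approx_indicator_closed)
  next
    case empty
    then show ?case by (simp add: poly_approx_continuous)
  next
    case (compl A)
    have "poly_approx (\<lambda>x. 1 + - 1 * indicator A x)"
      by (rule poly_approx_add[OF poly_approx_continuous[OF continuous_on_const] poly_approx_mult[OF compl(2)]])
    then show ?case
      by (rule poly_approx_cong) (simp add: indicator_def)
  next
    case (union A)
    let ?F = "\<lambda>n x. \<Sum>i<n. indicator (A i) x :: real"
    have F: "?F n x = indicator (\<Union>i<n. A i) x" for n x
      using union(1) by (subst indicator_UN_disjoint) (auto simp: disjoint_family_on_def)
    show ?case
    proof (rule poly_approx_dominated_limit[where F = ?F and h = "\<lambda>_. 1"])
      show "poly_approx (?F n)" for n
        using union by (intro poly_approx_sum)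
      show "(indicator (\<Union>i. A i) :: real ^ 'n \<Rightarrow> real) \<in> L2_sphere"
        using union(2) by (intro L2_functions_indicator) (auto simp: gen intro: sigma_sets.Union)
      show "integrable \<nu> (\<lambda>_ :: real ^ 'n. 1 :: real)"
        by (intro integrable_sphere_measureI continuous_intros)
      fix x :: "real ^ 'n"
      show "(indicator (\<Union>i. A i) x - ?F n x)\<^sup>2 \<le> 1" for n
        unfolding F by (auto simp: indicator_def)
      show "(\<lambda>n. ?F n x) \<longlonglongrightarrow> indicator (\<Union>i. A i) x"
        unfolding F by (rule LIMSEQ_indicator_UN)
    qed
  qed
qed

lemma L2_functions_approx:
  fixes f :: "real ^ 'n \<Rightarrow> real"
  assumes f: "f \<in> L2_sphere"
  shows "poly_approx f"
proof -
  let ?M = "\<nu> :: (real ^ 'n) measure"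
  have m: "f \<in> borel_measurable ?M" and i: "integrable ?M (\<lambda>x. (f x)\<^sup>2)"
    using f by (auto simp: L2_functions_def)
  from borel_measurable_implies_sequence_metric[OF m, of 0]
  obtain F where "(\<forall>i. simple_function ?M (F i)) \<and> (\<forall>x\<in>space ?M. (\<lambda>i. F i x) \<longlonglongrightarrow> f x) \<and>
    (\<forall>i. \<forall>x\<in>space ?M. dist (F i x) 0 \<le> 2 * dist (f x) 0)" ..
  then have F: "\<And>i. simple_function ?M (F i)"
    "\<And>x. x \<in> space ?M \<Longrightarrow> (\<lambda>i. F i x) \<longlonglongrightarrow> f x"
    "\<And>i x. x \<in> space ?M \<Longrightarrow> dist (F i x) 0 \<le> 2 * dist (f x) 0"
    by blast+
  show ?thesis
  \<comment> \<open>The simple functions satisfy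
    \<open>\<bar>F n x\<bar> \<le> 2 * \<bar>f x\<bar>\<close>, so the difference is at most
    \<open>3 * \<bar>f x\<bar>\<close>; squaring gives the factor 9.\<close>
  proof (rule poly_approx_dominated_limit[OF _ f, where F = F and h = "\<lambda>x. 9 * (f x)\<^sup>2"])
    show "poly_approx (F n)" for n
    proof -
      have borel: "F n -` {y} \<inter> space ?M \<in> sets borel" for y
        using simple_functionD(2)[OF F(1)[of n], of "{y}"]
        by (simp add: sets_sphere_measure sets_restrict_space_iff borel_closed)
      have "poly_approx (\<lambda>x. \<Sum>y\<in>F n ` space ?M. y * indicator (F n -` {y} \<inter> space ?M) x)"
        by (intro poly_approx_sum poly_approx_mult poly_approx_indicator borel)
      then show ?thesis
      proof (rule poly_approx_cong)
        fix x :: "real ^ 'n" assume "norm x = 1"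
        then have "x \<in> space ?M" by (simp add: space_sphere_measure)
        note rep = simple_function_indicator_representation_banach[OF F(1) this, of n]
        show "(\<Sum>y\<in>F n ` space ?M. y * indicator (F n -` {y} \<inter> space ?M) x) = F n x"
          by (subst rep) (rule sum.cong[OF refl], simp only: real_scaleR_def mult.commute)
      qed
    qed
    show "integrable ?M (\<lambda>x. 9 * (f x)\<^sup>2)" using i by simp
    fix x :: "real ^ 'n" assume "norm x = 1"
    then have x: "x \<in> space ?M" by (simp add: space_sphere_measure)
    then show "(\<lambda>n. F n x) \<longlonglongrightarrow> f x" by (rule F(2))
    show "(f x - F n x)\<^sup>2 \<le> 9 * (f x)\<^sup>2" for n
    proof -
      have "\<bar>f x - F n x\<bar> \<le> 3 * \<bar>f x\<bar>"
        using F(3)[OF x, of n] by simp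
      then have "\<bar>f x - F n x\<bar>\<^sup>2 \<le> (3 * \<bar>f x\<bar>)\<^sup>2"
        by (intro power_mono) auto
      then show ?thesis by (simp add: power_mult_distrib)
    qed
  qed
qed

section \<open>The Dirichlet form on square integrable functions\<close>

lemma L2_rotation:
  assumes "f \<in> L2_sphere"
  shows "(\<lambda>x. f (kac_rotation i j \<theta> x)) \<in> L2_sphere"
    "(\<integral>x. (f (kac_rotation i j \<theta> x))\<^sup>2 \<partial>\<nu>) = sq_norm f"
proof -
  have m: "f \<in> borel_measurable \<nu>" and i: "integrable \<nu> (\<lambda>x. (f x)\<^sup>2)"
    using assms by (auto simp: L2_functions_def)
  have "integrable (distr \<nu> \<nu> (kac_rotation i j \<theta>)) (\<lambda>x. (f x)\<^sup>2)"
    using i by (simp add: sphere_measure_orthogonal_invariant orthogonal_transformation_kac_rotation)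
  then have "integrable \<nu> (\<lambda>x. (f (kac_rotation i j \<theta> x))\<^sup>2)"
    by (rule integrable_distr[OF measurable_kac_rotation_sphere])
  then show "(\<lambda>x. f (kac_rotation i j \<theta> x)) \<in> L2_sphere"
    using measurable_compose[OF measurable_kac_rotation_sphere m] by (simp add: L2_functions_def)
  have "(\<lambda>x. (f x)\<^sup>2) \<in> borel_measurable \<nu>"
    using m by measurable
  from integral_kac_rotation[OF this]
  show "(\<integral>x. (f (kac_rotation i j \<theta> x))\<^sup>2 \<partial>\<nu>) = sq_norm f" .
qed

lemma abs_mult_le_squares: "\<bar>a * b\<bar> \<le> a\<^sup>2 + (b :: real)\<^sup>2"
proof -
  have "2 * \<bar>a * b\<bar> \<le> a\<^sup>2 + b\<^sup>2"
    using sum_squares_bound[of "\<bar>a\<bar>" "\<bar>b\<bar>"] by (simp add: abs_mult mult.assoc)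
  then show ?thesis by linarith
qed

lemma L2_functions_integrable_mult:
  assumes "f \<in> L2_functions M" "g \<in> L2_functions M"
  shows "integrable M (\<lambda>x. f x * g x :: real)"
proof (rule Bochner_Integration.integrable_bound)
  show "integrable M (\<lambda>x. (f x)\<^sup>2 + (g x)\<^sup>2)"
    using assms by (simp add: L2_functions_def)
  show "(\<lambda>x. f x * g x) \<in> borel_measurable M"
  proof -
    have [measurable]: "f \<in> borel_measurable M" "g \<in> borel_measurable M"
      using assms by (auto simp: L2_functions_def)
    show ?thesis by measurable
  qed
  show "AE x in M. norm (f x * g x) \<le> norm ((f x)\<^sup>2 + (g x)\<^sup>2)"
    using abs_mult_le_squares by (intro AE_I2) simp
qed

text \<open>With the angle outermost, the inner integral of the absolute value does not depend on
  the angle, by rotation invariance. Integrability is checked in that order and the product is then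
  swapped.\<close>

lemma integrable_rotation_pair:
  fixes u :: "real ^ 'n \<Rightarrow> real"
  assumes u: "integrable \<nu> u"
  shows "integrable (\<nu> \<Otimes>\<^sub>M lborel)
    (\<lambda>(x, \<theta>). indicator {0..2 * pi} \<theta> * u (kac_rotation i j \<theta> x))"
proof -
  let ?M = "\<nu> :: (real ^ 'n) measure"
  interpret S: prob_space ?M by (rule prob_space_sphere_measure)
  interpret P: pair_sigma_finite "lborel :: real measure" ?M ..
  let ?G = "\<lambda>(\<theta>, x). indicator {0..2 * pi} \<theta> * u (kac_rotation i j \<theta> x)"
  have um: "u \<in> borel_measurable ?M" using u by simp
  have m: "(\<lambda>p. kac_rotation i j (fst p) (snd p)) \<in> lborel \<Otimes>\<^sub>M ?M \<rightarrow>\<^sub>M ?M"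
    using measurable_compose[OF measurable_pair_swap' measurable_rotation_pair, of i j]
    by (simp add: case_prod_unfold)
  have int: "integrable ?M (\<lambda>x. u (kac_rotation i j \<theta> x))" for \<theta>
  proof -
    have "integrable (distr ?M ?M (kac_rotation i j \<theta>)) u"
      using u by (simp add: sphere_measure_orthogonal_invariant orthogonal_transformation_kac_rotation)
    then show ?thesis
      by (rule integrable_distr[OF measurable_kac_rotation_sphere])
  qed
  have "integrable (lborel \<Otimes>\<^sub>M ?M) ?G"
  proof (rule P.Fubini_integrable)
    have [measurable]: "(\<lambda>p. u (kac_rotation i j (fst p) (snd p))) \<in> borel_measurable (lborel \<Otimes>\<^sub>M ?M)"
      using measurable_compose[OF m um] by simp
    have "(\<lambda>p. indicator {0..2 * pi} (fst p) * u (kac_rotation i j (fst p) (snd p)))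
        \<in> borel_measurable (lborel \<Otimes>\<^sub>M ?M)"
      by measurable
    then show "?G \<in> borel_measurable (lborel \<Otimes>\<^sub>M ?M)"
      by (simp add: case_prod_unfold)
    have "(\<integral>x. norm (?G (\<theta>, x)) \<partial>?M) = indicator {0..2 * pi} \<theta> * (\<integral>x. \<bar>u x\<bar> \<partial>?M)" for \<theta>
    proof -
      have "(\<lambda>x. \<bar>u x\<bar>) \<in> borel_measurable ?M" using um by measurable
      from integral_kac_rotation[OF this, of i j \<theta>] show ?thesis
        by (simp add: abs_mult)
    qed
    moreover have "integrable lborel (\<lambda>\<theta>. indicator {0..2 * pi} \<theta> * (\<integral>x. \<bar>u x\<bar> \<partial>?M))"
      by (intro integrable_mult_left integrable_real_indicator) auto
    ultimately show "integrable lborel (\<lambda>\<theta>. \<integral>x. norm (?G (\<theta>, x)) \<partial>?M)"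
      by simp
    show "AE \<theta> in lborel. integrable ?M (\<lambda>x. ?G (\<theta>, x))"
      using int by simp
  qed
  from P.integrable_product_swap[OF this] show ?thesis
    by (simp add: case_prod_unfold)
qed

lemma integrable_product_pair:
  fixes f :: "real ^ 'n \<Rightarrow> real"
  assumes f: "f \<in> L2_sphere"
  shows "integrable (\<nu> \<Otimes>\<^sub>M lborel)
    (\<lambda>(x, \<theta>). indicator {0..2 * pi} \<theta> * (f x * (f (kac_rotation i j \<theta> x) - f x)))"
proof -
  let ?M = "\<nu> :: (real ^ 'n) measure"
  let ?R = "\<lambda>p. kac_rotation i j (snd p) (fst p)"
  have m: "f \<in> borel_measurable ?M" and i: "integrable ?M (\<lambda>x. (f x)\<^sup>2)"
    using f by (auto simp: L2_functions_def)
  have 1: "integrable (?M \<Otimes>\<^sub>M lborel) (\<lambda>p. indicator {0..2 * pi} (snd p) * (f (?R p))\<^sup>2)"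
    using integrable_rotation_pair[OF i, of i j] by (simp add: case_prod_unfold)
  \<comment> \<open>The rotation with equal indices is the identity, so the general statement also
    covers the unrotated square.\<close>
  have 2: "integrable (?M \<Otimes>\<^sub>M lborel) (\<lambda>p. indicator {0..2 * pi} (snd p) * (f (fst p))\<^sup>2)"
    using integrable_rotation_pair[OF i, of i i] by (simp add: case_prod_unfold)
  have [measurable]: "(\<lambda>p. f (fst p)) \<in> borel_measurable (?M \<Otimes>\<^sub>M lborel)"
    using m by measurable
  have [measurable]: "(\<lambda>p. f (?R p)) \<in> borel_measurable (?M \<Otimes>\<^sub>M lborel)"
    using measurable_compose[OF measurable_rotation_pair m, of i j] by (simp add: case_prod_unfold)
  have "integrable (?M \<Otimes>\<^sub>M lborel)
      (\<lambda>p. indicator {0..2 * pi} (snd p) * (f (fst p) * (f (?R p) - f (fst p))))"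
  proof (rule Bochner_Integration.integrable_bound)
    show "integrable (?M \<Otimes>\<^sub>M lborel) (\<lambda>p. indicator {0..2 * pi} (snd p) * (f (?R p))\<^sup>2 +
        2 * (indicator {0..2 * pi} (snd p) * (f (fst p))\<^sup>2))"
      using 1 2 by simp
    have *: "\<bar>a * (b - a)\<bar> \<le> b\<^sup>2 + 2 * a\<^sup>2" for a b :: real
    proof -
      have "\<bar>a * (b - a)\<bar> = \<bar>a * b - a\<^sup>2\<bar>"
        by (simp add: power2_eq_square right_diff_distrib)
      also have "\<dots> \<le> \<bar>a * b\<bar> + a\<^sup>2"
        using abs_triangle_ineq4[of "a * b" "a\<^sup>2"] by simp
      finally show ?thesis
        using abs_mult_le_squares[of a b] by linarith
    qed
    show "AE p in ?M \<Otimes>\<^sub>M lborel.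
        norm (indicator {0..2 * pi} (snd p) * (f (fst p) * (f (?R p) - f (fst p)))) \<le>
        norm (indicator {0..2 * pi} (snd p) * (f (?R p))\<^sup>2 + 2 * (indicator {0..2 * pi} (snd p) * (f (fst p))\<^sup>2))"
      by (rule AE_I2) (simp add: indicator_def *)
  qed measurable
  then show ?thesis by (simp add: case_prod_unfold)
qed

definition pair_energy :: "'n \<Rightarrow> 'n \<Rightarrow> (real ^ 'n \<Rightarrow> real) \<Rightarrow> real \<Rightarrow> real" where
  "pair_energy i j f \<theta> = (\<integral>x. (f x - f (kac_rotation i j \<theta> x))\<^sup>2 \<partial>\<nu>) / 2"

text \<open>The quadratic form of \<open>2N\<close> times the negative generator, written with
  squared differences: it is visibly nonnegative and can be controlled under perturbations in the
  mean square.\<close>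

definition kac_form :: "(real ^ 'n \<Rightarrow> real) \<Rightarrow> real" where
  "kac_form f = (\<Sum>i\<in>UNIV. \<Sum>j\<in>UNIV. circle_mean (pair_energy i j f))"

text \<open>A rotation preserves the squared norm, so half the squared norm of the difference is the
  squared norm minus the inner product of \<open>f\<close> with its rotated copy.\<close>

lemma pair_energy_eq:
  assumes f: "f \<in> L2_sphere"
  shows "(\<integral>x. f x * (f (kac_rotation i j \<theta> x) - f x) \<partial>\<nu>) = - pair_energy i j f \<theta>"
proof -
  let ?g = "\<lambda>x. f (kac_rotation i j \<theta> x)"
  note g = L2_rotation[OF f, of i j \<theta>]
  have i: "integrable \<nu> (\<lambda>x. (f x)\<^sup>2)" "integrable \<nu> (\<lambda>x. (?g x)\<^sup>2)"
    "integrable \<nu> (\<lambda>x. f x * ?g x)"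
    using f g L2_functions_integrable_mult[OF f g(1)] by (auto simp: L2_functions_def)
  have "(\<integral>x. (f x - ?g x)\<^sup>2 \<partial>\<nu>) =
      (\<integral>x. (f x)\<^sup>2 + (?g x)\<^sup>2 - 2 * (f x * ?g x) \<partial>\<nu>)"
    by (simp add: power2_eq_square algebra_simps)
  also have "\<dots> = 2 * sq_norm f - 2 * (\<integral>x. f x * ?g x \<partial>\<nu>)"
    using i g(2) by simp
  finally have 1: "pair_energy i j f \<theta> =
      sq_norm f - (\<integral>x. f x * ?g x \<partial>\<nu>)"
    by (simp add: pair_energy_def)
  have "(\<integral>x. f x * (?g x - f x) \<partial>\<nu>) = (\<integral>x. f x * ?g x - (f x)\<^sup>2 \<partial>\<nu>)"
    by (simp add: power2_eq_square algebra_simps)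
  then show ?thesis
    using i by (simp add: 1)
qed

lemma pair_energy_integrable:
  fixes f :: "real ^ 'n \<Rightarrow> real"
  assumes f: "f \<in> L2_sphere"
  shows "set_integrable lborel {0..2 * pi} (pair_energy i j f)"
    "integrable \<nu> (\<lambda>x. f x * circle_mean (\<lambda>\<theta>. f (kac_rotation i j \<theta> x) - f x))"
    "(\<integral>x. f x * circle_mean (\<lambda>\<theta>. f (kac_rotation i j \<theta> x) - f x) \<partial>\<nu>) =
       - circle_mean (pair_energy i j f)"
proof -
  let ?M = "\<nu> :: (real ^ 'n) measure"
  let ?F = "\<lambda>x \<theta>. f x * (f (kac_rotation i j \<theta> x) - f x)"
  interpret S: prob_space ?M by (rule prob_space_sphere_measure)
  interpret P: pair_sigma_finite ?M "lborel :: real measure" ..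
  interpret Q: pair_sigma_finite "lborel :: real measure" ?M ..
  note int = integrable_product_pair[OF f, of i j]
  from Q.integrable_fst'[OF P.integrable_product_swap[OF int]]
  have "integrable lborel (\<lambda>\<theta>. - (\<integral>x. indicator {0..2 * pi} \<theta> * ?F x \<theta> \<partial>?M))"
    by simp
  then show "set_integrable lborel {0..2 * pi} (pair_energy i j f)"
    by (simp add: set_integrable_def pair_energy_eq[OF f])
  have eq: "f x * circle_mean (\<lambda>\<theta>. f (kac_rotation i j \<theta> x) - f x) = circle_mean (?F x)" for x
    by (rule circle_mean_mult[symmetric])
  from P.integrable_fst'[OF int]
  have "integrable ?M (\<lambda>x. 1 / (2 * pi) * (\<integral>\<theta>. indicator {0..2 * pi} \<theta> * ?F x \<theta> \<partial>lborel))"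
    by (intro integrable_mult_right) simp
  then show "integrable ?M (\<lambda>x. f x * circle_mean (\<lambda>\<theta>. f (kac_rotation i j \<theta> x) - f x))"
    unfolding eq by (simp only: circle_mean_def set_lebesgue_integral_def real_scaleR_def)
  have "(\<integral>x. circle_mean (?F x) \<partial>?M) = circle_mean (\<lambda>\<theta>. \<integral>x. ?F x \<theta> \<partial>?M)"
    by (rule sphere_circle_Fubini[OF int])
  also have "\<dots> = circle_mean (\<lambda>\<theta>. - 1 * pair_energy i j f \<theta>)"
    by (simp add: pair_energy_eq[OF f])
  also have "\<dots> = - circle_mean (pair_energy i j f)"
    by (subst circle_mean_mult) simp
  finally show "(\<integral>x. f x * circle_mean (\<lambda>\<theta>. f (kac_rotation i j \<theta> x) - f x) \<partial>?M) =
       - circle_mean (pair_energy i j f)"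
    unfolding eq .
qed

lemma kac_generator_eq:
  "kac_generator f (x :: real ^ 'n) = 1 / (2 * real CARD('n)) *
     (\<Sum>i\<in>UNIV. \<Sum>j\<in>UNIV. circle_mean (\<lambda>\<theta>. f (kac_rotation i j \<theta> x) - f x))"
  by (simp add: kac_generator_def circle_mean_def)

lemma dirichlet_form:
  fixes f :: "real ^ 'n \<Rightarrow> real"
  assumes f: "f \<in> L2_sphere"
  shows "(\<integral>x. f x * (- kac_generator f x) \<partial>\<nu>) = kac_form f / (2 * real CARD('n))"
proof -
  let ?c = "1 / (2 * real CARD('n))"
  let ?t = "\<lambda>i j x. f x * circle_mean (\<lambda>\<theta>. f (kac_rotation i j \<theta> x) - f x)"
  have "f x * (- kac_generator f x) = - ?c * (\<Sum>i\<in>UNIV. \<Sum>j\<in>UNIV. ?t i j x)" for x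
    unfolding kac_generator_eq by (simp add: sum_distrib_left[symmetric])
  then have "(\<integral>x. f x * (- kac_generator f x) \<partial>\<nu>) =
      - ?c * (\<integral>x. (\<Sum>i\<in>UNIV. \<Sum>j\<in>UNIV. ?t i j x) \<partial>\<nu>)"
    by (simp only: integral_mult_right_zero)
  also have "(\<integral>x. (\<Sum>i\<in>UNIV. \<Sum>j\<in>UNIV. ?t i j x) \<partial>\<nu>) =
      (\<Sum>i\<in>UNIV. \<Sum>j\<in>UNIV. \<integral>x. ?t i j x \<partial>\<nu>)"
    using pair_energy_integrable(2)[OF f]
    by (subst Bochner_Integration.integral_sum) (auto intro!: sum.cong Bochner_Integration.integral_sum)
  also have "\<dots> = - kac_form f"
    unfolding pair_energy_integrable(3)[OF f] kac_form_def by (simp add: sum_negf)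
  finally show ?thesis by simp
qed

lemma kac_form_poly_fun:
  fixes f :: "real ^ 'n \<Rightarrow> real"
  assumes f: "poly_fun f"
  shows "kac_form f = nu_inner f (kac_op f)"
proof -
  have "circle_mean (pair_energy i j f) = nu_inner f (kac_diff i j f)" for i j
  proof -
    have "circle_mean (\<lambda>\<theta>. f (kac_rotation i j \<theta> x) - f x) = - kac_diff i j f x" for x
    proof -
      have "continuous_on UNIV (\<lambda>\<theta>. f (kac_rotation i j \<theta> x))"
        by (intro continuous_on_orbit continuous_on_poly_fun f)
      then show ?thesis
        using circle_mean_add[of "\<lambda>\<theta>. f (kac_rotation i j \<theta> x)" "\<lambda>_. - f x"]
        by (simp add: kac_diff_def kac_avg_def)
    qed
    then show ?thesis
      using pair_energy_integrable(3)[OF L2_functions_poly_fun[OF f], of i j]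
      by (simp add: nu_inner_def)
  qed
  then show ?thesis
    using f by (simp add: kac_form_def kac_op_def)
qed

section \<open>The spectral gap\<close>

text \<open>The weight keeps the factor of the main term arbitrarily close to 1; a factor 2 there
  would destroy the sharp constant in the limit.\<close>

lemma square_add_le_weighted:
  fixes a b \<epsilon> :: real
  assumes "\<epsilon> > 0"
  shows "(a + b)\<^sup>2 \<le> (1 + \<epsilon>) * a\<^sup>2 + (1 + 1 / \<epsilon>) * b\<^sup>2"
proof -
  have "0 \<le> (\<epsilon> * a - b)\<^sup>2 / \<epsilon>" using assms by simp
  also have "(\<epsilon> * a - b)\<^sup>2 / \<epsilon> = \<epsilon> * a\<^sup>2 - 2 * (a * b) + 1 / \<epsilon> * b\<^sup>2"
    using assms by (simp add: power2_eq_square field_simps)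
  finally show ?thesis
    by (simp add: power2_sum distrib_right)
qed

lemma L2_add_weighted:
  fixes f g :: "'a \<Rightarrow> real"
  assumes f: "f \<in> L2_functions M" and g: "g \<in> L2_functions M" and \<epsilon>: "\<epsilon> > 0"
  shows "(\<integral>x. (f x + g x)\<^sup>2 \<partial>M) \<le> (1 + \<epsilon>) * (\<integral>x. (f x)\<^sup>2 \<partial>M) + (1 + 1 / \<epsilon>) * (\<integral>x. (g x)\<^sup>2 \<partial>M)"
proof -
  have i: "integrable M (\<lambda>x. (f x)\<^sup>2)" "integrable M (\<lambda>x. (g x)\<^sup>2)" "integrable M (\<lambda>x. (f x + g x)\<^sup>2)"
    using f g L2_functions_add[OF f g] by (auto simp: L2_functions_def)
  have "(\<integral>x. (f x + g x)\<^sup>2 \<partial>M) \<le> (\<integral>x. (1 + \<epsilon>) * (f x)\<^sup>2 + (1 + 1 / \<epsilon>) * (g x)\<^sup>2 \<partial>M)"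
    using i by (intro integral_mono square_add_le_weighted[OF \<epsilon>]) auto
  then show ?thesis using i by simp
qed

lemma circle_mean_mono:
  assumes "set_integrable lborel {0..2 * pi} f" "set_integrable lborel {0..2 * pi} g" "\<And>\<theta>. f \<theta> \<le> g \<theta>"
  shows "circle_mean f \<le> circle_mean g"
  unfolding circle_mean_def using assms
  by (intro mult_left_mono set_integral_mono) auto

lemma pair_energy_nonneg: "0 \<le> pair_energy i j f \<theta>"
  by (simp add: pair_energy_def)

lemma kac_form_nonneg: "0 \<le> kac_form f"
proof -
  have "0 \<le> circle_mean (pair_energy i j f)" for i j
    unfolding circle_mean_def set_lebesgue_integral_def
    by (intro mult_nonneg_nonneg Bochner_Integration.integral_nonneg)
      (simp_all add: pair_energy_nonneg)
  then show ?thesis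
    by (simp add: kac_form_def sum_nonneg)
qed

text \<open>There are \<open>N * N\<close> ordered pairs, and the pair energy of
  \<open>f - g\<close> is at most twice the squared distance, because rotations preserve the
  norm.\<close>

lemma kac_form_perturb:
  fixes f g :: "real ^ 'n \<Rightarrow> real"
  assumes f: "f \<in> L2_sphere" and g: "g \<in> L2_sphere" and \<epsilon>: "\<epsilon> > 0"
  shows "kac_form g \<le> (1 + \<epsilon>) * kac_form f +
    (1 + 1 / \<epsilon>) * (2 * (real CARD('n))\<^sup>2 * sq_dist f g)"
proof -
  let ?d = "\<integral>x. (f x - g x)\<^sup>2 \<partial>\<nu>"
  have fg: "(\<lambda>x. f x - g x) \<in> L2_sphere"
    using f g by (rule L2_functions_diff)
  have point: "pair_energy i j g \<theta> \<le> (1 + \<epsilon>) * pair_energy i j f \<theta> + (1 + 1 / \<epsilon>) * (2 * ?d)" for i j \<theta>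
  proof -
    let ?R = "kac_rotation i j \<theta>"
    let ?h = "\<lambda>x. (f x - g x) - (f (?R x) - g (?R x))"
    note fgR = L2_rotation[OF fg, of i j \<theta>]
    have df: "(\<lambda>x. f x - f (?R x)) \<in> L2_sphere"
      using f L2_rotation(1)[OF f] by (rule L2_functions_diff)
    have dh: "?h \<in> L2_sphere"
      using fg fgR(1) by (rule L2_functions_diff)
    have "(\<integral>x. (g x - g (?R x))\<^sup>2 \<partial>\<nu>) =
        (\<integral>x. ((f x - f (?R x)) + - 1 * ?h x)\<^sup>2 \<partial>\<nu>)"
      by (simp add: algebra_simps)
    also have "\<dots> \<le> (1 + \<epsilon>) * (\<integral>x. (f x - f (?R x))\<^sup>2 \<partial>\<nu>) +
        (1 + 1 / \<epsilon>) * (\<integral>x. (- 1 * ?h x)\<^sup>2 \<partial>\<nu>)"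
      by (rule L2_add_weighted[OF df L2_functions_mult[OF dh] \<epsilon>])
    finally have 1: "(\<integral>x. (g x - g (?R x))\<^sup>2 \<partial>\<nu>) \<le>
        (1 + \<epsilon>) * (\<integral>x. (f x - f (?R x))\<^sup>2 \<partial>\<nu>) +
        (1 + 1 / \<epsilon>) * (\<integral>x. (- 1 * ?h x)\<^sup>2 \<partial>\<nu>)" .
    \<comment> \<open>The difference of \<open>f - g\<close> and its rotated copy: two terms of
      equal squared norm, each doubled.\<close>
    have "(\<integral>x. (- 1 * ?h x)\<^sup>2 \<partial>\<nu>) \<le> 4 * ?d"
    proof -
      have "(\<integral>x. (?h x)\<^sup>2 \<partial>\<nu>) =
          (\<integral>x. ((f x - g x) + - 1 * (f (?R x) - g (?R x)))\<^sup>2 \<partial>\<nu>)"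
        by (simp only: mult_minus1 diff_conv_add_uminus)
      also have "\<dots> \<le> 2 * ?d + 2 * (\<integral>x. (- 1 * (f (?R x) - g (?R x)))\<^sup>2 \<partial>\<nu>)"
        using fg L2_functions_mult[OF fgR(1), of "- 1"] unfolding L2_functions_def
        by (intro integrable_square_add) auto
      also have "(\<integral>x. (- 1 * (f (?R x) - g (?R x)))\<^sup>2 \<partial>\<nu>) = ?d"
        using fgR(2) by (simp add: power2_commute)
      finally show ?thesis
        by (simp add: power2_commute)
    qed
    then have "(1 + 1 / \<epsilon>) * (\<integral>x. (- 1 * ?h x)\<^sup>2 \<partial>\<nu>) \<le> (1 + 1 / \<epsilon>) * (4 * ?d)"
      using \<epsilon> by (intro mult_left_mono) auto
    with 1 have 2: "(\<integral>x. (g x - g (?R x))\<^sup>2 \<partial>\<nu>) \<le>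
        (1 + \<epsilon>) * (\<integral>x. (f x - f (?R x))\<^sup>2 \<partial>\<nu>) + (1 + 1 / \<epsilon>) * (4 * ?d)"
      by linarith
    have "G / 2 \<le> m * (A / 2) + k * (2 * d)" if "G \<le> m * A + k * (4 * d)" for G m A k d :: real
      using that by (simp add: field_simps)
    from this[OF 2] show ?thesis
      by (simp only: pair_energy_def)
  qed
  have mean: "circle_mean (pair_energy i j g) \<le> (1 + \<epsilon>) * circle_mean (pair_energy i j f) +
      (1 + 1 / \<epsilon>) * (2 * ?d)" for i j
  proof -
    let ?c = "(1 + 1 / \<epsilon>) * (2 * ?d)"
    note If = pair_energy_integrable(1)[OF f, of i j]
    have Ic: "set_integrable lborel {0..2 * pi} (\<lambda>_ :: real. ?c)"
      by (intro set_integrable_circle continuous_intros)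
    have Isum: "set_integrable lborel {0..2 * pi} (\<lambda>\<theta>. (1 + \<epsilon>) * pair_energy i j f \<theta> + ?c)"
      using If Ic by (intro set_integral_add) auto
    have "circle_mean (pair_energy i j g) \<le> circle_mean (\<lambda>\<theta>. (1 + \<epsilon>) * pair_energy i j f \<theta> + ?c)"
      by (rule circle_mean_mono[OF pair_energy_integrable(1)[OF g] Isum point])
    also have "\<dots> = circle_mean (\<lambda>\<theta>. (1 + \<epsilon>) * pair_energy i j f \<theta>) + circle_mean (\<lambda>_. ?c)"
    proof -
      have "(LINT \<theta>:{0..2 * pi}|lborel. (1 + \<epsilon>) * pair_energy i j f \<theta> + ?c) =
          (LINT \<theta>:{0..2 * pi}|lborel. (1 + \<epsilon>) * pair_energy i j f \<theta>) + (LINT \<theta>:{0..2 * pi}|lborel. ?c)"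
        by (rule set_integral_add(2)[OF _ Ic]) (use If in auto)
      then show ?thesis by (simp only: circle_mean_def distrib_left)
    qed
    finally show ?thesis by (simp only: circle_mean_mult circle_mean_const)
  qed
  have "kac_form g \<le> (\<Sum>i\<in>UNIV. \<Sum>j\<in>UNIV. (1 + \<epsilon>) * circle_mean (pair_energy i j f) + (1 + 1 / \<epsilon>) * (2 * ?d))"
    unfolding kac_form_def by (intro sum_mono mean)
  also have "\<dots> = (1 + \<epsilon>) * kac_form f + real CARD('n) * (real CARD('n) * ((1 + 1 / \<epsilon>) * (2 * ?d)))"
    by (simp only: sum.distrib sum_distrib_left[symmetric] kac_form_def sum_constant)
      (simp only: mult_ac)
  finally show ?thesis
    by (simp add: power2_eq_square mult_ac)
qed

lemma L2_functions_integrable: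
  assumes "f \<in> (L2_sphere :: (real ^ 'n \<Rightarrow> real) set)"
  shows "integrable \<nu> f"
proof -
  have "(\<lambda>_. 1) \<in> (L2_sphere :: (real ^ 'n \<Rightarrow> real) set)"
    by (intro L2_functions_continuous continuous_intros)
  from L2_functions_integrable_mult[OF assms this] show ?thesis by simp
qed

text \<open>Subtracting the mean \<open>m\<close> from an approximating polynomial does not worsen
  the approximation: since \<open>f\<close> has mean 0, the squared distance drops by the square of
  \<open>m\<close>.\<close>

lemma poly_fun_mean_zero_approx:
  fixes f :: "real ^ 'n \<Rightarrow> real"
  assumes f: "f \<in> L2_sphere" and mean: "(\<integral>x. f x \<partial>\<nu>) = 0" and \<delta>: "\<delta> > 0"
  obtains p where "poly_fun p" "(\<integral>x. p x \<partial>\<nu>) = 0"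
    "sq_dist f p < \<delta>"
proof -
  interpret prob_space "\<nu> :: (real ^ 'n) measure"
    by (rule prob_space_sphere_measure)
  obtain p where p: "poly_fun p" "sq_dist f p < \<delta>"
    using L2_functions_approx[OF f] \<delta> by (auto simp: poly_approx_def)
  define m where "m = (\<integral>x. p x \<partial>\<nu>)"
  define q where "q = p - (\<lambda>_. m)"
  have q: "poly_fun q" using p(1) by (simp add: q_def)
  have ip: "integrable \<nu> p" using p(1) by simp
  have "(\<integral>x. q x \<partial>\<nu>) = 0"
    using ip by (simp add: q_def m_def prob_space)
  moreover have "sq_dist f q < \<delta>"
  proof -
    have fp: "(\<lambda>x. f x - p x) \<in> L2_sphere"
      using f L2_functions_poly_fun[OF p(1)] by (rule L2_functions_diff)
    have i: "integrable \<nu> (\<lambda>x. (f x - p x)\<^sup>2)" "integrable \<nu> (\<lambda>x. f x - p x)"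
      using fp L2_functions_integrable[OF fp] by (auto simp: L2_functions_def)
    have "sq_dist f q =
        (\<integral>x. (f x - p x)\<^sup>2 + 2 * m * (f x - p x) + m\<^sup>2 \<partial>\<nu>)"
      by (intro Bochner_Integration.integral_cong refl)
        (simp add: q_def power2_eq_square algebra_simps)
    also have "\<dots> = sq_dist f p + 2 * m * (\<integral>x. f x - p x \<partial>\<nu>) + m\<^sup>2"
      using i by (simp add: prob_space)
    also have "(\<integral>x. f x - p x \<partial>\<nu>) = - m"
      using ip L2_functions_integrable[OF f] mean by (simp add: m_def)
    also have "sq_dist f p + 2 * m * - m + m\<^sup>2 \<le>
        sq_dist f p"
      by (simp add: power2_eq_square)
    finally show ?thesis using p(2) by simp
  qed
  ultimately show ?thesis using q by (intro that)
qed

text \<open>The polynomial inequality is transferred with a loss of \<open>\<epsilon> * K\<close>,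
  where \<open>K\<close> depends only on \<open>f\<close> and \<open>N\<close>.\<close>

theorem kac_form_lower_bound:
  fixes f :: "real ^ 'n \<Rightarrow> real"
  assumes f: "f \<in> L2_sphere" and mean: "(\<integral>x. f x \<partial>\<nu>) = 0"
    and N: "CARD('n) \<ge> 2"
  shows "(real CARD('n) + 2) / 2 * sq_norm f \<le> kac_form f"
proof (rule field_le_epsilon)
  fix e :: real assume e: "e > 0"
  define l where "l = (real CARD('n) + 2) / 2"
  define n2 where "n2 = 2 * (real CARD('n))\<^sup>2"
  \<comment> \<open>Collects the error terms of the final estimate: 3 from
    \<open>(1 + \<epsilon>) * (1 + \<epsilon>) \<le> 1 + 3 * \<epsilon>\<close>, 4 from
    \<open>2 * (n2 * (2 * \<epsilon>))\<close>, and 2 from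
    \<open>l * (2 * \<epsilon>)\<close>.\<close>
  define K where "K = 3 * kac_form f + 4 * n2 + 2 * l"
  have l: "l \<ge> 0" and n2: "n2 \<ge> 0" by (simp_all add: l_def n2_def)
  then have K: "K \<ge> 0" using kac_form_nonneg[of f] by (simp add: K_def)
  define \<epsilon> where "\<epsilon> = min 1 (e / (K + 1))"
  have \<epsilon>: "\<epsilon> > 0" "\<epsilon> \<le> 1" "\<epsilon> \<le> e / (K + 1)"
    using e K by (auto simp: \<epsilon>_def)
  have "\<epsilon>\<^sup>2 > 0" using \<epsilon> by simp
  then obtain p where p: "poly_fun p" "(\<integral>x. p x \<partial>\<nu>) = 0"
    "sq_dist f p < \<epsilon>\<^sup>2"
    using poly_fun_mean_zero_approx[OF f mean] by blast
  let ?d = "\<integral>x. (f x - p x)\<^sup>2 \<partial>\<nu>"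
  let ?P = "\<integral>x. (p x)\<^sup>2 \<partial>\<nu>"
  note pL = L2_functions_poly_fun[OF p(1)]
  \<comment> \<open>Accuracy \<open>\<epsilon>\<^sup>2\<close> in the approximation is chosen so
    that the weight \<open>1 + 1 / \<epsilon>\<close> still leaves an error of order
    \<open>\<epsilon>\<close>.\<close>
  have "(1 + 1 / \<epsilon>) * ?d \<le> (1 + 1 / \<epsilon>) * \<epsilon>\<^sup>2"
    using p(3) \<epsilon> by (intro mult_left_mono) auto
  also have "\<dots> = \<epsilon> * \<epsilon> + \<epsilon>"
    using \<epsilon> by (simp add: field_simps power2_eq_square)
  also have "\<dots> \<le> 1 * \<epsilon> + \<epsilon>"
    using \<epsilon> by (intro add_right_mono mult_right_mono) auto
  finally have d: "(1 + 1 / \<epsilon>) * ?d \<le> 2 * \<epsilon>" by simp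
  have "l * ?P \<le> kac_form p"
    using polynomial_spectral_gap[OF p(1,2) N] kac_form_poly_fun[OF p(1)]
    by (simp add: l_def nu_inner_def power2_eq_square)
  also have "\<dots> \<le> (1 + \<epsilon>) * kac_form f + (1 + 1 / \<epsilon>) * (n2 * ?d)"
    using kac_form_perturb[OF f pL \<epsilon>(1)] by (simp add: n2_def)
  also have "(1 + 1 / \<epsilon>) * (n2 * ?d) = n2 * ((1 + 1 / \<epsilon>) * ?d)"
    by (simp only: mult.left_commute)
  also have "\<dots> \<le> n2 * (2 * \<epsilon>)"
    using d n2 by (intro mult_left_mono)
  finally have P: "l * ?P \<le> (1 + \<epsilon>) * kac_form f + n2 * (2 * \<epsilon>)" by simp
  have "sq_norm f = (\<integral>x. (p x + (f x - p x))\<^sup>2 \<partial>\<nu>)" by simp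
  also have "\<dots> \<le> (1 + \<epsilon>) * ?P + (1 + 1 / \<epsilon>) * ?d"
    by (rule L2_add_weighted[OF pL L2_functions_diff[OF f pL] \<epsilon>(1)])
  also have "\<dots> \<le> (1 + \<epsilon>) * ?P + 2 * \<epsilon>"
    using d by simp
  finally have "l * sq_norm f \<le> l * ((1 + \<epsilon>) * ?P + 2 * \<epsilon>)"
    using l by (intro mult_left_mono)
  also have "\<dots> = (1 + \<epsilon>) * (l * ?P) + l * (2 * \<epsilon>)"
    by (simp add: algebra_simps)
  also have "\<dots> \<le> (1 + \<epsilon>) * ((1 + \<epsilon>) * kac_form f + n2 * (2 * \<epsilon>)) + l * (2 * \<epsilon>)"
    using P \<epsilon> by (intro add_right_mono mult_left_mono) auto
  also have "\<dots> = (1 + \<epsilon>) * (1 + \<epsilon>) * kac_form f + (1 + \<epsilon>) * (n2 * (2 * \<epsilon>)) + l * (2 * \<epsilon>)"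
    by (simp add: distrib_left mult.assoc)
  also have "\<dots> \<le> (1 + 3 * \<epsilon>) * kac_form f + 2 * (n2 * (2 * \<epsilon>)) + l * (2 * \<epsilon>)"
  proof (intro add_right_mono add_mono mult_right_mono kac_form_nonneg)
    have "\<epsilon> * \<epsilon> \<le> 1 * \<epsilon>" using \<epsilon> by (intro mult_right_mono) auto
    then show "(1 + \<epsilon>) * (1 + \<epsilon>) \<le> 1 + 3 * \<epsilon>" by (simp add: algebra_simps)
  qed (use \<epsilon> n2 in auto)
  also have "\<dots> = kac_form f + \<epsilon> * K"
    by (simp add: K_def algebra_simps)
  also have "\<epsilon> * K \<le> e / (K + 1) * (K + 1)"
    using \<epsilon> K e by (intro mult_mono) auto
  also have "e / (K + 1) * (K + 1) = e"
    using K by simp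
  finally show "(real CARD('n) + 2) / 2 * sq_norm f \<le> kac_form f + e"
    by (simp add: l_def)
qed

section \<open>The extremal quartic and the value of the gap\<close>

definition quartic :: "real ^ 'n \<Rightarrow> real" where
  "quartic = (\<Sum>k\<in>UNIV. (\<lambda>x. (x $ k) ^ 4))"

lemma kac_avg_fourth_power:
  assumes "i \<noteq> j"
  shows "kac_avg i j (\<lambda>x. (x $ i) ^ 4) x = 3 / 8 * ((x $ i)\<^sup>2 + (x $ j)\<^sup>2)\<^sup>2"
proof -
  have "wallis 2 = 3 / 8"
    by (simp add: wallis_Suc numeral_2_eq_2)
  then have "circ 4 0 = 3 / 8"
    by (simp add: wallis_def)
  moreover have "sqrt ((x $ i)\<^sup>2 + (x $ j)\<^sup>2) ^ 4 = ((x $ i)\<^sup>2 + (x $ j)\<^sup>2)\<^sup>2"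
    using power_mult[of "sqrt ((x $ i)\<^sup>2 + (x $ j)\<^sup>2)" 2 2] by simp
  ultimately show ?thesis
    using circle_mean_rotated_monomial[of "x $ i" "x $ j" 4 0] assms
    by (simp add: kac_avg_def kac_rotation_nth)
qed

lemma kac_diff_quartic:
  assumes ij: "i \<noteq> j"
  shows "kac_diff i j quartic x = 1 / 4 * ((x $ i) ^ 4 + (x $ j) ^ 4) - 3 / 2 * ((x $ i)\<^sup>2 * (x $ j)\<^sup>2)"
proof -
  let ?p = "\<lambda>k x. (x $ k :: real) ^ 4"
  have "kac_avg i j quartic x = (\<Sum>k\<in>UNIV. kac_avg i j (?p k) x)"
    by (simp add: quartic_def kac_avg_sum)
  also have "\<dots> = kac_avg i j (?p i) x + kac_avg i j (?p j) x + (\<Sum>k\<in>UNIV - {i, j}. kac_avg i j (?p k) x)"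
    by (rule sum_split2[OF ij])
  also have "kac_avg i j (?p i) x = 3 / 8 * ((x $ i)\<^sup>2 + (x $ j)\<^sup>2)\<^sup>2"
    by (rule kac_avg_fourth_power[OF ij])
  also have "kac_avg i j (?p j) = kac_avg j i (?p j)"
    by (intro kac_avg_swap) simp
  also have "kac_avg j i (?p j) x = 3 / 8 * ((x $ i)\<^sup>2 + (x $ j)\<^sup>2)\<^sup>2"
    using kac_avg_fourth_power[of j i] ij by (simp add: add.commute)
  also have "(\<Sum>k\<in>UNIV - {i, j}. kac_avg i j (?p k) x) = (\<Sum>k\<in>UNIV - {i, j}. ?p k x)"
  proof (intro sum.cong refl)
    fix k assume "k \<in> UNIV - {i, j}"
    then have "rot_invariant i j (?p k)"
      using ij by (simp add: rot_invariant_def kac_rotation_nth)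
    then show "kac_avg i j (?p k) x = ?p k x" by (simp add: kac_avg_invariant)
  qed
  finally have avg: "kac_avg i j quartic x =
      3 / 4 * ((x $ i)\<^sup>2 + (x $ j)\<^sup>2)\<^sup>2 + (\<Sum>k\<in>UNIV - {i, j}. ?p k x)" by simp
  have "quartic x = ?p i x + ?p j x + (\<Sum>k\<in>UNIV - {i, j}. ?p k x)"
    using sum_split2[OF ij, of "\<lambda>k. ?p k x"] by (simp add: quartic_def)
  then have "kac_diff i j quartic x = ?p i x + ?p j x - 3 / 4 * ((x $ i)\<^sup>2 + (x $ j)\<^sup>2)\<^sup>2"
    by (simp add: kac_diff_def avg)
  also have "((x $ i)\<^sup>2 + (x $ j)\<^sup>2)\<^sup>2 = ?p i x + ?p j x + 2 * ((x $ i)\<^sup>2 * (x $ j)\<^sup>2)"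
    by (simp add: power2_sum power_mult[symmetric])
  finally show ?thesis by (simp add: field_simps)
qed

lemma poly_fun_quartic [simp]: "poly_fun quartic"
  by (simp add: quartic_def)

lemma kac_op_quartic:
  fixes x :: "real ^ 'n"
  assumes "norm x = 1"
  shows "kac_op quartic x = (real CARD('n) + 2) / 2 * quartic x - 3 / 2"
proof -
  let ?t = "\<lambda>i j. 1 / 4 * ((x $ i) ^ 4 + (x $ j) ^ 4) - 3 / 2 * ((x $ i)\<^sup>2 * (x $ j)\<^sup>2)"
  have sq: "(\<Sum>i\<in>UNIV. (x $ i)\<^sup>2) = 1"
    using assms by (simp add: norm_vec_def L2_set_def)
  have q: "quartic x = (\<Sum>i\<in>UNIV. (x $ i) ^ 4)" by (simp add: quartic_def)
  \<comment> \<open>On the diagonal \<open>kac_diff\<close> is 0 while \<open>?t i i\<close> equals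
    minus the fourth power of the coordinate; the correction makes the formula valid for all pairs.
    It later contributes the extra \<open>quartic x\<close> that turns \<open>N / 2\<close> into
    \<open>(N + 2) / 2\<close>.\<close>
  have "kac_diff i j quartic x = ?t i j + (if j = i then (x $ i) ^ 4 else 0)" for i j
    using kac_diff_quartic[of i j x] by (cases "i = j") (simp_all add: power4_eq_xxxx power2_eq_square)
  then have "kac_op quartic x = (\<Sum>i\<in>UNIV. \<Sum>j\<in>UNIV. ?t i j + (if j = i then (x $ i) ^ 4 else 0))"
    by (simp add: kac_op_def)
  also have "\<dots> = (\<Sum>i\<in>UNIV. \<Sum>j\<in>UNIV. ?t i j) + quartic x"
    by (simp add: sum.distrib q)
  also have "(\<Sum>i\<in>UNIV. \<Sum>j\<in>UNIV. ?t i j) =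
      1 / 4 * (real CARD('n) * quartic x + real CARD('n) * quartic x) -
      3 / 2 * ((\<Sum>i\<in>UNIV. (x $ i)\<^sup>2) * (\<Sum>j\<in>UNIV. (x $ j)\<^sup>2))"
    by (simp only: sum_subtractf sum_distrib_left[symmetric] sum.distrib sum_product sum_constant q)
  finally show ?thesis
    unfolding sq by (simp add: field_simps)
qed

theorem kac_gap_eq:
  assumes N: "CARD('n::finite) \<ge> 2"
  shows "kac_gap TYPE('n) = (real CARD('n) + 2) / (4 * real CARD('n))"
proof -
  let ?n = "real CARD('n)"
  \<comment> \<open>The constant is \<open>3 / 2\<close> divided by the eigenvalue
    \<open>(N + 2) / 2\<close>, so that the inhomogeneous term in \<open>kac_op quartic\<close> is
    absorbed.\<close>
  define f :: "real ^ 'n \<Rightarrow> real" where "f = quartic - (\<lambda>_. 3 / (?n + 2))"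
  have f: "poly_fun f" by (simp add: f_def)
  have "kac_diff i j f = kac_diff i j quartic" for i j
  proof -
    have "kac_avg i j (\<lambda>_. 3 / (?n + 2)) = (\<lambda>_. 3 / (?n + 2))"
      by (intro kac_avg_invariant rot_invariant_const)
    then show ?thesis by (simp add: f_def kac_diff_def kac_avg_diff)
  qed
  then have "kac_op f = kac_op quartic" by (simp add: kac_op_def)
  then have op: "kac_op f x = (?n + 2) / 2 * f x" if "norm x = 1" for x
  proof -
    have "(?n + 2) / 2 * f x = (?n + 2) / 2 * quartic x - (?n + 2) / 2 * (3 / (?n + 2))"
      by (simp add: f_def right_diff_distrib)
    also have "(?n + 2) / 2 * (3 / (?n + 2)) = 3 / 2"
      by (simp add: field_simps)
    finally show ?thesis
      using kac_op_quartic[OF that] \<open>kac_op f = kac_op quartic\<close> by simp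
  qed
  \<comment> \<open>The mean of \<open>kac_op f\<close> is 0, and the eigenvalue is not, so the mean
    of \<open>f\<close> is 0; no moment of the sphere has to be computed.\<close>
  have "(\<integral>x. kac_op f x \<partial>\<nu>) = (\<integral>x. (?n + 2) / 2 * f x \<partial>\<nu>)"
    by (intro Bochner_Integration.integral_cong) (auto simp: op space_sphere_measure)
  then have mean: "(\<integral>x. f x \<partial>\<nu>) = 0"
    using nu_inner_one_kac_op[OF f] by (simp add: nu_inner_one)
  have nonzero: "\<not> (AE x in \<nu>. f x = 0)"
  proof
    assume "AE x in \<nu>. f x = 0"
    \<comment> \<open>At a basis vector the value is \<open>1 - 3 / (N + 2)\<close>, which is
      positive for \<open>N \<ge> 2\<close>.\<close>
    then have "f (axis i 1) = 0" for i
      by (intro continuous_eq_0_on_sphere continuous_on_poly_fun f) simp_all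
    moreover have "quartic (axis i 1 :: real ^ 'n) = 1" for i
      by (simp add: quartic_def axis_def if_distrib[of "\<lambda>x. x ^ 4"] cong: if_cong)
    ultimately show False using N by (simp add: f_def)
  qed
  have pos: "sq_norm g > 0"
    if g: "g \<in> L2_sphere" "\<not> (AE x in \<nu>. g x = 0)" for g :: "real ^ 'n \<Rightarrow> real"
  proof -
    have "sq_norm g \<noteq> 0"
      using g integral_nonneg_eq_0_iff_AE[of \<nu> "\<lambda>x. (g x)\<^sup>2"]
      by (auto simp: L2_functions_def)
    moreover have "sq_norm g \<ge> 0" by simp
    ultimately show ?thesis by linarith
  qed
  note fL = L2_functions_poly_fun[OF f]
  have "kac_form f = (\<integral>x. (?n + 2) / 2 * (f x)\<^sup>2 \<partial>\<nu>)"
    unfolding kac_form_poly_fun[OF f] nu_inner_def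
    by (intro Bochner_Integration.integral_cong refl)
      (simp add: op space_sphere_measure power2_eq_square)
  then have form: "kac_form f = (?n + 2) / 2 * sq_norm f"
    by simp
  let ?X = "{(\<integral>x. f x * (- kac_generator f x) \<partial>\<nu>) / sq_norm f
      | f :: real ^ 'n \<Rightarrow> real.
          f \<in> L2_sphere \<and> \<not> (AE x in \<nu>. f x = 0) \<and> (\<integral>x. f x \<partial>\<nu>) = 0}"
  show ?thesis
    unfolding kac_gap_def
  proof (rule cInf_eq_minimum)
    have "(?n + 2) / (4 * ?n) =
        (\<integral>x. f x * (- kac_generator f x) \<partial>\<nu>) / sq_norm f"
      unfolding dirichlet_form[OF fL] form using pos[OF fL nonzero] by (simp add: field_simps)
    then show "(?n + 2) / (4 * ?n) \<in> ?X"
      using fL nonzero mean by blast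
  next
    fix r
    assume "r \<in> ?X"
    then obtain g :: "real ^ 'n \<Rightarrow> real" where
      r: "r = (\<integral>x. g x * (- kac_generator g x) \<partial>\<nu>) / sq_norm g"
      and g: "g \<in> L2_sphere" "\<not> (AE x in \<nu>. g x = 0)"
        "(\<integral>x. g x \<partial>\<nu>) = 0"
      by blast
    have "(?n + 2) / 2 * sq_norm g \<le> kac_form g"
      by (rule kac_form_lower_bound[OF g(1,3) N])
    then have "(?n + 2) / 2 \<le> kac_form g / sq_norm g"
      using pos[OF g(1,2)] by (simp add: pos_le_divide_eq)
    then have "(?n + 2) / 2 / (2 * ?n) \<le> kac_form g / sq_norm g / (2 * ?n)"
      by (intro divide_right_mono) auto
    then show "(?n + 2) / (4 * ?n) \<le> r"
      unfolding r dirichlet_form[OF g(1)] by (simp add: mult_ac)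
  qed
qed

text \<open>The recursion follows from the closed formula: \<open>3 * (5 / 12) - 1 = 1 / 4\<close>,
  and \<open>(1 / 4) * (1 - 2 / N) + 1 / N = (N + 2) / (4 * N)\<close>.\<close>

theorem theorem1p1:
  fixes N :: nat
  assumes "N = CARD('n::finite)"
  shows "(N \<ge> 3 \<longrightarrow>
            kac_gap TYPE('n) = (3 * kac_gap TYPE(3) - 1) * (1 - 2 / real N) + 1 / real N) \<and>
         kac_gap TYPE(3) = 5 / 12 \<and>
         (N \<ge> 2 \<longrightarrow> kac_gap TYPE('n) = (real N + 2) / (4 * real N))"
proof (intro conjI impI)
  show three: "kac_gap TYPE(3) = 5 / 12"
    by (subst kac_gap_eq) simp_all
  show gap: "kac_gap TYPE('n) = (real N + 2) / (4 * real N)" if "N \<ge> 2"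
    using that assms kac_gap_eq[where 'n = 'n] by simp
  assume "N \<ge> 3"
  then show "kac_gap TYPE('n) = (3 * kac_gap TYPE(3) - 1) * (1 - 2 / real N) + 1 / real N"
    using gap by (simp add: three field_simps)
qed

end
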